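(* Let $\rho$ be a strongly cuspidal representation of $\mathrm{GL}_3(\mathfrak o_2)$, $\chi$ a character of $\mathfrak o_2^\times$, and $\pi=\mathrm{Ind}_Q^{\mathrm{GL}_4(\mathfrak o_2)}(\rho\otimes\chi)$, where $\rho\otimes\chi$ is regarded as a representation of $Q$ via $Q\twoheadrightarrow Q/U\cong\mathrm{GL}_3(\mathfrak o_2)\times\mathrm{GL}_1(\mathfrak o_2)$. Let $\omega_\pi$ be the character by which the centre of $\mathrm{GL}_4(\mathfrak o_2)$ acts on $\pi$. Then: (a) The degenerate Whittaker space $\pi_{N,\psi}$ consists of all the regular representations of $\mathrm{GL}_2(\mathfrak o_2)$ with central character $\omega_\pi$; i.e. the irreducible representations of $\mathrm{GL}_2(\mathfrak o_2)$ occurring in $\pi_{N,\psi}$ are exactly the irreducible regular representations with central character $\omega_\pi$. (b) $\pi_{N,\psi}$ is a multiplicity-free representation of $\mathrm{GL}_2(\mathfrak o_2)$.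
   Context: Let $F$ be a finite unramified extension of $\mathbb Q_p$ or of $\mathbb F_p((t))$, with $p$ odd, $\mathfrak o$ its ring of integers, $\varpi$ a uniformizer, $\mathfrak o/(\varpi)\cong\mathbb F_q$, and $\mathfrak o_2=\mathfrak o/(\varpi^2)$. All representations are finite-dimensional and complex. Fix an additive character $\psi_0:\mathfrak o_2\to\mathbb C^\times$ that is nontrivial on $\varpi\mathfrak o_2$; for $x\in\mathbb F_q$ write $\psi_0(x):=\psi_0(\varpi\tilde x)$ for any lift $\tilde x\in\mathfrak o_2$ of $x$. $Q\subset\mathrm{GL}_4(\mathfrak o_2)$ is the subgroup of matrices $\begin{pmatrix}h_1&Y\\0&h_2\end{pmatrix}$ with $h_1\in\mathrm{GL}_3(\mathfrak o_2)$, $h_2\in\mathrm{GL}_1(\mathfrak o_2)$, $Y\in M_{3\times1}(\mathfrak o_2)$, and $U$ is its subgroup $h_1=I_3,h_2=1$. $N\cong M_2(\mathfrak o_2)$ is the group of matrices $\begin{pmatrix}I_2&X\\0&I_2\end{pmatrix}$, and $\psi(X)=\psi_0(\mathrm{tr}\,X)$. The degenerate Whittaker space of a representation $(\pi,V)$ of $\mathrm{GL}_4(\mathfrak o_2)$ is $\pi_{N,\psi}=\{v\in V:\pi(n)v=\psi(n)v\ \forall n\in N\}$, a representation of $\mathrm{GL}_2(\mathfrak o_2)$ via $g\mapsto\mathrm{diag}(g,g)$. Central characters are viewed as characters of $\mathfrak o_2^\times$. For $B\in M_n(\mathbb F_q)$, $\phi_B(I_n+\varpi X)=\psi_0(\mathrm{tr}(B\bar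 X))$ ($\bar X$ the reduction mod $\varpi$) is a character of $I_n+\varpi M_n(\mathfrak o_2)$, and $I(\phi_B)$ is its stabilizer in $\mathrm{GL}_n(\mathfrak o_2)$ under conjugation. $B$ is regular if its characteristic and minimal polynomials coincide. An irreducible representation of $\mathrm{GL}_n(\mathfrak o_2)$ is regular if its restriction to $I_n+\varpi M_n(\mathfrak o_2)$ contains $\phi_B$ for some regular $B$. If $B$ is regular, $\phi_B$ extends to one-dimensional characters $\tilde\phi_B$ of $I(\phi_B)$ and $\mathrm{Ind}_{I(\phi_B)}^{\mathrm{GL}_n(\mathfrak o_2)}\tilde\phi_B$ is irreducible; it is called strongly cuspidal when the characteristic polynomial of $B$ is irreducible over $\mathbb F_q$. *)

theory Defs
  imports
    Complex_Main
    "HOL-Library.Function_Algebras"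
    "HOL-Computational_Algebra.Fraction_Field"
    "HOL-Computational_Algebra.Formal_Laurent_Series"
    "Jordan_Normal_Form.Char_Poly"
    "Berlekamp_Zassenhaus.Finite_Field"
begin

section \<open>The field of p-adic numbers\<close>

text \<open>The ring of p-adic integers is the inverse limit of the rings of integers modulo powers
  of \<open>p = CARD('p)\<close>; the \<open>n\<close>-th entry is the representative in \<open>{0..<p^n}\<close>.\<close>

typedef (overloaded) ('p :: prime_card) padic_int =
  "{x :: nat \<Rightarrow> int. \<forall>n. x (Suc n) mod int CARD('p) ^ n = x n}"
  by (rule exI[of _ "\<lambda>_. 0"]) simp

setup_lifting type_definition_padic_int

lemma mod_power_Suc_mod: "(a :: int) mod p ^ Suc n mod p ^ n = a mod p ^ n"
  by (rule mod_mod_cancel) simp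

lemma compat_mod_power:
  fixes x :: "nat \<Rightarrow> int"
  assumes "\<forall>n. x (Suc n) mod p ^ n = x n"
  shows "x n mod p ^ n = x n"
  using assms by (metis mod_mod_trivial)

lemma compat_mod_power_add:
  fixes x :: "nat \<Rightarrow> int"
  assumes "\<forall>n. x (Suc n) mod p ^ n = x n"
  shows "x (n + k) mod p ^ n = x n"
proof (induction k)
  case 0
  then show ?case using compat_mod_power[OF assms] by simp
next
  case (Suc k)
  have "x (n + k) mod p ^ n = x (Suc (n + k)) mod p ^ (n + k) mod p ^ n"
    using spec[OF assms, of "n + k"] by (simp only:)
  also have "\<dots> = x (Suc (n + k)) mod p ^ n"
    by (rule mod_mod_cancel) (simp add: le_imp_power_dvd)
  finally show ?case using Suc by simp
qed

instantiation padic_int :: (prime_card) comm_ring_1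
begin

lift_definition zero_padic_int :: "'a padic_int" is "\<lambda>_. 0" by simp

lift_definition one_padic_int :: "'a padic_int" is "\<lambda>n. 1 mod int CARD('a) ^ n"
  by (simp only: mod_power_Suc_mod simp_thms)

lift_definition plus_padic_int :: "'a padic_int \<Rightarrow> 'a padic_int \<Rightarrow> 'a padic_int"
  is "\<lambda>x y n. (x n + y n) mod int CARD('a) ^ n"
  by (simp only: mod_power_Suc_mod) (metis mod_add_eq)

lift_definition uminus_padic_int :: "'a padic_int \<Rightarrow> 'a padic_int"
  is "\<lambda>x n. (- x n) mod int CARD('a) ^ n"
  by (simp only: mod_power_Suc_mod) (metis mod_minus_eq)

lift_definition minus_padic_int :: "'a padic_int \<Rightarrow> 'a padic_int \<Rightarrow> 'a padic_int"
  is "\<lambda>x y n. (x n - y n) mod int CARD('a) ^ n"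
  by (simp only: mod_power_Suc_mod) (metis mod_diff_eq)

lift_definition times_padic_int :: "'a padic_int \<Rightarrow> 'a padic_int \<Rightarrow> 'a padic_int"
  is "\<lambda>x y n. (x n * y n) mod int CARD('a) ^ n"
  by (simp only: mod_power_Suc_mod) (metis mod_mult_eq)

instance
proof
  fix a b c :: "'a padic_int"
  show "a * b * c = a * (b * c)"
    by transfer (simp add: mod_simps mult.assoc)
  show "a * b = b * a"
    by transfer (simp add: mult.commute)
  show "1 * a = a"
    by transfer (simp add: mod_simps compat_mod_power)
  show "a + b + c = a + (b + c)"
    by transfer (simp add: mod_simps add.assoc)
  show "a + b = b + a"
    by transfer (simp add: add.commute)
  show "0 + a = a"
    by transfer (simp add: compat_mod_power)
  show "- a + a = 0"
    by transfer (simp add: mod_simps)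
  show "a - b = a + - b"
    by transfer (simp add: mod_simps)
  show "(a + b) * c = a * c + b * c"
    by transfer (simp add: mod_simps distrib_right)
  have "1 < int CARD('a)"
    using prime_gt_1_nat[OF prime_card[where ?'a = 'a]] by simp
  then show "(0 :: 'a padic_int) \<noteq> 1"
    by transfer (auto simp: fun_eq_iff intro!: exI[of _ 1])
qed

end

instance padic_int :: (prime_card) idom
proof
  fix a b :: "'a padic_int"
  assume "a \<noteq> 0" and "b \<noteq> 0"
  then show "a * b \<noteq> 0"
  proof transfer
    fix x y :: "nat \<Rightarrow> int"
    let ?p = "int CARD('a)"
    assume x: "\<forall>n. x (Suc n) mod ?p ^ n = x n" and y: "\<forall>n. y (Suc n) mod ?p ^ n = y n"
      and "x \<noteq> (\<lambda>_. 0)" and "y \<noteq> (\<lambda>_. 0)"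
    then obtain m k where m: "x m \<noteq> 0" and k: "y k \<noteq> 0" by fast
    have p: "prime ?p" using prime_card[where ?'a = 'a] by simp
    let ?X = "x (m + k)" and ?Y = "y (m + k)"
    have X: "\<not> ?p ^ m dvd ?X"
      using m compat_mod_power_add[OF x, of m k] by (simp add: dvd_eq_mod_eq_0)
    have Y: "\<not> ?p ^ k dvd ?Y"
      using k compat_mod_power_add[OF y, of k m] by (simp add: dvd_eq_mod_eq_0 add.commute)
    have nz: "?X \<noteq> 0" "?Y \<noteq> 0" using X Y by auto
    have "multiplicity ?p ?X < m"
    proof (rule ccontr)
      assume "\<not> ?thesis"
      then have "?p ^ m dvd ?X" by (intro multiplicity_dvd') simp
      with X show False ..
    qed
    moreover have "multiplicity ?p ?Y < k"
    proof (rule ccontr)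
      assume "\<not> ?thesis"
      then have "?p ^ k dvd ?Y" by (intro multiplicity_dvd') simp
      with Y show False ..
    qed
    moreover have "multiplicity ?p (?X * ?Y) = multiplicity ?p ?X + multiplicity ?p ?Y"
      using nz p by (intro prime_elem_multiplicity_mult_distrib) auto
    ultimately have less: "multiplicity ?p (?X * ?Y) < m + k" by linarith
    have "\<not> ?p ^ (m + k) dvd ?X * ?Y"
    proof
      assume "?p ^ (m + k) dvd ?X * ?Y"
      then have "m + k \<le> multiplicity ?p (?X * ?Y)"
        using nz p by (intro multiplicity_geI) (auto simp: not_prime_unit)
      with less show False by simp
    qed
    then have "(?X * ?Y) mod ?p ^ (m + k) \<noteq> 0"
      by (simp add: dvd_eq_mod_eq_0)
    then show "(\<lambda>n. x n * y n mod ?p ^ n) \<noteq> (\<lambda>_. 0)"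
      unfolding fun_eq_iff by blast
  qed
qed

type_synonym 'p padic = "'p padic_int fract"

definition padic_integers :: "'p :: prime_card padic set" where
  "padic_integers = range (\<lambda>a. Fraction_Field.Fract a 1)"


section \<open>Unramified extensions and their integers\<close>

definition integral_closure :: "('a :: field \<Rightarrow> 'f :: field) \<Rightarrow> 'a set \<Rightarrow> 'f set" where
  "integral_closure \<iota> A =
     {x. \<exists>P. monic P \<and> (\<forall>i. Polynomial.coeff P i \<in> A) \<and> poly (map_poly \<iota> P) x = 0}"

text \<open>\<open>t\<close> generates the maximal ideal, i.e.\ the ideal of nonunits, of the local domain \<open>R\<close>.\<close>

definition uniformizer :: "'f :: field set \<Rightarrow> 'f \<Rightarrow> bool" where
  "uniformizer R t \<longleftrightarrow>
     t \<noteq> 0 \<and> {t * x | x. x \<in> R} = {x \<in> R. \<not> (\<exists>y \<in> R. x * y = 1)}"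

definition finite_extension :: "('a :: field \<Rightarrow> 'f :: field) \<Rightarrow> bool" where
  "finite_extension \<iota> \<longleftrightarrow>
     field_hom \<iota> \<and> (\<exists>B. finite B \<and> Modules.module.span (\<lambda>c x. \<iota> c * x) B = UNIV)"

text \<open>Residue fields being finite here, an extension is unramified iff its ramification index is
  one, i.e.\ iff a uniformizer \<open>t\<close> of the base remains a uniformizer.\<close>

definition finite_unramified_extension ::
    "('a :: field \<Rightarrow> 'f :: field) \<Rightarrow> 'a set \<Rightarrow> 'a \<Rightarrow> bool" where
  "finite_unramified_extension \<iota> A t \<longleftrightarrow>
     finite_extension \<iota> \<and> uniformizer (integral_closure \<iota> A) (\<iota> t)"

text \<open>The type \<open>'f\<close> is a finite unramified extension of the p-adic numbers or of the field of
  Laurent series over the field with \<open>p = CARD('p)\<close> elements, with ring of integers \<open>R\<close>.\<close>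

definition integers_of_unramified_extension ::
    "'p :: prime_card itself \<Rightarrow> 'f :: field set \<Rightarrow> bool" where
  "integers_of_unramified_extension _ R \<longleftrightarrow>
     (\<exists>\<iota> :: 'p padic \<Rightarrow> 'f.
        finite_unramified_extension \<iota> padic_integers (of_nat CARD('p)) \<and>
        R = integral_closure \<iota> padic_integers) \<or>
     (\<exists>\<iota> :: 'p mod_ring fls \<Rightarrow> 'f.
        finite_unramified_extension \<iota> (range fps_to_fls) fls_X \<and>
        R = integral_closure \<iota> (range fps_to_fls))"

text \<open>\<open>h\<close>, restricted to the subring \<open>R\<close>, exhibits its codomain as \<open>R / (a)\<close>.\<close>

definition quotient_map :: "'f :: field set \<Rightarrow> 'f \<Rightarrow> ('f \<Rightarrow> 'r :: comm_ring_1) \<Rightarrow> bool" where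
  "quotient_map R a h \<longleftrightarrow>
     h ` R = UNIV \<and> h 1 = 1 \<and>
     (\<forall>x\<in>R. \<forall>y\<in>R. h (x + y) = h x + h y \<and> h (x * y) = h x * h y) \<and>
     (\<forall>x\<in>R. h x = 0 \<longleftrightarrow> (\<exists>y\<in>R. x = a * y))"


section \<open>Complex representations\<close>

text \<open>The underlying space is a subspace of the complex vector space given by the whole type
  \<open>'v\<close> with scalar multiplication \<open>rep_scale\<close>.\<close>

record ('g, 'v) rep =
  rep_space :: "'v set"
  rep_scale :: "complex \<Rightarrow> 'v \<Rightarrow> 'v"
  rep_act :: "'g \<Rightarrow> 'v \<Rightarrow> 'v"

definition invariant_subspace ::
    "('g, 'b) monoid_scheme \<Rightarrow> ('g, 'v :: ab_group_add) rep \<Rightarrow> 'v set \<Rightarrow> bool" where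
  "invariant_subspace G \<pi> W \<longleftrightarrow>
     Modules.module.subspace (rep_scale \<pi>) W \<and> W \<subseteq> rep_space \<pi> \<and>
     (\<forall>g\<in>carrier G. \<forall>w\<in>W. rep_act \<pi> g w \<in> W)"

definition finite_dim_rep ::
    "('g, 'b) monoid_scheme \<Rightarrow> ('g, 'v :: ab_group_add) rep \<Rightarrow> bool" where
  "finite_dim_rep G \<pi> \<longleftrightarrow>
     Vector_Spaces.vector_space (rep_scale \<pi>) \<and>
     (\<exists>B. finite B \<and> rep_space \<pi> = Modules.module.span (rep_scale \<pi>) B) \<and>
     invariant_subspace G \<pi> (rep_space \<pi>) \<and>
     (\<forall>g\<in>carrier G. \<forall>v\<in>rep_space \<pi>. \<forall>w\<in>rep_space \<pi>.
        rep_act \<pi> g (v + w) = rep_act \<pi> g v + rep_act \<pi> g w) \<and>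
     (\<forall>g\<in>carrier G. \<forall>c. \<forall>v\<in>rep_space \<pi>.
        rep_act \<pi> g (rep_scale \<pi> c v) = rep_scale \<pi> c (rep_act \<pi> g v)) \<and>
     (\<forall>v\<in>rep_space \<pi>. rep_act \<pi> \<one>\<^bsub>G\<^esub> v = v) \<and>
     (\<forall>g\<in>carrier G. \<forall>h\<in>carrier G. \<forall>v\<in>rep_space \<pi>.
        rep_act \<pi> (g \<otimes>\<^bsub>G\<^esub> h) v = rep_act \<pi> g (rep_act \<pi> h v))"

definition irreducible_rep ::
    "('g, 'b) monoid_scheme \<Rightarrow> ('g, 'v :: ab_group_add) rep \<Rightarrow> bool" where
  "irreducible_rep G \<pi> \<longleftrightarrow>
     finite_dim_rep G \<pi> \<and> rep_space \<pi> \<noteq> {0} \<and>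
     (\<forall>W. invariant_subspace G \<pi> W \<longrightarrow> W = {0} \<or> W = rep_space \<pi>)"

definition intertwiner ::
    "('g, 'b) monoid_scheme \<Rightarrow> ('g, 'v :: ab_group_add) rep \<Rightarrow> ('g, 'w :: ab_group_add) rep
      \<Rightarrow> ('v \<Rightarrow> 'w) \<Rightarrow> bool" where
  "intertwiner G \<sigma> \<pi> T \<longleftrightarrow>
     T ` rep_space \<sigma> \<subseteq> rep_space \<pi> \<and>
     (\<forall>v\<in>rep_space \<sigma>. \<forall>w\<in>rep_space \<sigma>. T (v + w) = T v + T w) \<and>
     (\<forall>c. \<forall>v\<in>rep_space \<sigma>. T (rep_scale \<sigma> c v) = rep_scale \<pi> c (T v)) \<and>
     (\<forall>g\<in>carrier G. \<forall>v\<in>rep_space \<sigma>. T (rep_act \<sigma> g v) = rep_act \<pi> g (T v))"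

definition equivalent_reps ::
    "('g, 'b) monoid_scheme \<Rightarrow> ('g, 'v :: ab_group_add) rep \<Rightarrow> ('g, 'w :: ab_group_add) rep
      \<Rightarrow> bool" where
  "equivalent_reps G \<sigma> \<pi> \<longleftrightarrow>
     (\<exists>T. intertwiner G \<sigma> \<pi> T \<and> bij_betw T (rep_space \<sigma>) (rep_space \<pi>))"

definition subrep :: "('g, 'v) rep \<Rightarrow> 'v set \<Rightarrow> ('g, 'v) rep" where
  "subrep \<pi> W = \<pi>\<lparr>rep_space := W\<rparr>"

definition occurs_in ::
    "('g, 'b) monoid_scheme \<Rightarrow> ('g, 'w :: ab_group_add) rep \<Rightarrow> ('g, 'v :: ab_group_add) rep
      \<Rightarrow> bool" where
  "occurs_in G \<sigma> \<pi> \<longleftrightarrow>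
     (\<exists>W. invariant_subspace G \<pi> W \<and> equivalent_reps G \<sigma> (subrep \<pi> W))"

text \<open>The dimension of the space of intertwiners. Only values on \<open>rep_space \<sigma>\<close> matter, so an
  intertwiner is normalised to vanish elsewhere; addition is that of \<^theory>\<open>HOL-Library.Function_Algebras\<close>.\<close>

definition multiplicity_in ::
    "('g, 'b) monoid_scheme \<Rightarrow> ('g, 'w :: ab_group_add) rep \<Rightarrow> ('g, 'v :: ab_group_add) rep
      \<Rightarrow> nat" where
  "multiplicity_in G \<sigma> \<pi> =
     Vector_Spaces.vector_space.dim (\<lambda>c T w. rep_scale \<pi> c (T w))
       {T. intertwiner G \<sigma> \<pi> T \<and> (\<forall>w. w \<notin> rep_space \<sigma> \<longrightarrow> T w = 0)}"

text \<open>An irreducible representation occurring in \<open>\<pi>\<close> is, up to isomorphism, carried by an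
  invariant subspace, so it suffices to range over these.\<close>

definition multiplicity_free ::
    "('g, 'b) monoid_scheme \<Rightarrow> ('g, 'v :: ab_group_add) rep \<Rightarrow> bool" where
  "multiplicity_free G \<pi> \<longleftrightarrow>
     (\<forall>W. invariant_subspace G \<pi> W \<and> irreducible_rep G (subrep \<pi> W) \<longrightarrow>
        multiplicity_in G (subrep \<pi> W) \<pi> = 1)"

text \<open>Functions \<open>f\<close> on \<open>G\<close> (extended by zero) with \<open>f (h g) = \<sigma> h (f g)\<close>, acted on by right
  translation.\<close>

definition induced_rep ::
    "('g, 'b) monoid_scheme \<Rightarrow> 'g set \<Rightarrow> ('g, 'v :: ab_group_add) rep \<Rightarrow> ('g, 'g \<Rightarrow> 'v) rep" where
  "induced_rep G H \<sigma> =
     \<lparr>rep_space = {f. (\<forall>g\<in>carrier G. f g \<in> rep_space \<sigma>) \<and>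
                      (\<forall>g. g \<notin> carrier G \<longrightarrow> f g = 0) \<and>
                      (\<forall>h\<in>H. \<forall>g\<in>carrier G. f (h \<otimes>\<^bsub>G\<^esub> g) = rep_act \<sigma> h (f g))},
      rep_scale = (\<lambda>c f g. rep_scale \<sigma> c (f g)),
      rep_act = (\<lambda>g f x. if x \<in> carrier G then f (x \<otimes>\<^bsub>G\<^esub> g) else 0)\<rparr>"

definition character :: "('g, 'b) monoid_scheme \<Rightarrow> ('g \<Rightarrow> complex) \<Rightarrow> bool" where
  "character G \<chi> \<longleftrightarrow>
     (\<forall>g\<in>carrier G. \<chi> g \<noteq> 0) \<and>
     (\<forall>g\<in>carrier G. \<forall>h\<in>carrier G. \<chi> (g \<otimes>\<^bsub>G\<^esub> h) = \<chi> g * \<chi> h)"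

definition character_rep :: "('g \<Rightarrow> complex) \<Rightarrow> ('g, complex) rep" where
  "character_rep \<chi> = \<lparr>rep_space = UNIV, rep_scale = (*), rep_act = (\<lambda>g z. \<chi> g * z)\<rparr>"


section \<open>Matrices\<close>

definition mat_trace :: "'a :: comm_monoid_add mat \<Rightarrow> 'a" where
  "mat_trace A = (\<Sum>i<dim_row A. A $$ (i, i))"

definition mat_poly_eval :: "'a :: comm_ring_1 poly \<Rightarrow> 'a mat \<Rightarrow> 'a mat" where
  "mat_poly_eval P A =
     mat (dim_row A) (dim_row A) (\<lambda>ij. \<Sum>l\<le>Polynomial.degree P. Polynomial.coeff P l * (A ^\<^sub>m l) $$ ij)"

definition min_poly :: "'a :: field mat \<Rightarrow> 'a poly" where
  "min_poly A = (THE \<mu>. monic \<mu> \<and>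
     (\<forall>P. mat_poly_eval P A = 0\<^sub>m (dim_row A) (dim_row A) \<longleftrightarrow> \<mu> dvd P))"

definition regular_mat :: "'a :: field mat \<Rightarrow> bool" where
  "regular_mat A \<longleftrightarrow> char_poly A = min_poly A"

definition GL :: "nat \<Rightarrow> 'r :: comm_ring_1 mat monoid" where
  "GL n = units_of (ring_mat TYPE('r) n ())"

definition unit_group :: "'r :: comm_ring_1 monoid" where
  "unit_group = \<lparr>carrier = {x. x dvd 1}, mult = (*), one = 1\<rparr>"


section \<open>Regular representations\<close>

text \<open>In what follows \<open>'r\<close> plays the role of the ring of integers modulo the square of a
  uniformizer, \<open>\<omega> :: 'r\<close> is the class of that uniformizer, \<open>red :: 'r \<Rightarrow> 'k\<close> is the reduction
  to the residue field, and \<open>\<psi>\<close> is the additive character. Since \<open>\<omega> * y\<close> depends only on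
  \<open>red y\<close>, the choices made by \<open>SOME\<close> in the next two definitions are immaterial.\<close>

definition psi_residue :: "'r :: comm_ring_1 \<Rightarrow> ('r \<Rightarrow> 'k) \<Rightarrow> ('r \<Rightarrow> complex) \<Rightarrow> 'k \<Rightarrow> complex" where
  "psi_residue \<omega> red \<psi> x = \<psi> (\<omega> * (SOME y. red y = x))"

definition phi ::
    "'r :: comm_ring_1 \<Rightarrow> ('r \<Rightarrow> 'k :: field) \<Rightarrow> ('r \<Rightarrow> complex) \<Rightarrow> nat \<Rightarrow> 'k mat
      \<Rightarrow> 'r mat \<Rightarrow> complex" where
  "phi \<omega> red \<psi> n B k =
     psi_residue \<omega> red \<psi> (mat_trace (B * map_mat red
       (SOME X. X \<in> carrier_mat n n \<and> k = 1\<^sub>m n + \<omega> \<cdot>\<^sub>m X)))"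

definition congruence_subgroup :: "'r :: comm_ring_1 \<Rightarrow> nat \<Rightarrow> 'r mat set" where
  "congruence_subgroup \<omega> n = {1\<^sub>m n + \<omega> \<cdot>\<^sub>m X | X. X \<in> carrier_mat n n}"

definition phi_stabilizer ::
    "'r :: comm_ring_1 \<Rightarrow> ('r \<Rightarrow> 'k :: field) \<Rightarrow> ('r \<Rightarrow> complex) \<Rightarrow> nat \<Rightarrow> 'k mat
      \<Rightarrow> 'r mat set" where
  "phi_stabilizer \<omega> red \<psi> n B =
     {g \<in> carrier (GL n). \<forall>k \<in> congruence_subgroup \<omega> n.
        phi \<omega> red \<psi> n B (inv\<^bsub>GL n\<^esub> g * k * g) = phi \<omega> red \<psi> n B k}"

definition regular_rep ::
    "'r :: comm_ring_1 \<Rightarrow> ('r \<Rightarrow> 'k :: field) \<Rightarrow> ('r \<Rightarrow> complex) \<Rightarrow> nat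
      \<Rightarrow> ('r mat, 'v :: ab_group_add) rep \<Rightarrow> bool" where
  "regular_rep \<omega> red \<psi> n \<tau> \<longleftrightarrow>
     irreducible_rep (GL n) \<tau> \<and>
     (\<exists>B \<in> carrier_mat n n. regular_mat B \<and>
        (\<exists>v \<in> rep_space \<tau>. v \<noteq> 0 \<and>
           (\<forall>k \<in> congruence_subgroup \<omega> n.
              rep_act \<tau> k v = rep_scale \<tau> (phi \<omega> red \<psi> n B k) v)))"

definition strongly_cuspidal ::
    "'r :: comm_ring_1 \<Rightarrow> ('r \<Rightarrow> 'k :: field) \<Rightarrow> ('r \<Rightarrow> complex) \<Rightarrow> nat
      \<Rightarrow> ('r mat, 'v :: ab_group_add) rep \<Rightarrow> bool" where
  "strongly_cuspidal \<omega> red \<psi> n \<rho> \<longleftrightarrow>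
     finite_dim_rep (GL n) \<rho> \<and>
     (\<exists>B \<in> carrier_mat n n. regular_mat B \<and> Factorial_Ring.irreducible (char_poly B) \<and>
        (\<exists>\<phi>. character ((GL n)\<lparr>carrier := phi_stabilizer \<omega> red \<psi> n B\<rparr>) \<phi> \<and>
             (\<forall>k \<in> congruence_subgroup \<omega> n. \<phi> k = phi \<omega> red \<psi> n B k) \<and>
             equivalent_reps (GL n) \<rho>
               (induced_rep (GL n) (phi_stabilizer \<omega> red \<psi> n B) (character_rep \<phi>))))"

text \<open>The centre of \<open>GL n\<close> consists of the scalar matrices with unit entry.\<close>

definition has_central_character ::
    "nat \<Rightarrow> ('r :: comm_ring_1 mat, 'v :: ab_group_add) rep \<Rightarrow> ('r \<Rightarrow> complex) \<Rightarrow> bool" where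
  "has_central_character n \<pi> \<chi> \<longleftrightarrow>
     character unit_group \<chi> \<and>
     (\<forall>z \<in> carrier unit_group. \<forall>v \<in> rep_space \<pi>.
        rep_act \<pi> (z \<cdot>\<^sub>m 1\<^sub>m n) v = rep_scale \<pi> (\<chi> z) v)"


section \<open>Parabolic induction and the degenerate Whittaker space\<close>

definition parabolic_3_1 :: "'r :: comm_ring_1 mat set" where
  "parabolic_3_1 = {four_block_mat h1 Y (0\<^sub>m 1 3) h2 | h1 Y h2.
     h1 \<in> carrier (GL 3) \<and> h2 \<in> carrier (GL 1) \<and> Y \<in> carrier_mat 3 1}"

text \<open>The representation \<open>\<rho> \<otimes> \<chi>\<close> inflated to the parabolic subgroup; \<open>\<chi>\<close> being one-dimensional,
  it is carried by the space of \<open>\<rho>\<close>.\<close>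

definition inflated_rep ::
    "('r :: comm_ring_1 mat, 'v) rep \<Rightarrow> ('r \<Rightarrow> complex) \<Rightarrow> ('r mat, 'v) rep" where
  "inflated_rep \<rho> \<chi> =
     \<rho>\<lparr>rep_act := (\<lambda>q v. rep_scale \<rho> (\<chi> (q $$ (3, 3)))
                           (rep_act \<rho> (mat 3 3 (\<lambda>ij. q $$ ij)) v))\<rparr>"

definition degenerate_whittaker ::
    "('r :: comm_ring_1 \<Rightarrow> complex) \<Rightarrow> ('r mat, 'v) rep \<Rightarrow> ('r mat, 'v) rep" where
  "degenerate_whittaker \<psi> \<pi> =
     \<lparr>rep_space = {v \<in> rep_space \<pi>. \<forall>X \<in> carrier_mat 2 2.
        rep_act \<pi> (four_block_mat (1\<^sub>m 2) X (0\<^sub>m 2 2) (1\<^sub>m 2)) v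
          = rep_scale \<pi> (\<psi> (mat_trace X)) v},
      rep_scale = rep_scale \<pi>,
      rep_act = (\<lambda>g. rep_act \<pi> (four_block_mat g (0\<^sub>m 2 2) (0\<^sub>m 2 2) g))\<rparr>"

end

theory Submission
  imports Defs "HOL-Algebra.Multiplicative_Group"
begin

text \<open>Realise \<open>\<rho>\<close> by functions on \<open>GL 3\<close>. Evaluation at a suitable point is a functional \<open>lam\<close> that
  transforms by a character \<open>\<phi>\<close> under the subgroup \<open>I\<close> of matrices commuting, modulo the
  uniformizer, with a companion matrix \<open>C\<close> whose characteristic polynomial is irreducible
  (\<open>strongly_cuspidal_functional\<close>). An element \<open>f\<close> of the Whittaker space becomes the complex
  function \<open>g \<mapsto> lam (f g)\<close> on \<open>GL 4\<close>, which transforms on the left by a character of the group of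
  block upper triangular matrices with diagonal blocks in \<open>I\<close> and \<open>GL 1\<close>, and on the right by \<open>\<psi>\<close>
  under \<open>N\<close>.

  Such functions are supported on a single double coset modulo \<open>N\<close> and the diagonal \<open>GL 2\<close>, that
  of the permutation matrix \<open>perm4\<close>. If the first half of the last row of \<open>g\<close> vanishes modulo the
  uniformizer, an element of \<open>N\<close> on which \<open>\<psi>\<close> is nontrivial can be moved to the unipotent radical
  on the left (\<open>whittaker_vanish\<close>). Otherwise \<open>g\<close> lies in \<open>U h perm4 GL 2 N\<close> with \<open>h \<in> GL 3\<close>, and
  comparing characters of the congruence subgroup forces \<open>h\<close> into \<open>I\<close> times triangular matrices
  that can be moved to the right (\<open>whittaker_perm4_eq_0\<close>); this uses that a nonzero vector
  is cyclic for \<open>C\<close>. Since a triangular matrix commuting with \<open>C\<close> is scalar, the stabilizer of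
  \<open>perm4\<close> in \<open>GL 2\<close> is the centre times the group of all \<open>1 + \<varpi> (0 b; 0 d)\<close>, and the Whittaker
  space is induced from there: an intertwiner from an irreducible \<open>\<tau>\<close> to it amounts to a functional
  on \<open>\<tau>\<close> transforming by the central character and by \<open>1 + \<varpi> (0 b; 0 d) \<mapsto> \<psi> (\<varpi> (b + s d))\<close> for a
  certain \<open>s\<close> (\<open>intertwiner_triangular\<close> and, conversely, \<open>realization_intertwiner\<close>).

  The rest is Clifford theory for \<open>\<tau>\<close> over the abelian congruence subgroup of \<open>GL 2\<close>. Decomposing
  the functional under the matrices \<open>1 + \<varpi> (0 0; y 0)\<close> gives functionals on which the whole
  congruence subgroup acts by the character of a companion matrix \<open>(0 c; 1 s)\<close>. Companion matrices
  represent exactly the conjugacy classes of regular matrices, and the trace \<open>s\<close> is dictated by the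
  central character; hence the functional exists precisely if \<open>\<tau>\<close> is regular with the right
  central character. It is unique up to a factor because only one \<open>c\<close> can occur in \<open>\<tau>\<close> and the
  stabilizer of the character of a regular matrix acts on the eigenvectors in \<open>\<tau>\<close> by commuting
  operators (\<open>eigenfunctional_unique\<close>, \<open>triangular_functional_unique\<close>).\<close>

section \<open>Invertible matrices\<close>

lemma carrier_GL:
  "A \<in> carrier (GL n) \<longleftrightarrow>
     A \<in> carrier_mat n n \<and> (\<exists>B \<in> carrier_mat n n. A * B = 1\<^sub>m n \<and> B * A = 1\<^sub>m n)"
  by (auto simp: GL_def units_of_def Units_def ring_mat_def)

lemma GL_simps [simp]:
  "x \<otimes>\<^bsub>GL n\<^esub> y = x * y" "\<one>\<^bsub>GL n\<^esub> = 1\<^sub>m n"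
  by (simp_all add: GL_def units_of_def ring_mat_def)

lemma group_GL: "Group.group (GL n :: 'r :: comm_ring_1 mat monoid)"
proof -
  interpret R: semiring "ring_mat TYPE('r) n ()" by (rule semiring_mat)
  show ?thesis unfolding GL_def by (rule R.units_group)
qed

lemma GL_mat: "A \<in> carrier (GL n) \<Longrightarrow> A \<in> carrier_mat n n"
  by (simp add: carrier_GL)

lemma GL_mult: "A \<in> carrier (GL n) \<Longrightarrow> B \<in> carrier (GL n) \<Longrightarrow> A * B \<in> carrier (GL n)"
  for A B :: "'r :: comm_ring_1 mat"
  using Group.group.is_monoid[OF group_GL, of n, THEN monoid.m_closed, of A B] by simp

lemma GL_one: "1\<^sub>m n \<in> carrier (GL n)"
  by (auto simp: carrier_GL)

lemma GL_cases:
  assumes "A \<in> carrier (GL n)"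
  obtains B where "B \<in> carrier (GL n)" "A \<in> carrier_mat n n" "B \<in> carrier_mat n n"
    "A * B = 1\<^sub>m n" "B * A = 1\<^sub>m n"
  using assms unfolding carrier_GL by blast

lemma GL_I:
  "A \<in> carrier_mat n n \<Longrightarrow> B \<in> carrier_mat n n \<Longrightarrow> A * B = 1\<^sub>m n \<Longrightarrow> B * A = 1\<^sub>m n
    \<Longrightarrow> A \<in> carrier (GL n)"
  by (auto simp: carrier_GL)

lemma GL_inv:
  assumes "A \<in> carrier (GL n)"
  shows "inv\<^bsub>GL n\<^esub> A \<in> carrier (GL n)" "A * inv\<^bsub>GL n\<^esub> A = 1\<^sub>m n" "inv\<^bsub>GL n\<^esub> A * A = 1\<^sub>m n"
  using Group.group.inv_closed[OF group_GL assms] Group.group.r_inv[OF group_GL assms]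
    Group.group.l_inv[OF group_GL assms] by simp_all

lemma GL_cancel:
  fixes A B X :: "'r :: comm_ring_1 mat"
  assumes "A * B = 1\<^sub>m n" "A \<in> carrier_mat n n" "B \<in> carrier_mat n n" "X \<in> carrier_mat n k"
  shows "A * (B * X) = X"
  using assoc_mult_mat[OF assms(2-4)] left_mult_one_mat[OF assms(4)] assms(1) by simp

lemma GL_cancel':
  fixes A B X :: "'r :: comm_ring_1 mat"
  assumes "A * B = 1\<^sub>m n" "A \<in> carrier_mat n n" "B \<in> carrier_mat n n" "X \<in> carrier_mat k n"
  shows "X * A * B = X"
  using assoc_mult_mat[OF assms(4,2,3)] right_mult_one_mat[OF assms(4)] assms(1) by simp

lemma GL_scalar:
  assumes "z dvd 1"
  shows "z \<cdot>\<^sub>m 1\<^sub>m n \<in> carrier (GL n)"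
proof -
  obtain y where y: "1 = z * y" using assms by (auto simp: dvd_def)
  show ?thesis
  proof (rule GL_I)
    show "z \<cdot>\<^sub>m 1\<^sub>m n * (y \<cdot>\<^sub>m 1\<^sub>m n) = 1\<^sub>m n" "y \<cdot>\<^sub>m 1\<^sub>m n * (z \<cdot>\<^sub>m 1\<^sub>m n) = 1\<^sub>m n"
      using y by (auto simp: mult.commute intro!: eq_matI)
  qed simp_all
qed

lemmas assoc2 = assoc_mult_mat[of _ 2 2 _ 2 _ 2]
lemmas assoc3 = assoc_mult_mat[of _ 3 3 _ 3 _ 3]
lemmas assoc4 = assoc_mult_mat[of _ 4 4 _ 4 _ 4]

lemma index_mult_sum:
  assumes "A \<in> carrier_mat n m" "B \<in> carrier_mat m k" "i < n" "j < k"
  shows "(A * B) $$ (i, j) = (\<Sum>l<m. A $$ (i, l) * B $$ (l, j))"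
  using assms by (auto simp: scalar_prod_def atLeast0LessThan intro!: sum.cong)

lemma lessThan_small:
  "{..<2} = {0, Suc 0}" "{..<3} = {0, 1, 2::nat}" "{..<4} = {0, 1, 2, 3::nat}"
  by auto

lemma less_small:
  "i < 2 \<longleftrightarrow> i = 0 \<or> i = Suc 0" "i < 3 \<longleftrightarrow> i = 0 \<or> i = Suc 0 \<or> i = 2"
  "i < 4 \<longleftrightarrow> i = 0 \<or> i = Suc 0 \<or> i = 2 \<or> i = 3" for i :: nat
  by auto

lemma mat_trace_mult:
  assumes "A \<in> carrier_mat n n" "B \<in> carrier_mat n n"
  shows "mat_trace (A * B) = (\<Sum>i<n. \<Sum>j<n. A $$ (i, j) * B $$ (j, i))"
  using assms by (auto simp: mat_trace_def index_mult_sum simp del: index_mult_mat(1) intro!: sum.cong)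

lemma mat_trace_commute:
  fixes A B :: "'r :: comm_ring_1 mat"
  assumes "A \<in> carrier_mat n n" "B \<in> carrier_mat n n"
  shows "mat_trace (A * B) = mat_trace (B * A)"
  unfolding mat_trace_mult[OF assms] mat_trace_mult[OF assms(2,1)]
  by (subst sum.swap) (simp add: mult.commute)

lemma mat_trace_conj:
  fixes g h C C' M :: "'a :: comm_ring_1 mat"
  assumes c: "g \<in> carrier_mat n n" "h \<in> carrier_mat n n" "C \<in> carrier_mat n n" "C' \<in> carrier_mat n n"
      "M \<in> carrier_mat n n"
    and gh: "g * h = 1\<^sub>m n" and eq: "g * C = C' * g"
  shows "mat_trace (C * (h * M * g)) = mat_trace (C' * M)"
proof -
  have "mat_trace (C * (h * M * g)) = mat_trace (C * (h * M) * g)"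
    using c by (simp add: assoc_mult_mat[of _ n n _ n _ n])
  also have "\<dots> = mat_trace (g * (C * (h * M)))"
    using c by (intro mat_trace_commute[of _ n]) auto
  also have "g * (C * (h * M)) = g * C * (h * M)"
    using c by (intro assoc_mult_mat[symmetric, of _ n n _ n _ n]) auto
  also have "\<dots> = C' * (g * (h * M))"
    unfolding eq using c by (intro assoc_mult_mat[of _ n n _ n _ n]) auto
  also have "g * (h * M) = M"
    by (rule GL_cancel[OF gh c(1,2,5)])
  finally show ?thesis .
qed

definition mat2 :: "'a \<Rightarrow> 'a \<Rightarrow> 'a \<Rightarrow> 'a \<Rightarrow> 'a mat" where
  "mat2 a b c d = mat 2 2 (\<lambda>(i, j). [[a, b], [c, d]] ! i ! j)"

definition mat3 :: "'a \<Rightarrow> 'a \<Rightarrow> 'a \<Rightarrow> 'a \<Rightarrow> 'a \<Rightarrow> 'a \<Rightarrow> 'a \<Rightarrow> 'a \<Rightarrow> 'a \<Rightarrow> 'a mat" where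
  "mat3 a b c d e f g h i = mat 3 3 (\<lambda>(k, l). [[a, b, c], [d, e, f], [g, h, i]] ! k ! l)"

lemma mat2_carrier [simp]: "mat2 a b c d \<in> carrier_mat 2 2"
  by (simp add: mat2_def)

lemma mat2_dim [simp]: "dim_row (mat2 a b c d) = 2" "dim_col (mat2 a b c d) = 2"
  by (simp_all add: mat2_def)

lemma mat2_index [simp]:
  "mat2 a b c d $$ (0, 0) = a" "mat2 a b c d $$ (0, Suc 0) = b"
  "mat2 a b c d $$ (Suc 0, 0) = c" "mat2 a b c d $$ (Suc 0, Suc 0) = d"
  by (simp_all add: mat2_def)

lemma mat3_carrier [simp]: "mat3 a b c d e f g h i \<in> carrier_mat 3 3"
  by (simp add: mat3_def)

lemma mat3_dim [simp]: "dim_row (mat3 a b c d e f g h i) = 3" "dim_col (mat3 a b c d e f g h i) = 3"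
  by (simp_all add: mat3_def)

lemma mat3_index [simp]:
  "mat3 a b c d e f g h i $$ (0, 0) = a" "mat3 a b c d e f g h i $$ (0, Suc 0) = b"
  "mat3 a b c d e f g h i $$ (0, 2) = c" "mat3 a b c d e f g h i $$ (Suc 0, 0) = d"
  "mat3 a b c d e f g h i $$ (Suc 0, Suc 0) = e" "mat3 a b c d e f g h i $$ (Suc 0, 2) = f"
  "mat3 a b c d e f g h i $$ (2, 0) = g" "mat3 a b c d e f g h i $$ (2, Suc 0) = h"
  "mat3 a b c d e f g h i $$ (2, 2) = i"
  by (simp_all add: mat3_def)

lemma mat2_eta:
  "A \<in> carrier_mat 2 2 \<Longrightarrow> A = mat2 (A $$ (0, 0)) (A $$ (0, 1)) (A $$ (1, 0)) (A $$ (1, 1))"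
  by (rule eq_matI) (auto simp: less_small)

lemma mat2_cases:
  assumes "A \<in> carrier_mat 2 2"
  obtains a b c d where "A = mat2 a b c d"
  using mat2_eta[OF assms] by blast

lemma mat3_eta:
  "A \<in> carrier_mat 3 3 \<Longrightarrow> A = mat3 (A $$ (0, 0)) (A $$ (0, 1)) (A $$ (0, 2))
     (A $$ (1, 0)) (A $$ (1, 1)) (A $$ (1, 2)) (A $$ (2, 0)) (A $$ (2, 1)) (A $$ (2, 2))"
  by (rule eq_matI) (auto simp: less_small)

lemma mat3_cases:
  assumes "A \<in> carrier_mat 3 3"
  obtains a b c d e f g h i where "A = mat3 a b c d e f g h i"
  using mat3_eta[OF assms] by blast

lemma mat2_eq_iff [simp]:
  "mat2 a b c d = mat2 a' b' c' d' \<longleftrightarrow> a = a' \<and> b = b' \<and> c = c' \<and> d = d'"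
  by (metis mat2_index)

lemma mat3_eq_iff [simp]:
  "mat3 a b c d e f g h i = mat3 a' b' c' d' e' f' g' h' i' \<longleftrightarrow>
    a = a' \<and> b = b' \<and> c = c' \<and> d = d' \<and> e = e' \<and> f = f' \<and> g = g' \<and> h = h' \<and> i = i'"
  by (metis mat3_index)

lemma mat2_mult:
  "mat2 a b c d * mat2 a' b' c' d' =
     mat2 (a * a' + b * c') (a * b' + b * d') (c * a' + d * c') (c * b' + d * d')"
  for a :: "'a :: comm_ring_1"
  by (rule eq_matI)
    (auto simp: less_small index_mult_sum[OF mat2_carrier mat2_carrier] lessThan_small simp del: index_mult_mat(1))

lemma mat2_add: "mat2 a b c d + mat2 a' b' c' d' = mat2 (a + a') (b + b') (c + c') (d + d')"
  by (rule eq_matI) (auto simp: less_small)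

lemma mat2_map [simp]: "map_mat f (mat2 a b c d) = mat2 (f a) (f b) (f c) (f d)"
  by (rule eq_matI) (auto simp: less_small)

lemma mat2_one: "1\<^sub>m 2 = mat2 1 0 0 1"
  by (rule eq_matI) (auto simp: less_small)

lemma mat2_smult: "z \<cdot>\<^sub>m mat2 a b c d = mat2 (z * a) (z * b) (z * c) (z * d)"
  by (rule eq_matI) (auto simp: less_small)

lemma mat2_trace [simp]: "mat_trace (mat2 a b c d) = a + d"
  by (simp add: mat_trace_def lessThan_small)

lemma mat3_mult:
  "mat3 a b c d e f g h i * mat3 a' b' c' d' e' f' g' h' i' =
     mat3 (a * a' + b * d' + c * g') (a * b' + b * e' + c * h') (a * c' + b * f' + c * i')
       (d * a' + e * d' + f * g') (d * b' + e * e' + f * h') (d * c' + e * f' + f * i')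
       (g * a' + h * d' + i * g') (g * b' + h * e' + i * h') (g * c' + h * f' + i * i')"
  for a :: "'a :: comm_ring_1"
  by (rule eq_matI)
    (auto simp: less_small index_mult_sum[OF mat3_carrier mat3_carrier] lessThan_small ac_simps
      simp del: index_mult_mat(1))

lemma mat3_add: "mat3 a b c d e f g h i + mat3 a' b' c' d' e' f' g' h' i' =
    mat3 (a + a') (b + b') (c + c') (d + d') (e + e') (f + f') (g + g') (h + h') (i + i')"
  by (rule eq_matI) (auto simp: less_small)

lemma mat3_map [simp]: "map_mat u (mat3 a b c d e f g h i) =
    mat3 (u a) (u b) (u c) (u d) (u e) (u f) (u g) (u h) (u i)"
  by (rule eq_matI) (auto simp: less_small)

lemma mat3_one: "1\<^sub>m 3 = mat3 1 0 0 0 1 0 0 0 1"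
  by (rule eq_matI) (auto simp: less_small)

lemma mat3_smult: "z \<cdot>\<^sub>m mat3 a b c d e f g h i =
    mat3 (z * a) (z * b) (z * c) (z * d) (z * e) (z * f) (z * g) (z * h) (z * i)"
  by (rule eq_matI) (auto simp: less_small)

lemma mat3_trace [simp]: "mat_trace (mat3 a b c d e f g h i) = a + e + i"
  by (simp add: mat_trace_def lessThan_small add.assoc)

lemma finite_carrier_mat:
  assumes "finite (UNIV :: 'a set)"
  shows "finite (carrier_mat n m :: 'a mat set)"
proof (rule finite_subset)
  show "carrier_mat n m \<subseteq> (\<lambda>f. mat n m f) ` (({..<n} \<times> {..<m}) \<rightarrow>\<^sub>E (UNIV :: 'a set))"
  proof
    fix A :: "'a mat"
    assume "A \<in> carrier_mat n m"
    then have "A = mat n m (restrict (\<lambda>ij. A $$ ij) ({..<n} \<times> {..<m}))"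
      by (intro eq_matI) auto
    moreover have "restrict (\<lambda>ij. A $$ ij) ({..<n} \<times> {..<m}) \<in> ({..<n} \<times> {..<m}) \<rightarrow>\<^sub>E UNIV"
      by simp
    ultimately show "A \<in> (\<lambda>f. mat n m f) ` (({..<n} \<times> {..<m}) \<rightarrow>\<^sub>E UNIV)"
      by (rule image_eqI)
  qed
  show "finite ((\<lambda>f. mat n m f) ` (({..<n} \<times> {..<m}) \<rightarrow>\<^sub>E (UNIV :: 'a set)))"
    by (intro finite_imageI finite_PiE) (auto simp: assms)
qed

section \<open>Local rings of length two\<close>

text \<open>The quotient of a discrete valuation ring by the square of its maximal ideal. All that matters is
  the reduction \<open>red\<close> to the residue field and that multiplication by \<open>\<omega>\<close> has the maximal ideal both
  as its image and as its kernel.\<close>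

locale length_two_ring =
  fixes \<omega> :: "'r :: comm_ring_1" and red :: "'r \<Rightarrow> 'k :: {field, finite}"
  assumes red_add: "red (x + y) = red x + red y"
    and red_mult: "red (x * y) = red x * red y"
    and red_1: "red 1 = 1"
    and red_surj: "range red = UNIV"
    and red_eq_0_iff: "red x = 0 \<longleftrightarrow> (\<exists>y. x = \<omega> * y)"
    and omega_mult_eq_0_iff: "\<omega> * x = 0 \<longleftrightarrow> red x = 0"
begin

lemma red_0: "red 0 = 0"
  using red_add[of 0 0] by (metis add.right_neutral add_left_cancel)

sublocale red: comm_ring_hom red
  by standard (simp_all add: red_add red_mult red_1 red_0)

definition lift :: "'k \<Rightarrow> 'r" where
  "lift x = (SOME y. red y = x)"

text \<open>Multiplication by \<open>\<omega>\<close> factors through an isomorphism from the residue field to the maximal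
  ideal. With this isomorphism as a function, elements of the congruence subgroups are described
  by matrices over the residue field, and products with them are computed there.\<close>

definition eps :: "'k \<Rightarrow> 'r" where
  "eps x = \<omega> * lift x"

lemma red_lift [simp]: "red (lift x) = x"
  unfolding lift_def using red_surj by (metis (mono_tags) someI_ex surjD)

lemma omega_cong: "red x = red y \<Longrightarrow> \<omega> * x = \<omega> * y"
  using omega_mult_eq_0_iff[of "x - y"] by (simp add: red.hom_minus right_diff_distrib)

lemma eps_red: "eps (red x) = \<omega> * x"
  unfolding eps_def by (rule omega_cong) simp

lemma eps_add: "eps (x + y) = eps x + eps y"
  using eps_red[of "lift x + lift y"] by (simp add: red_add distrib_left eps_def[symmetric])

lemma eps_0 [simp]: "eps 0 = 0"
  using eps_add[of 0 0] by simp

lemma red_eps [simp]: "red (eps x) = 0"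
  by (auto simp: red_eq_0_iff eps_def)

lemma mult_eps: "r * eps x = eps (red r * x)"
  using eps_red[of "r * lift x"] by (simp add: red_mult eps_def ac_simps)

lemma eps_mult: "eps x * r = eps (x * red r)"
  using mult_eps[of r x] by (simp add: mult.commute)

lemma eps_mult_eps [simp]: "eps x * eps y = 0"
  by (simp add: eps_mult)

lemma eps_eq_0_iff [simp]: "eps x = 0 \<longleftrightarrow> x = 0"
  by (simp add: eps_def omega_mult_eq_0_iff)

lemma eps_inj: "eps x = eps y \<longleftrightarrow> x = y"
  using eps_eq_0_iff[of "x - y"] eps_add[of "x - y" y] by auto

lemma red_eq_0E:
  assumes "red x = 0"
  obtains a where "x = eps a"
  using assms by (metis red_eq_0_iff eps_red)

lemma red_eqE:
  assumes "red x = red y"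
  obtains a where "x = y + eps a"
proof -
  have "red (x - y) = 0" using assms by (simp add: red.hom_minus)
  then obtain a where "x - y = eps a" by (rule red_eq_0E)
  then have "x = y + eps a" by (simp add: algebra_simps)
  then show thesis by (rule that)
qed

lemma unit_iff: "x dvd 1 \<longleftrightarrow> red x \<noteq> 0"
proof
  assume "x dvd 1"
  then obtain y where "1 = x * y" by (auto simp: dvd_def)
  then have "1 = red x * red y" by (metis red_1 red_mult)
  then show "red x \<noteq> 0" by auto
next
  assume "red x \<noteq> 0"
  then have "red (x * lift (1 / red x)) = red 1" by (simp add: red_mult)
  then obtain a where a: "x * lift (1 / red x) = 1 + eps a" by (rule red_eqE)
  have "x * (lift (1 / red x) * (1 - eps a)) = 1"
    unfolding mult.assoc[symmetric] a by (simp add: algebra_simps)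
  then show "x dvd 1" by (metis dvdI)
qed

lemma finite_UNIV_ring: "finite (UNIV :: 'r set)"
proof -
  have "\<exists>a b. x = lift a + eps b" for x :: 'r
    using red_eqE[of x "lift (red x)"] by (metis red_lift)
  then have "UNIV \<subseteq> (\<lambda>(a, b). lift a + eps b) ` (UNIV :: ('k \<times> 'k) set)"
    by (auto simp: image_iff)
  then show ?thesis by (rule finite_subset) simp
qed

abbreviation redm :: "'r mat \<Rightarrow> 'k mat" where "redm \<equiv> map_mat red"
abbreviation epsm :: "'k mat \<Rightarrow> 'r mat" where "epsm \<equiv> map_mat eps"

definition congr :: "'k mat \<Rightarrow> 'r mat" where
  "congr M = 1\<^sub>m (dim_row M) + epsm M"

lemma congr_carrier [simp]: "M \<in> carrier_mat n n \<Longrightarrow> congr M \<in> carrier_mat n n"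
  by (simp add: congr_def)

lemma mult_epsm:
  assumes "A \<in> carrier_mat n m" "M \<in> carrier_mat m k"
  shows "A * epsm M = epsm (redm A * M)"
proof (rule eq_matI)
  have eps_sum: "eps (sum f S) = (\<Sum>x\<in>S. eps (f x))" for f :: "nat \<Rightarrow> 'k" and S
    by (induction S rule: infinite_finite_induct) (simp_all add: eps_add)
  fix i j assume "i < dim_row (epsm (redm A * M))" "j < dim_col (epsm (redm A * M))"
  then have ij: "i < n" "j < k" using assms by auto
  have "(A * epsm M) $$ (i, j) = (\<Sum>l<m. A $$ (i, l) * eps (M $$ (l, j)))"
    using assms ij by (subst index_mult_sum[of _ n m _ k]) auto
  also have "\<dots> = epsm (redm A * M) $$ (i, j)"
    using assms ij by (simp add: index_mult_sum[of _ n m _ k] eps_sum mult_eps del: index_mult_mat(1))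
  finally show "(A * epsm M) $$ (i, j) = epsm (redm A * M) $$ (i, j)" .
qed (use assms in auto)

lemma epsm_mult:
  assumes "A \<in> carrier_mat m k" "M \<in> carrier_mat n m"
  shows "epsm M * A = epsm (M * redm A)"
proof (rule eq_matI)
  have eps_sum: "eps (sum f S) = (\<Sum>x\<in>S. eps (f x))" for f :: "nat \<Rightarrow> 'k" and S
    by (induction S rule: infinite_finite_induct) (simp_all add: eps_add)
  fix i j assume "i < dim_row (epsm (M * redm A))" "j < dim_col (epsm (M * redm A))"
  then have ij: "i < n" "j < k" using assms by auto
  have "(epsm M * A) $$ (i, j) = (\<Sum>l<m. eps (M $$ (i, l)) * A $$ (l, j))"
    using assms ij by (subst index_mult_sum[of _ n m _ k]) auto
  also have "\<dots> = epsm (M * redm A) $$ (i, j)"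
    using assms ij by (simp add: index_mult_sum[of _ n m _ k] eps_sum eps_mult del: index_mult_mat(1))
  finally show "(epsm M * A) $$ (i, j) = epsm (M * redm A) $$ (i, j)" .
qed (use assms in auto)

lemma epsm_0 [simp]: "epsm (0\<^sub>m n m) = 0\<^sub>m n m"
  by (rule eq_matI) auto

lemma redm_congr [simp]: "M \<in> carrier_mat n n \<Longrightarrow> redm (congr M) = 1\<^sub>m n"
  by (rule eq_matI) (auto simp: congr_def red_add red_1 red_0)

lemma redm_mult: "A \<in> carrier_mat n m \<Longrightarrow> B \<in> carrier_mat m k \<Longrightarrow> redm (A * B) = redm A * redm B"
  by (rule red.mat_hom_mult)

lemma redm_one [simp]: "redm (1\<^sub>m n) = 1\<^sub>m n"
  by (rule red.mat_hom_one)

lemma mult_congr: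
  assumes "A \<in> carrier_mat n n" "M \<in> carrier_mat n n"
  shows "A * congr M = A + epsm (redm A * M)"
  using assms unfolding congr_def
  by (subst mult_add_distrib_mat[of _ n n _ n]) (auto simp: mult_epsm[of A n n M n])

lemma congr_mult:
  assumes "A \<in> carrier_mat n n" "M \<in> carrier_mat n n"
  shows "congr M * A = A + epsm (M * redm A)"
  using assms unfolding congr_def
  by (subst add_mult_distrib_mat[of _ n n _ _ n]) (auto simp: epsm_mult[of A n n M n])

lemma congr_add:
  assumes "M \<in> carrier_mat n n" "M' \<in> carrier_mat n n"
  shows "congr M * congr M' = congr (M + M')"
proof -
  have "congr M * congr M' = congr M + epsm M'"
    using assms by (subst mult_congr[of _ n]) auto
  also have "\<dots> = congr (M + M')"
    using assms unfolding congr_def by (intro eq_matI) (auto simp: eps_add)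
  finally show ?thesis .
qed

lemma congr_0 [simp]: "congr (0\<^sub>m n n) = 1\<^sub>m n"
  by (rule eq_matI) (auto simp: congr_def)

lemma congr_GL:
  assumes "M \<in> carrier_mat n n"
  shows "congr M \<in> carrier (GL n)"
proof (rule GL_I)
  show "congr M * congr (- M) = 1\<^sub>m n" "congr (- M) * congr M = 1\<^sub>m n"
    using assms uminus_l_inv_mat[OF assms] comm_add_mat[OF assms, of "- M"]
    by (simp_all add: congr_add[of _ n])
qed (use assms in auto)

lemma redm_eqE:
  assumes "redm A = redm A'" "A \<in> carrier_mat n m" "A' \<in> carrier_mat n m"
  obtains M where "M \<in> carrier_mat n m" "A = A' + epsm M"
proof -
  have "\<exists>a. A $$ ij = A' $$ ij + eps a" if "fst ij < n" "snd ij < m" for ij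
  proof -
    have "red (A $$ ij) = redm A $$ ij" "red (A' $$ ij) = redm A' $$ ij"
      using assms(2,3) that by (cases ij; simp)+
    then have "red (A $$ ij) = red (A' $$ ij)" using assms(1) by simp
    then obtain a where "A $$ ij = A' $$ ij + eps a" by (rule red_eqE)
    then show ?thesis ..
  qed
  then obtain a where a: "\<And>ij. fst ij < n \<Longrightarrow> snd ij < m \<Longrightarrow> A $$ ij = A' $$ ij + eps (a ij)"
    by metis
  show thesis
    by (rule that[of "mat n m a"]) (use assms a in \<open>auto intro!: eq_matI\<close>)
qed

lemma redm_eq_congrE:
  assumes "redm A = 1\<^sub>m n" "A \<in> carrier_mat n n"
  obtains M where "M \<in> carrier_mat n n" "A = congr M"
  by (rule redm_eqE[of A "1\<^sub>m n" n n]) (use assms in \<open>auto simp: congr_def\<close>)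

lemma GL_redm:
  assumes "A \<in> carrier (GL n)"
  shows "redm A \<in> carrier (GL n)"
proof -
  obtain B where B: "A \<in> carrier_mat n n" "B \<in> carrier_mat n n" "A * B = 1\<^sub>m n" "B * A = 1\<^sub>m n"
    using assms by (rule GL_cases)
  have "redm A * redm B = 1\<^sub>m n" "redm B * redm A = 1\<^sub>m n"
    using B redm_mult[of A n n B n] redm_mult[of B n n A n] by simp_all
  then show ?thesis using B by (intro GL_I[of _ _ "redm B"]) auto
qed

definition liftm :: "'k mat \<Rightarrow> 'r mat" where
  "liftm = map_mat lift"

lemma redm_liftm [simp]: "redm (liftm A) = A"
  unfolding liftm_def by (rule eq_matI) auto

lemma liftm_carrier [simp]: "liftm A \<in> carrier_mat n m \<longleftrightarrow> A \<in> carrier_mat n m"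
  by (simp add: liftm_def)

text \<open>A lift of the inverse of the reduction is an inverse up to the congruence subgroup, on either
  side.\<close>

lemma GL_redmD:
  assumes "redm A \<in> carrier (GL n)"
  shows "A \<in> carrier (GL n)"
proof -
  obtain B where B: "redm A \<in> carrier_mat n n" "B \<in> carrier_mat n n"
      "redm A * B = 1\<^sub>m n" "B * redm A = 1\<^sub>m n"
    using assms by (rule GL_cases)
  let ?B = "liftm B"
  have c: "A \<in> carrier_mat n n" "?B \<in> carrier_mat n n" using B by simp_all
  have "redm (A * ?B) = 1\<^sub>m n" "redm (?B * A) = 1\<^sub>m n"
    using B c by (simp_all add: redm_mult[of _ n n _ n])
  note inv = this
  obtain M where M: "M \<in> carrier_mat n n" "A * ?B = congr M"
    by (rule redm_eq_congrE[OF inv(1) mult_carrier_mat[OF c]])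
  obtain M' where M': "M' \<in> carrier_mat n n" "?B * A = congr M'"
    by (rule redm_eq_congrE[OF inv(2) mult_carrier_mat[OF c(2,1)]])
  obtain U where U: "U \<in> carrier_mat n n" "congr M * U = 1\<^sub>m n"
    using congr_GL[OF M(1)] by (auto simp: carrier_GL)
  obtain U' where U': "U' \<in> carrier_mat n n" "U' * congr M' = 1\<^sub>m n"
    using congr_GL[OF M'(1)] by (auto simp: carrier_GL)
  have r: "A * (?B * U) = 1\<^sub>m n"
    using assoc_mult_mat[OF c U(1)] U(2) M(2) by simp
  have l: "(U' * ?B) * A = 1\<^sub>m n"
    using assoc_mult_mat[OF U'(1) c(2,1)] U'(2) M'(2) by simp
  have "U' * ?B = (U' * ?B) * (A * (?B * U))" using r c U U' by simp
  also have "\<dots> = (U' * ?B) * A * (?B * U)"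
    using c U U' by (intro assoc_mult_mat[symmetric, of _ n n _ n _ n]) auto
  also have "\<dots> = ?B * U" using l c U by simp
  finally show ?thesis using r l c U by (intro GL_I[of _ _ "?B * U"]) auto
qed

text \<open>Conjugation moves the congruence subgroup through the residue field only.\<close>

lemma mult_congr_swap:
  assumes "A \<in> carrier_mat n n" "M \<in> carrier_mat n n" "M' \<in> carrier_mat n n"
    "redm A * M = M' * redm A"
  shows "A * congr M = congr M' * A"
  using assms by (simp add: mult_congr[of _ n] congr_mult[of _ n])

lemma congr_conj:
  assumes c: "g \<in> carrier_mat n n" "h \<in> carrier_mat n n" "M \<in> carrier_mat n n"
    and gh: "g * h = 1\<^sub>m n"
  shows "g * congr M * h = congr (redm g * M * redm h)"
proof -
  have r: "redm g * redm h = 1\<^sub>m n" using redm_mult[OF c(1,2)] gh by simp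
  have "redm h * redm g = 1\<^sub>m n"
    using mat_mult_left_right_inverse[of "redm g" n "redm h"] r c by simp
  then have "g * congr M = congr (redm g * M * redm h) * g"
    using c by (intro mult_congr_swap[of _ n]) (simp_all add: assoc_mult_mat[of _ n n _ n _ n])
  then have "g * congr M * h = congr (redm g * M * redm h) * g * h" by simp
  also have "\<dots> = congr (redm g * M * redm h)"
  proof -
    have "congr (redm g * M * redm h) \<in> carrier_mat n n"
      using c by (intro congr_carrier mult_carrier_mat[of _ n n]) auto
    from assoc_mult_mat[OF this c(1,2)] right_mult_one_mat[OF this] show ?thesis
      by (simp only: gh)
  qed
  finally show ?thesis .
qed

lemma GL_redm_cases:
  assumes "g \<in> carrier (GL n)"
  obtains h where "h \<in> carrier (GL n)" "g \<in> carrier_mat n n" "h \<in> carrier_mat n n"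
    "g * h = 1\<^sub>m n" "h * g = 1\<^sub>m n" "redm g * redm h = 1\<^sub>m n" "redm h * redm g = 1\<^sub>m n"
proof -
  obtain h where h: "h \<in> carrier (GL n)" "g \<in> carrier_mat n n" "h \<in> carrier_mat n n"
    "g * h = 1\<^sub>m n" "h * g = 1\<^sub>m n" using assms by (rule GL_cases)
  have "redm g * redm h = 1\<^sub>m n" "redm h * redm g = 1\<^sub>m n"
    using h redm_mult[of g n n h n] redm_mult[of h n n g n] by auto
  then show thesis by (rule that[OF h])
qed

lemma congruence_subgroup_eq: "congruence_subgroup \<omega> n = congr ` carrier_mat n n"
proof -
  have 1: "1\<^sub>m n + \<omega> \<cdot>\<^sub>m X = congr (redm X)" if "X \<in> carrier_mat n n" for X
    using that by (intro eq_matI) (auto simp: congr_def eps_red)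
  show ?thesis
  proof (intro equalityI subsetI)
    fix x assume "x \<in> congruence_subgroup \<omega> n"
    then show "x \<in> congr ` carrier_mat n n"
      using 1 by (force simp: congruence_subgroup_def)
  next
    fix x assume "x \<in> congr ` carrier_mat n n"
    then obtain M where M: "M \<in> carrier_mat n n" "x = congr M" by blast
    then have "x = 1\<^sub>m n + \<omega> \<cdot>\<^sub>m liftm M" using 1[of "liftm M"] by simp
    moreover have "liftm M \<in> carrier_mat n n" using M by simp
    ultimately show "x \<in> congruence_subgroup \<omega> n"
      unfolding congruence_subgroup_def by blast
  qed
qed

end

section \<open>Additive characters of the residue field\<close>

locale length_two_ring_character = length_two_ring \<omega> red
  for \<omega> :: "'r :: comm_ring_1" and red :: "'r \<Rightarrow> 'k :: {field, finite}" +
  fixes \<psi> :: "'r \<Rightarrow> complex"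
  assumes psi_nz: "\<psi> x \<noteq> 0"
    and psi_add: "\<psi> (x + y) = \<psi> x * \<psi> y"
    and psi_nontrivial: "\<exists>x. \<psi> (\<omega> * x) \<noteq> 1"
begin

definition e :: "'k \<Rightarrow> complex" where "e x = \<psi> (eps x)"

lemma psi_residue_eq: "psi_residue \<omega> red \<psi> = e"
  by (rule ext) (simp add: psi_residue_def e_def eps_def lift_def)

lemma e_add: "e (x + y) = e x * e y"
  by (simp add: e_def eps_add psi_add)

lemma e_nz [simp]: "e x \<noteq> 0"
  by (simp add: e_def psi_nz)

lemma psi_0 [simp]: "\<psi> 0 = 1"
  using psi_add[of 0 0] psi_nz[of 0] by simp

lemma e_0 [simp]: "e 0 = 1"
  by (simp add: e_def)

lemma e_uminus: "e (- x) = 1 / e x"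
  using e_add[of x "- x"] by (simp add: field_simps)

lemma e_nontrivial:
  assumes "a \<noteq> 0"
  obtains x where "e (a * x) \<noteq> 1"
proof -
  obtain y where y: "e y \<noteq> 1" using psi_nontrivial by (metis e_def eps_red)
  show thesis by (rule that[of "y / a"]) (use y assms in simp)
qed

lemma e_inj:
  assumes "\<And>x. e (a * x) = e (b * x)"
  shows "a = b"
proof (rule ccontr)
  assume "a \<noteq> b"
  then obtain x where "e ((a - b) * x) \<noteq> 1" using e_nontrivial[of "a - b"] by auto
  moreover have "e (a * x) = e ((a - b) * x) * e (b * x)"
    by (subst e_add[symmetric]) (simp add: algebra_simps)
  ultimately show False using assms[of x] by simp
qed

lemma sum_additive_character:
  fixes \<eta> :: "'k \<Rightarrow> complex"
  assumes add: "\<And>x y. \<eta> (x + y) = \<eta> x * \<eta> y" and "\<eta> y \<noteq> 1"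
  shows "(\<Sum>x\<in>UNIV. \<eta> x) = 0"
proof -
  have "(\<Sum>x\<in>UNIV. \<eta> x) = (\<Sum>x\<in>UNIV. \<eta> (y + x))"
    by (rule sum.reindex_bij_witness[of _ "\<lambda>x. y + x" "\<lambda>x. x - y"]) auto
  also have "\<dots> = \<eta> y * (\<Sum>x\<in>UNIV. \<eta> x)"
    by (simp add: add sum_distrib_left)
  finally show ?thesis using assms(2) by (simp add: field_simps)
qed

lemma sum_e: "(\<Sum>x\<in>UNIV. e (a * x)) = (if a = 0 then of_nat CARD('k) else 0)"
proof (cases "a = 0")
  case False
  then obtain y where "e (a * y) \<noteq> 1" by (rule e_nontrivial)
  then show ?thesis
    using False sum_additive_character[of "\<lambda>x. e (a * x)" y] by (simp add: distrib_left e_add)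
qed simp

text \<open>Were \<open>\<eta>\<close> different from every \<open>x \<mapsto> e (a x)\<close>, it would be orthogonal to all of them, but the
  sum over \<open>a\<close> of these scalar products is a nonzero multiple of \<open>\<eta> 0\<close>.\<close>

lemma additive_character_eq:
  assumes add: "\<And>x y. \<eta> (x + y) = \<eta> x * \<eta> y" and nz: "\<And>x. \<eta> x \<noteq> 0"
  obtains a where "\<And>x. \<eta> x = e (a * x)"
proof (rule ccontr)
  assume "\<not> thesis"
  then have neq: "\<exists>x. \<eta> x \<noteq> e (a * x)" for a using that by blast
  have zero: "(\<Sum>x\<in>UNIV. \<eta> x * e (x * a)) = 0" for a
  proof -
    obtain x where x: "\<eta> x \<noteq> e (- a * x)" using neq[of "- a"] by blast
    have "\<eta> x * e (x * a) \<noteq> 1" using x by (simp add: e_uminus field_simps)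
    then show ?thesis
      by (intro sum_additive_character[of "\<lambda>x. \<eta> x * e (x * a)" x])
        (simp add: add distrib_right e_add)
  qed
  have "0 = (\<Sum>a\<in>UNIV. \<Sum>x\<in>UNIV. \<eta> x * e (x * a))" using zero by simp
  also have "\<dots> = (\<Sum>x\<in>UNIV. \<eta> x * (\<Sum>a\<in>UNIV. e (x * a)))"
    by (subst sum.swap) (simp add: sum_distrib_left)
  also have "\<dots> = (\<Sum>x\<in>UNIV. if x = 0 then \<eta> x * of_nat CARD('k) else 0)"
    by (intro sum.cong) (simp_all add: sum_e)
  also have "\<dots> = \<eta> 0 * of_nat CARD('k)" by simp
  finally show False using nz[of 0] by simp
qed

lemma phi_congr:
  assumes "B \<in> carrier_mat n n" "M \<in> carrier_mat n n"
  shows "phi \<omega> red \<psi> n B (congr M) = e (mat_trace (B * M))"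
proof -
  let ?P = "\<lambda>X. X \<in> carrier_mat n n \<and> congr M = 1\<^sub>m n + \<omega> \<cdot>\<^sub>m X"
  have "\<exists>X. ?P X"
    using assms(2) congruence_subgroup_eq[of n] unfolding congruence_subgroup_def by blast
  then have P: "?P (SOME X. ?P X)" by (rule someI_ex)
  have "redm X = M" if "?P X" for X
  proof (rule eq_matI)
    fix i j assume "i < dim_row M" "j < dim_col M"
    then have ij: "i < n" "j < n" using assms by auto
    then have "congr M $$ (i, j) = (1\<^sub>m n + \<omega> \<cdot>\<^sub>m X) $$ (i, j)" using that by simp
    then have "eps (M $$ (i, j)) = \<omega> * X $$ (i, j)"
      using ij assms that by (auto simp: congr_def)
    then have "M $$ (i, j) = red (X $$ (i, j))" by (simp add: eps_red[symmetric] eps_inj)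
    then show "redm X $$ (i, j) = M $$ (i, j)" using ij that by auto
  qed (use assms that in auto)
  from this[OF P] show ?thesis by (simp add: phi_def psi_residue_eq)
qed

lemma trace_character_inj:
  assumes "A \<in> carrier_mat n n" "B \<in> carrier_mat n n"
    and eq: "\<And>M. M \<in> carrier_mat n n \<Longrightarrow> e (mat_trace (A * M)) = e (mat_trace (B * M))"
  shows "A = B"
proof (rule eq_matI)
  fix i j assume "i < dim_row B" "j < dim_col B"
  then have ij: "i < n" "j < n" using assms by auto
  have tr: "mat_trace (C * mat n n (\<lambda>kl. if kl = (j, i) then x else 0)) = C $$ (i, j) * x"
    if "C \<in> carrier_mat n n" for C :: "'k mat" and x
  proof -
    have "mat_trace (C * mat n n (\<lambda>kl. if kl = (j, i) then x else 0))
        = (\<Sum>k<n. \<Sum>l<n. if k = i then if l = j then C $$ (i, j) * x else 0 else 0)"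
      using that ij by (subst mat_trace_mult[of _ n]) (auto intro!: sum.cong)
    also have "\<dots> = (\<Sum>k<n. if k = i then C $$ (i, j) * x else 0)"
      using ij by (intro sum.cong) auto
    finally show ?thesis using ij by simp
  qed
  have "e (A $$ (i, j) * x) = e (B $$ (i, j) * x)" for x
    using eq[of "mat n n (\<lambda>kl. if kl = (j, i) then x else 0)"] tr assms(1,2) by simp
  then show "A $$ (i, j) = B $$ (i, j)" by (rule e_inj)
qed (use assms in auto)

end

section \<open>Representations of a finite group\<close>

definition linear_functional :: "('g, 'v :: ab_group_add) rep \<Rightarrow> ('v \<Rightarrow> complex) \<Rightarrow> bool" where
  "linear_functional \<tau> l \<longleftrightarrow>
     (\<forall>v \<in> rep_space \<tau>. \<forall>w \<in> rep_space \<tau>. l (v + w) = l v + l w) \<and>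
     (\<forall>c. \<forall>v \<in> rep_space \<tau>. l (rep_scale \<tau> c v) = c * l v)"

locale fin_dim_representation =
  fixes G :: "('g, 'b) monoid_scheme" and \<tau> :: "('g, 'v :: ab_group_add) rep"
  assumes group: "Group.group G" and fin_dim: "finite_dim_rep G \<tau>"
begin

abbreviation "V \<equiv> rep_space \<tau>"
abbreviation "sc \<equiv> rep_scale \<tau>"
abbreviation "act \<equiv> rep_act \<tau>"

sublocale vs: vector_space "rep_scale \<tau>"
  using fin_dim by (simp add: finite_dim_rep_def)

lemma subspace_V: "vs.subspace V"
  using fin_dim by (simp add: finite_dim_rep_def invariant_subspace_def)

lemma zero_V [simp]: "0 \<in> V" using subspace_V vs.subspace_0 by blast
lemma add_V [simp]: "v \<in> V \<Longrightarrow> w \<in> V \<Longrightarrow> v + w \<in> V" using subspace_V vs.subspace_add by blast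
lemma sc_V [simp]: "v \<in> V \<Longrightarrow> sc c v \<in> V" using subspace_V vs.subspace_scale by blast
lemma sum_V: "(\<And>x. x \<in> S \<Longrightarrow> f x \<in> V) \<Longrightarrow> sum f S \<in> V" using subspace_V vs.subspace_sum by blast

lemma act_V [simp]: "g \<in> carrier G \<Longrightarrow> v \<in> V \<Longrightarrow> act g v \<in> V"
  using fin_dim by (simp add: finite_dim_rep_def invariant_subspace_def)

lemma act_add: "g \<in> carrier G \<Longrightarrow> v \<in> V \<Longrightarrow> w \<in> V \<Longrightarrow> act g (v + w) = act g v + act g w"
  using fin_dim by (simp add: finite_dim_rep_def)

lemma act_sc: "g \<in> carrier G \<Longrightarrow> v \<in> V \<Longrightarrow> act g (sc c v) = sc c (act g v)"
  using fin_dim by (simp add: finite_dim_rep_def)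

lemma act_one [simp]: "v \<in> V \<Longrightarrow> act \<one>\<^bsub>G\<^esub> v = v"
  using fin_dim by (simp add: finite_dim_rep_def)

lemma act_mult: "g \<in> carrier G \<Longrightarrow> h \<in> carrier G \<Longrightarrow> v \<in> V \<Longrightarrow> act (g \<otimes>\<^bsub>G\<^esub> h) v = act g (act h v)"
  using fin_dim by (simp add: finite_dim_rep_def)

lemma act_0 [simp]: "g \<in> carrier G \<Longrightarrow> act g 0 = 0"
  using act_add[of g 0 0] by simp

lemma act_sum:
  assumes "g \<in> carrier G" "\<And>x. x \<in> S \<Longrightarrow> f x \<in> V"
  shows "act g (sum f S) = (\<Sum>x\<in>S. act g (f x))"
  using assms
  by (induction S rule: infinite_finite_induct) (simp_all add: act_add sum_V)

lemma linear_functional_sum: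
  assumes "linear_functional \<tau> l" "\<And>x. x \<in> S \<Longrightarrow> f x \<in> V"
  shows "l (sum f S) = (\<Sum>x\<in>S. l (f x))"
proof -
  have "l (sc 0 0) = 0 * l 0" using assms(1) zero_V by (simp only: linear_functional_def)
  then have 0: "l 0 = 0" by simp
  show ?thesis using assms(2)
    by (induction S rule: infinite_finite_induct)
      (use assms(1) in \<open>auto simp: 0 linear_functional_def sum_V\<close>)
qed

lemma exists_linear_functional:
  assumes "v \<in> V" "v \<noteq> 0"
  obtains l where "linear_functional \<tau> l" "l v = 1"
proof -
  interpret p: vector_space_pair "rep_scale \<tau>" "(*) :: complex \<Rightarrow> _"
    by unfold_locales (auto simp: algebra_simps)
  have "vs.independent {v}" using assms by simp
  then obtain g where g: "Vector_Spaces.linear (rep_scale \<tau>) (*) g" "g v = (1 :: complex)"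
    using p.linear_independent_extend[of "{v}" "\<lambda>_. 1"] by auto
  interpret g: Vector_Spaces.linear "rep_scale \<tau>" "(*)" g by (rule g)
  show thesis
    by (rule that[of g]) (use g in \<open>auto simp: linear_functional_def g.add g.scale\<close>)
qed

text \<open>Simultaneous diagonalisation: an element \<open>g\<close> acts with finite order \<open>N\<close>, so \<open>N v\<close> is the sum
  over \<open>j < N\<close> of the eigenvectors \<open>\<Sum>\<^sub>k \<zeta>\<^sup>j\<^sup>k g\<^sup>k v\<close> of \<open>g\<close>, and one of these is nonzero. If \<open>v\<close> is
  an eigenvector of operators commuting with \<open>g\<close>, so is each summand.\<close>

lemma common_eigenvector:
  assumes fin: "finite (carrier G)" and S: "S \<subseteq> carrier G"
    and comm: "\<And>s t. s \<in> S \<Longrightarrow> t \<in> S \<Longrightarrow> s \<otimes>\<^bsub>G\<^esub> t = t \<otimes>\<^bsub>G\<^esub> s"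
    and U: "vs.subspace U" "U \<subseteq> V" "\<And>s v. s \<in> S \<Longrightarrow> v \<in> U \<Longrightarrow> act s v \<in> U"
    and u: "u \<in> U" "u \<noteq> 0"
  obtains v where "v \<in> U" "v \<noteq> 0" "\<And>s. s \<in> S \<Longrightarrow> \<exists>c. act s v = sc c v"
proof -
  interpret G: Group.group G by (rule group)
  define N where "N = Coset.order G"
  define \<zeta> where "\<zeta> = cis (2 * pi / N)"
  have N: "N > 0" using fin G.one_closed by (auto simp: N_def order_def card_gt_0_iff)
  have \<zeta>N: "\<zeta> ^ N = 1" using N by (simp add: \<zeta>_def DeMoivre)
  have \<zeta>k: "(\<Sum>j<N. \<zeta> ^ (j * k)) = (if k = 0 then of_nat N else 0)" if "k < N" for k
  proof (cases "k = 0")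
    case False
    have "inj_on (\<lambda>k. cis (2 * pi * real k / real N)) {..<N}"
      using bij_betw_roots_unity[OF N] by (rule bij_betw_imp_inj_on)
    then have "cis (2 * pi * real k / real N) \<noteq> cis (2 * pi * real 0 / real N)"
      using False that N by (metis inj_onD lessThan_iff)
    then have ne: "\<zeta> ^ k \<noteq> 1" by (simp add: \<zeta>_def DeMoivre field_simps)
    have "(\<Sum>j<N. \<zeta> ^ (j * k)) = (\<Sum>j<N. (\<zeta> ^ k) ^ j)"
      by (simp add: power_mult[symmetric] mult.commute)
    also have "\<dots> = ((\<zeta> ^ k) ^ N - 1) / (\<zeta> ^ k - 1)" by (rule geometric_sum[OF ne])
    also have "(\<zeta> ^ k) ^ N = 1" using \<zeta>N by (metis power_mult mult.commute power_one)
    finally show ?thesis using False by simp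
  qed simp
  have fS: "finite S" using S fin finite_subset by blast
  have "\<exists>v\<in>U. v \<noteq> 0 \<and> (\<forall>s\<in>F. \<exists>c. act s v = sc c v)" if "finite F" "F \<subseteq> S" for F
    using that
  proof (induction F rule: finite_induct)
    case empty
    then show ?case using u by blast
  next
    case (insert g F)
    then obtain v where v: "v \<in> U" "v \<noteq> 0" and ev: "\<And>s. s \<in> F \<Longrightarrow> \<exists>c. act s v = sc c v"
      by auto
    have g: "g \<in> S" "g \<in> carrier G" using insert S by auto
    have vV: "v \<in> V" using v U by blast
    define f where "f k = act (g [^]\<^bsub>G\<^esub> k) v" for k :: nat
    have f0: "f 0 = v" using vV by (simp add: f_def)
    have fSuc: "f (Suc k) = act g (f k)" for k
      unfolding f_def G.nat_pow_Suc2[OF g(2)] using g vV by (intro act_mult) auto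
    have fU: "f k \<in> U" for k
      by (induction k) (use v U g in \<open>auto simp: f0 fSuc\<close>)
    have fV: "f k \<in> V" for k using fU U by blast
    have fN: "f N = v"
      using G.pow_order_eq_1[OF g(2)] vV by (simp add: f_def N_def)
    define w where "w j = (\<Sum>k<N. sc (\<zeta> ^ (j * k)) (f k))" for j
    have "(\<Sum>j<N. w j) = (\<Sum>k<N. sc (\<Sum>j<N. \<zeta> ^ (j * k)) (f k))"
      unfolding w_def by (subst sum.swap) (simp add: vs.scale_sum_left)
    also have "\<dots> = (\<Sum>k<N. if k = 0 then sc (of_nat N) v else 0)"
      by (intro sum.cong) (auto simp: \<zeta>k f0)
    also have "\<dots> = sc (of_nat N) v" using N by simp
    finally have "(\<Sum>j<N. w j) \<noteq> 0" using v N by simp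
    then obtain j where j: "w j \<noteq> 0" by (metis sum.neutral)
    have wU: "w j \<in> U"
      unfolding w_def by (intro vs.subspace_sum vs.subspace_scale U(1) fU)
    have wV: "w j \<in> V" using wU U by blast
    have "sc (\<zeta> ^ j) (act g (w j)) = (\<Sum>k<N. sc (\<zeta> ^ (j * Suc k)) (f (Suc k)))"
      unfolding w_def using g fV
      by (simp add: act_sum act_sc fSuc vs.scale_sum_right power_add)
    also have "\<dots> = w j + sc (\<zeta> ^ (j * N)) (f N) - sc (\<zeta> ^ (j * 0)) (f 0)"
      unfolding w_def using sum.lessThan_Suc_shift[of "\<lambda>k. sc (\<zeta> ^ (j * k)) (f k)" N]
      by (simp add: algebra_simps)
    also have "\<zeta> ^ (j * N) = 1" using \<zeta>N by (metis power_mult mult.commute power_one)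
    finally have "sc (\<zeta> ^ j) (act g (w j)) = w j" by (simp add: fN f0)
    then have "sc (1 / \<zeta> ^ j) (sc (\<zeta> ^ j) (act g (w j))) = sc (1 / \<zeta> ^ j) (w j)" by simp
    moreover have "\<zeta> \<noteq> 0" by (simp add: \<zeta>_def)
    ultimately have wg: "act g (w j) = sc (1 / \<zeta> ^ j) (w j)" by simp
    have "\<exists>c. act s (w j) = sc c (w j)" if s: "s \<in> F" for s
    proof -
      obtain c where c: "act s v = sc c v" using ev[OF s] by blast
      have sS: "s \<in> S" "s \<in> carrier G" using s insert S by auto
      have "act s (f k) = sc c (f k)" for k
      proof (induction k)
        case (Suc k)
        have "act s (f (Suc k)) = act (s \<otimes>\<^bsub>G\<^esub> g) (f k)"
          using sS g fV by (simp add: fSuc act_mult)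
        also have "\<dots> = act g (act s (f k))"
          using sS g fV comm[of s g] by (simp add: act_mult)
        finally show ?case using Suc g fV by (simp add: fSuc act_sc)
      qed (simp add: f0 c)
      then have "act s (w j) = sc c (w j)"
        unfolding w_def using sS fV
        by (simp add: act_sum act_sc vs.scale_sum_right mult.commute)
      then show ?thesis ..
    qed
    then show ?case using wU j wg by auto
  qed
  from this[OF fS] show thesis using that by blast
qed

end

locale irreducible_representation = fin_dim_representation G \<tau>
  for G :: "('g, 'b) monoid_scheme" and \<tau> :: "('g, 'v :: ab_group_add) rep" +
  assumes irreducible: "irreducible_rep G \<tau>"
begin

text \<open>The vectors all of whose translates are killed by \<open>l\<close> form an invariant subspace.\<close>

lemma functional_eq_0:
  assumes l: "linear_functional \<tau> l" and v: "v \<in> V" "v \<noteq> 0"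
    and 0: "\<And>g. g \<in> carrier G \<Longrightarrow> l (act g v) = 0" and w: "w \<in> V"
  shows "l w = 0"
proof -
  interpret G: Group.group G by (rule group)
  define W where "W = {x \<in> V. \<forall>g \<in> carrier G. l (act g x) = 0}"
  have l0: "l 0 = 0"
    using linear_functional_sum[OF l, of "{}"] by simp
  have "invariant_subspace G \<tau> W"
    unfolding invariant_subspace_def
  proof (intro conjI ballI)
    show "vs.subspace W"
      using l l0 by (auto simp: vs.subspace_def W_def act_add act_sc linear_functional_def)
    show "act g x \<in> W" if "g \<in> carrier G" "x \<in> W" for g x
      using that by (auto simp: W_def act_mult[symmetric])
  qed (auto simp: W_def)
  moreover have "v \<in> W" using v 0 by (auto simp: W_def)
  ultimately have "W = V" using irreducible v unfolding irreducible_rep_def by auto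
  then have "l (act \<one>\<^bsub>G\<^esub> w) = 0" using w unfolding W_def by blast
  then show ?thesis using w by simp
qed

end

section \<open>Clifford theory over the congruence subgroup\<close>

context length_two_ring_character
begin

text \<open>The vectors and the functionals that transform under the congruence subgroup by the character
  \<open>\<phi>\<^sub>C\<close>.\<close>

definition eigenvectors :: "nat \<Rightarrow> 'k mat \<Rightarrow> ('r mat, 'v :: ab_group_add) rep \<Rightarrow> 'v set" where
  "eigenvectors n C \<tau> = {v \<in> rep_space \<tau>. \<forall>M \<in> carrier_mat n n.
     rep_act \<tau> (congr M) v = rep_scale \<tau> (e (mat_trace (C * M))) v}"

definition eigenfunctional ::
    "nat \<Rightarrow> 'k mat \<Rightarrow> ('r mat, 'v :: ab_group_add) rep \<Rightarrow> ('v \<Rightarrow> complex) \<Rightarrow> bool" where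
  "eigenfunctional n C \<tau> l \<longleftrightarrow> linear_functional \<tau> l \<and>
     (\<forall>M \<in> carrier_mat n n. \<forall>v \<in> rep_space \<tau>.
        l (rep_act \<tau> (congr M) v) = e (mat_trace (C * M)) * l v)"

lemma mat_trace_add:
  assumes "A \<in> carrier_mat n n" "B \<in> carrier_mat n n"
  shows "mat_trace (A + B) = mat_trace A + mat_trace B"
  using assms by (simp add: mat_trace_def sum.distrib)

lemma trace_mult_add:
  fixes C :: "'k mat"
  assumes "C \<in> carrier_mat n n" "M \<in> carrier_mat n n" "M' \<in> carrier_mat n n"
  shows "e (mat_trace (C * (M + M'))) = e (mat_trace (C * M)) * e (mat_trace (C * M'))"
  using assms by (simp add: mult_add_distrib_mat[of C n n] mat_trace_add[of _ n] e_add)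

end

locale GL_representation = length_two_ring_character \<omega> red \<psi> +
    fin_dim_representation "GL n :: 'r mat monoid" \<tau>
  for \<omega> :: "'r :: comm_ring_1" and red :: "'r \<Rightarrow> 'k :: {field, finite}" and \<psi>
    and n and \<tau> :: "('r mat, 'v :: ab_group_add) rep"
begin

lemma act_mult_GL: "g \<in> carrier (GL n) \<Longrightarrow> h \<in> carrier (GL n) \<Longrightarrow> v \<in> V \<Longrightarrow> act (g * h) v = act g (act h v)"
  using act_mult[of g h v] by simp

lemma act_one_GL: "v \<in> V \<Longrightarrow> act (1\<^sub>m n) v = v"
  using act_one[of v] by simp

definition kmats :: "'k mat set" where "kmats = carrier_mat n n"

lemma finite_kmats [simp]: "finite kmats"
  by (simp add: kmats_def finite_carrier_mat)

lemma sum_kmats_shift: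
  assumes "M \<in> carrier_mat n n"
  shows "(\<Sum>M'\<in>kmats. f (M' + M)) = (\<Sum>M'\<in>kmats. f M')"
proof (rule sum.reindex_bij_witness[of _ "\<lambda>M'. M' - M" "\<lambda>M'. M' + M"])
  fix A assume "A \<in> kmats"
  then have A: "A \<in> carrier_mat n n" by (simp add: kmats_def)
  show "A + M - M = A" "A - M + M = A" using A assms by (auto intro!: eq_matI)
  show "A - M \<in> kmats" "A + M \<in> kmats"
    using A assms minus_carrier_mat[OF assms, of A] by (simp_all add: kmats_def)
qed simp

text \<open>A multiple of the projection to the eigenvectors. Since it can be precomposed with a functional as
  well as applied to a vector, nonzero eigenvectors and nonzero eigenfunctionals exist
  together.\<close>

definition project :: "'k mat \<Rightarrow> 'v \<Rightarrow> 'v" where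
  "project C v = (\<Sum>M\<in>kmats. sc (1 / e (mat_trace (C * M))) (act (congr M) v))"

lemma project_eigenvector:
  assumes C: "C \<in> carrier_mat n n" and v: "v \<in> V"
  shows "project C v \<in> eigenvectors n C \<tau>"
  unfolding eigenvectors_def
proof (intro CollectI conjI ballI)
  have km: "\<And>M. M \<in> kmats \<Longrightarrow> M \<in> carrier_mat n n" by (simp add: kmats_def)
  show "project C v \<in> V"
    unfolding project_def using km v by (intro sum_V) (simp add: congr_GL)
  fix M :: "'k mat" assume M: "M \<in> carrier_mat n n"
  have "act (congr M) (project C v)
      = (\<Sum>M'\<in>kmats. sc (1 / e (mat_trace (C * M'))) (act (congr (M' + M)) v))"
    unfolding project_def using M v km
    by (subst act_sum) (auto simp: congr_GL act_sc act_mult_GL[symmetric] congr_add[of _ n]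
        comm_add_mat[of _ n n M] intro!: sum.cong)
  also have "\<dots> = (\<Sum>M'\<in>kmats. sc (e (mat_trace (C * M)))
        (sc (1 / e (mat_trace (C * (M' + M)))) (act (congr (M' + M)) v)))"
    using M km C by (intro sum.cong) (simp_all add: trace_mult_add)
  also have "\<dots> = (\<Sum>M'\<in>kmats. sc (e (mat_trace (C * M)))
        (sc (1 / e (mat_trace (C * M'))) (act (congr M') v)))"
    by (rule sum_kmats_shift[OF M])
  also have "\<dots> = sc (e (mat_trace (C * M))) (project C v)"
    unfolding project_def by (simp add: vs.scale_sum_right)
  finally show "act (congr M) (project C v) = sc (e (mat_trace (C * M))) (project C v)" .
qed

lemma eigenfunctional_project:
  assumes C: "C \<in> carrier_mat n n" and v: "v \<in> V" and l: "eigenfunctional n C \<tau> l"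
  shows "l (project C v) = of_nat (card kmats) * l v"
proof -
  have km: "\<And>M. M \<in> kmats \<Longrightarrow> M \<in> carrier_mat n n" by (simp add: kmats_def)
  have "l (project C v) = (\<Sum>M\<in>kmats. l v)"
    unfolding project_def using l v km
    by (subst linear_functional_sum)
      (auto simp: eigenfunctional_def linear_functional_def congr_GL intro!: sum.cong)
  then show ?thesis by simp
qed

lemma card_kmats: "card kmats \<noteq> 0"
proof -
  have "0\<^sub>m n n \<in> kmats" by (simp add: kmats_def)
  then show ?thesis using finite_kmats by auto
qed

lemma exists_eigenvector:
  assumes C: "C \<in> carrier_mat n n" and v: "v \<in> V" and l: "eigenfunctional n C \<tau> l" "l v \<noteq> 0"
  obtains w where "w \<in> eigenvectors n C \<tau>" "w \<noteq> 0"
proof -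
  have "l (project C v) \<noteq> 0"
    using eigenfunctional_project[OF C v l(1)] l(2) card_kmats by simp
  moreover have "l 0 = 0"
    using linear_functional_sum[of l "{}"] l by (simp add: eigenfunctional_def)
  ultimately have "project C v \<noteq> 0" by metis
  then show thesis using that[of "project C v"] project_eigenvector[OF C v] by blast
qed

lemma exists_eigenfunctional:
  assumes C: "C \<in> carrier_mat n n" and v: "v \<in> eigenvectors n C \<tau>" "v \<noteq> 0"
  obtains l where "eigenfunctional n C \<tau> l" "l v \<noteq> 0"
proof -
  have km: "\<And>M. M \<in> kmats \<Longrightarrow> M \<in> carrier_mat n n" by (simp add: kmats_def)
  have vV: "v \<in> V" using v by (simp add: eigenvectors_def)
  obtain l where l: "linear_functional \<tau> l" "l v = 1"
    using exists_linear_functional[OF vV v(2)] .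
  define l' where "l' w = l (project C w)" for w
  have "eigenfunctional n C \<tau> l'"
    unfolding eigenfunctional_def
  proof (intro conjI ballI)
    have add: "project C (w + w') = project C w + project C w'" if "w \<in> V" "w' \<in> V" for w w'
      unfolding project_def using km that
      by (simp add: act_add congr_GL vs.scale_right_distrib sum.distrib)
    have scale: "project C (sc c w) = sc c (project C w)" if "w \<in> V" for c w
      unfolding project_def using km that
      by (simp add: act_sc congr_GL vs.scale_sum_right mult.commute)
    have pV: "project C w \<in> V" if "w \<in> V" for w
      using project_eigenvector[OF C that] by (simp add: eigenvectors_def)
    show "linear_functional \<tau> l'"
      using l pV by (simp add: linear_functional_def l'_def add scale)
    fix M :: "'k mat" and w assume M: "M \<in> carrier_mat n n" and w: "w \<in> V"
    have "project C (act (congr M) w)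
        = (\<Sum>M'\<in>kmats. sc (1 / e (mat_trace (C * M'))) (act (congr (M' + M)) w))"
      unfolding project_def using M w km
      by (intro sum.cong) (auto simp: congr_GL act_mult_GL[symmetric] congr_add[of _ n])
    also have "\<dots> = (\<Sum>M'\<in>kmats. sc (e (mat_trace (C * M)))
          (sc (1 / e (mat_trace (C * (M' + M)))) (act (congr (M' + M)) w)))"
      using M km C by (intro sum.cong) (simp_all add: trace_mult_add)
    also have "\<dots> = (\<Sum>M'\<in>kmats. sc (e (mat_trace (C * M)))
          (sc (1 / e (mat_trace (C * M'))) (act (congr M') w)))"
      by (rule sum_kmats_shift[OF M])
    also have "\<dots> = sc (e (mat_trace (C * M))) (project C w)"
      unfolding project_def by (simp add: vs.scale_sum_right)
    finally show "l' (act (congr M) w) = e (mat_trace (C * M)) * l' w"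
      using l pV[OF w] by (simp add: l'_def linear_functional_def)
  qed
  moreover have "l' v \<noteq> 0"
  proof -
    have "project C v = (\<Sum>M\<in>kmats. v)"
      unfolding project_def using v km by (intro sum.cong) (auto simp: eigenvectors_def)
    then show ?thesis
      using linear_functional_sum[OF l(1), of kmats "\<lambda>_. v"] vV l(2) card_kmats
      by (simp add: l'_def)
  qed
  ultimately show thesis by (rule that)
qed

text \<open>The congruence subgroup is normal, and conjugation by \<open>g\<close> turns \<open>\<phi>\<^sub>C\<close> into the character of the
  conjugate of \<open>C\<close> by the reduction of \<open>g\<close>.\<close>

lemma act_eigenvectors:
  assumes v: "v \<in> eigenvectors n C \<tau>" and C: "C \<in> carrier_mat n n" "C' \<in> carrier_mat n n"
    and g: "g \<in> carrier (GL n)" and eq: "redm g * C = C' * redm g"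
  shows "act g v \<in> eigenvectors n C' \<tau>"
  unfolding eigenvectors_def
proof (intro CollectI conjI ballI)
  have vV: "v \<in> V" using v by (simp add: eigenvectors_def)
  then show "act g v \<in> V" using g by simp
  fix M :: "'k mat" assume M: "M \<in> carrier_mat n n"
  obtain h where h: "h \<in> carrier (GL n)" "g \<in> carrier_mat n n" "h \<in> carrier_mat n n"
    "g * h = 1\<^sub>m n" "h * g = 1\<^sub>m n" "redm g * redm h = 1\<^sub>m n" using g by (rule GL_redm_cases)
  have r: "redm g \<in> carrier_mat n n" "redm h \<in> carrier_mat n n" using h by simp_all
  define M' where "M' = redm h * M * redm g"
  have M': "M' \<in> carrier_mat n n" using r M by (simp add: M'_def)
  have "congr M' = h * congr M * g"
    unfolding M'_def by (rule congr_conj[OF h(3,2) M h(5), symmetric])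
  also have "\<dots> = h * (congr M * g)"
    using h M by (intro assoc_mult_mat[of _ n n _ n _ n]) auto
  finally have "g * congr M' = g * (h * (congr M * g))" by (rule arg_cong)
  also have "\<dots> = congr M * g"
    using M h by (intro GL_cancel[OF h(4), of _ n] mult_carrier_mat[of _ n n]) auto
  finally have sw: "g * congr M' = congr M * g" .
  have "act (congr M) (act g v) = act (g * congr M') v"
    using vV g M by (simp add: sw act_mult_GL[symmetric] congr_GL)
  also have "\<dots> = act g (act (congr M') v)"
    using vV g M' by (simp add: act_mult_GL congr_GL)
  also have "\<dots> = sc (e (mat_trace (C * M'))) (act g v)"
    using v vV g M' by (simp add: eigenvectors_def act_sc)
  also have "mat_trace (C * M') = mat_trace (C' * M)"
    unfolding M'_def by (rule mat_trace_conj[OF r C M h(6) eq])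
  finally show "act (congr M) (act g v) = sc (e (mat_trace (C' * M))) (act g v)" .
qed

text \<open>An eigenfunctional does not vanish on an eigenvector only if the two characters agree.\<close>

lemma eigenfunctional_act_nonzero:
  assumes v: "v \<in> eigenvectors n C \<tau>" and C: "C \<in> carrier_mat n n" "C' \<in> carrier_mat n n"
    and l: "eigenfunctional n C' \<tau> l" and g: "g \<in> carrier (GL n)" and ne: "l (act g v) \<noteq> 0"
  shows "redm g * C = C' * redm g"
proof -
  obtain h where h: "g \<in> carrier_mat n n" "h \<in> carrier_mat n n"
    "redm g * redm h = 1\<^sub>m n" "redm h * redm g = 1\<^sub>m n" using g by (rule GL_redm_cases)
  have r: "redm g \<in> carrier_mat n n" "redm h \<in> carrier_mat n n" using h by simp_all
  define C'' where "C'' = redm g * C * redm h"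
  have C'': "C'' \<in> carrier_mat n n" using r C by (simp add: C''_def)
  have eq: "redm g * C = C'' * redm g"
    unfolding C''_def using GL_cancel'[OF h(4) r(2,1), of "redm g * C" n] r C by simp
  have "act g v \<in> eigenvectors n C'' \<tau>"
    by (rule act_eigenvectors[OF v C(1) C'' g eq])
  then have w: "act g v \<in> V" "\<And>M. M \<in> carrier_mat n n \<Longrightarrow>
      act (congr M) (act g v) = sc (e (mat_trace (C'' * M))) (act g v)"
    by (auto simp: eigenvectors_def)
  have "e (mat_trace (C'' * M)) = e (mat_trace (C' * M))" if "M \<in> carrier_mat n n" for M
  proof -
    have "e (mat_trace (C'' * M)) * l (act g v) = l (act (congr M) (act g v))"
      using l w that by (simp add: eigenfunctional_def linear_functional_def)
    also have "\<dots> = e (mat_trace (C' * M)) * l (act g v)"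
      using l w(1) that by (simp add: eigenfunctional_def)
    finally show ?thesis using ne by simp
  qed
  then have "C'' = C'" by (rule trace_character_inj[OF C'' C(2)])
  then show ?thesis using eq by simp
qed

end

section \<open>Regular matrices of size two\<close>

lemma det_mat2: "det (mat2 a b c d) = a * d - b * c" for a :: "'a :: comm_ring_1"
proof -
  have del: "mat_delete (mat2 a b c d) 0 0 = mat 1 1 (\<lambda>_. d)"
    "mat_delete (mat2 a b c d) (Suc 0) 0 = mat 1 1 (\<lambda>_. b)"
    by (auto simp: mat_delete_def intro!: eq_matI)
  have "det (mat2 a b c d) = (\<Sum>i<2. mat2 a b c d $$ (i, 0) * cofactor (mat2 a b c d) i 0)"
    by (rule laplace_expansion_column) simp_all
  also have "\<dots> = a * det (mat 1 1 (\<lambda>_. d)) - c * det (mat 1 1 (\<lambda>_. b))"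
    by (simp add: lessThan_small cofactor_def del)
  also have "\<dots> = a * d - b * c"
  proof -
    have "det (mat 1 1 (\<lambda>_. x)) = x" for x :: 'a by (subst det_single) auto
    then show ?thesis by (simp only: mult.commute)
  qed
  finally show ?thesis .
qed

lemma char_poly_mat2: "char_poly (mat2 a b c d) = [:a * d - b * c, - (a + d), 1:]"
proof -
  have "char_poly_matrix (mat2 a b c d) = mat2 [:- a, 1:] [:- b:] [:- c:] [:- d, 1:]"
    by (rule eq_matI) (auto simp: char_poly_matrix_def less_small)
  then show ?thesis by (simp add: char_poly_def det_mat2)
qed

lemma mat_poly_eval_carrier: "A \<in> carrier_mat n n \<Longrightarrow> mat_poly_eval P A \<in> carrier_mat n n"
  by (simp add: mat_poly_eval_def)

lemma mat_poly_eval_0: "A \<in> carrier_mat n n \<Longrightarrow> mat_poly_eval 0 A = 0\<^sub>m n n"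
  by (rule eq_matI) (auto simp: mat_poly_eval_def)

text \<open>Horner's rule, which turns statements on evaluations into inductions over the polynomial.\<close>

lemma mat_poly_eval_pCons:
  assumes A: "A \<in> carrier_mat n n"
  shows "mat_poly_eval (pCons a P) A = a \<cdot>\<^sub>m 1\<^sub>m n + A * mat_poly_eval P A"
proof (rule eq_matI)
  fix i j assume "i < dim_row (a \<cdot>\<^sub>m 1\<^sub>m n + A * mat_poly_eval P A)"
    "j < dim_col (a \<cdot>\<^sub>m 1\<^sub>m n + A * mat_poly_eval P A)"
  then have ij: "i < n" "j < n" using A mat_poly_eval_carrier[OF A, of P] by auto
  have pow: "A ^\<^sub>m l \<in> carrier_mat n n" for l using A by (rule pow_carrier_mat)
  have powS: "A ^\<^sub>m Suc l = A * A ^\<^sub>m l" for l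
    by (induction l) (use A pow in \<open>simp_all add: assoc_mult_mat[of _ n n _ n _ n]\<close>)
  have bound: "mat_poly_eval Q A $$ (i, j) = (\<Sum>l\<le>N. Polynomial.coeff Q l * (A ^\<^sub>m l) $$ (i, j))"
    if "Polynomial.degree Q \<le> N" "i < n" "j < n" for Q N i j
  proof -
    have "(\<Sum>l\<le>N. Polynomial.coeff Q l * (A ^\<^sub>m l) $$ (i, j)) = (\<Sum>l\<le>Polynomial.degree Q. Polynomial.coeff Q l * (A ^\<^sub>m l) $$ (i, j))"
      using that by (intro sum.mono_neutral_right) (auto simp: coeff_eq_0)
    then show ?thesis using that A by (simp add: mat_poly_eval_def)
  qed
  let ?N = "Polynomial.degree P"
  have "mat_poly_eval (pCons a P) A $$ (i, j)
      = (\<Sum>l\<le>Suc ?N. Polynomial.coeff (pCons a P) l * (A ^\<^sub>m l) $$ (i, j))"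
    using ij degree_pCons_le by (intro bound)
  also have "\<dots> = a * 1\<^sub>m n $$ (i, j) + (\<Sum>l\<le>?N. Polynomial.coeff P l * (A * A ^\<^sub>m l) $$ (i, j))"
    using A by (subst sum.atMost_Suc_shift) (simp only: powS, simp)
  also have "(\<Sum>l\<le>?N. Polynomial.coeff P l * (A * A ^\<^sub>m l) $$ (i, j))
      = (\<Sum>m<n. A $$ (i, m) * (\<Sum>l\<le>?N. Polynomial.coeff P l * (A ^\<^sub>m l) $$ (m, j)))"
    using ij by (simp add: index_mult_sum[OF A pow] sum_distrib_left sum_distrib_right del: index_mult_mat(1))
      (subst sum.swap, simp add: ac_simps)
  also have "\<dots> = (A * mat_poly_eval P A) $$ (i, j)"
    using ij by (simp add: index_mult_sum[OF A mat_poly_eval_carrier[OF A]] bound[of P ?N] del: index_mult_mat(1))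
  finally show "mat_poly_eval (pCons a P) A $$ (i, j) = (a \<cdot>\<^sub>m 1\<^sub>m n + A * mat_poly_eval P A) $$ (i, j)"
    using ij A mat_poly_eval_carrier[OF A, of P] by simp
qed (use A mat_poly_eval_carrier[OF A, of P] mat_poly_eval_carrier[OF A, of "pCons a P"] in auto)

lemma min_poly_eqI:
  fixes A :: "'a :: field mat"
  assumes "monic \<mu>" and "\<And>P. mat_poly_eval P A = 0\<^sub>m (dim_row A) (dim_row A) \<longleftrightarrow> \<mu> dvd P"
  shows "min_poly A = \<mu>"
  unfolding min_poly_def
proof (rule the_equality)
  show "monic \<mu> \<and> (\<forall>P. mat_poly_eval P A = 0\<^sub>m (dim_row A) (dim_row A) \<longleftrightarrow> \<mu> dvd P)"
    using assms by blast
  fix \<nu> assume \<nu>: "monic \<nu> \<and> (\<forall>P. mat_poly_eval P A = 0\<^sub>m (dim_row A) (dim_row A) \<longleftrightarrow> \<nu> dvd P)"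
  have "\<nu> dvd P \<longleftrightarrow> \<mu> dvd P" for P
    using \<nu> assms(2)[of P] by metis
  from this[of \<mu>] this[of \<nu>] have "\<nu> dvd \<mu>" "\<mu> dvd \<nu>" by simp_all
  then show "\<nu> = \<mu>" using assms(1) \<nu> by (intro poly_dvd_antisym) auto
qed

definition scalar_mat2 :: "'a :: zero mat \<Rightarrow> bool" where
  "scalar_mat2 A \<longleftrightarrow> (\<exists>x. A = mat2 x 0 0 x)"

text \<open>Every polynomial is, modulo the characteristic polynomial, of degree at most one, and a
  matrix that is not scalar satisfies no nonzero polynomial of degree one.\<close>

lemma regular_mat2_iff:
  fixes A :: "'a :: field mat"
  assumes "A \<in> carrier_mat 2 2"
  shows "regular_mat A \<longleftrightarrow> \<not> scalar_mat2 A"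
proof -
  obtain p q r t where A: "A = mat2 p q r t" using assms by (rule mat2_cases)
  define \<chi> where "\<chi> = [:p * t - q * r, - (p + t), 1:]"
  have \<chi>: "char_poly A = \<chi>" by (simp add: A \<chi>_def char_poly_mat2)
  have zero: "0\<^sub>m 2 2 = mat2 0 0 0 (0 :: 'a)" by (rule eq_matI) (auto simp: less_small)
  show ?thesis
  proof (cases "scalar_mat2 A")
    case True
    then obtain x where x: "A = mat2 x 0 0 x" by (auto simp: scalar_mat2_def)
    have ev: "mat_poly_eval P A = mat2 (poly P x) 0 0 (poly P x)" for P
      unfolding x
      by (induction P)
        (simp_all add: mat_poly_eval_0[OF assms, unfolded x] zero
          mat_poly_eval_pCons[OF assms, unfolded x] mat2_mult mat2_add mat2_smult mat2_one)
    have "min_poly A = [:- x, 1:]"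
    proof (rule min_poly_eqI)
      fix P
      have "mat_poly_eval P A = 0\<^sub>m (dim_row A) (dim_row A) \<longleftrightarrow> poly P x = 0"
        unfolding ev by (simp add: x zero)
      then show "mat_poly_eval P A = 0\<^sub>m (dim_row A) (dim_row A) \<longleftrightarrow> [:- x, 1:] dvd P"
        by (simp add: poly_eq_0_iff_dvd)
    qed simp
    then have "min_poly A \<noteq> char_poly A" by (simp add: \<chi> \<chi>_def)
    then show ?thesis using True by (auto simp: regular_mat_def)
  next
    case False
    have ev: "\<exists>Q a b. P = \<chi> * Q + [:a, b:] \<and>
        mat_poly_eval P A = mat2 (a + b * p) (b * q) (b * r) (a + b * t)" for P
    proof (induction P)
      case 0
      show ?case
        by (rule exI[of _ 0], rule exI[of _ 0], rule exI[of _ 0])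
          (simp add: mat_poly_eval_0[OF assms] zero)
    next
      case (pCons u P)
      then obtain Q a b where P: "P = \<chi> * Q + [:a, b:]"
        "mat_poly_eval P A = mat2 (a + b * p) (b * q) (b * r) (a + b * t)" by blast
      have "pCons u P = \<chi> * (pCons b Q) + [:u - b * (p * t - q * r), a + b * (p + t):]"
        unfolding P(1) by (simp add: \<chi>_def algebra_simps)
      moreover have "mat_poly_eval (pCons u P) A =
          mat2 (u - b * (p * t - q * r) + (a + b * (p + t)) * p) ((a + b * (p + t)) * q)
            ((a + b * (p + t)) * r) (u - b * (p * t - q * r) + (a + b * (p + t)) * t)"
        unfolding mat_poly_eval_pCons[OF assms] P(2)
        by (simp add: A mat2_mult mat2_add mat2_smult mat2_one algebra_simps)
      ultimately show ?case by blast
    qed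
    have "min_poly A = \<chi>"
    proof (rule min_poly_eqI)
      show "monic \<chi>" by (simp add: \<chi>_def)
      fix P
      obtain Q a b where P: "P = \<chi> * Q + [:a, b:]"
        "mat_poly_eval P A = mat2 (a + b * p) (b * q) (b * r) (a + b * t)" using ev[of P] by blast
      have "\<chi> dvd P \<longleftrightarrow> \<chi> dvd [:a, b:]" unfolding P(1) by (simp add: dvd_add_right_iff)
      also have "\<dots> \<longleftrightarrow> a = 0 \<and> b = 0"
      proof
        assume "\<chi> dvd [:a, b:]"
        moreover have "Polynomial.degree [:a, b:] < Polynomial.degree \<chi>" by (simp add: \<chi>_def)
        ultimately have "[:a, b:] = 0" using dvd_imp_degree_le by (metis leD)
        then show "a = 0 \<and> b = 0" by simp
      qed simp
      also have "\<dots> \<longleftrightarrow> mat_poly_eval P A = 0\<^sub>m (dim_row A) (dim_row A)"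
      proof
        assume "mat_poly_eval P A = 0\<^sub>m (dim_row A) (dim_row A)"
        then have z: "a + b * p = 0" "b * q = 0" "b * r = 0" "a + b * t = 0"
          unfolding P(2) by (simp_all add: A zero)
        have "b = 0"
        proof (rule ccontr)
          assume "b \<noteq> 0"
          then have "q = 0" "r = 0" using z by auto
          moreover have "b * p = b * t" using z by (metis add_left_cancel)
          then have "p = t" using \<open>b \<noteq> 0\<close> by simp
          ultimately show False using False A by (auto simp: scalar_mat2_def)
        qed
        then show "a = 0 \<and> b = 0" using z by simp
      qed (unfold P(2), simp add: A zero)
      finally show "mat_poly_eval P A = 0\<^sub>m (dim_row A) (dim_row A) \<longleftrightarrow> \<chi> dvd P" by simp
    qed
    then show ?thesis using False \<chi> by (simp add: regular_mat_def)
  qed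
qed

definition companion2 :: "'a \<Rightarrow> 'a \<Rightarrow> 'a :: {zero, one} mat" where
  "companion2 c s = mat2 0 c 1 s"

lemma companion2_carrier [simp]: "companion2 c s \<in> carrier_mat 2 2"
  by (simp add: companion2_def)

lemma regular_companion2: "regular_mat (companion2 c s)" for c :: "'a :: field"
  by (auto simp: regular_mat2_iff scalar_mat2_def companion2_def)

lemma GL2_I:
  assumes "a * d - b * c \<noteq> (0 :: 'a :: field)"
  shows "mat2 a b c d \<in> carrier (GL 2)"
proof -
  define D where "D = a * d - b * c"
  have D: "D \<noteq> 0" "a * d = D + b * c" using assms by (simp_all add: D_def)
  show ?thesis
  proof (rule GL_I[of _ _ "mat2 (d / D) (- b / D) (- c / D) (a / D)"])
    show "mat2 a b c d * mat2 (d / D) (- b / D) (- c / D) (a / D) = 1\<^sub>m 2"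
      "mat2 (d / D) (- b / D) (- c / D) (a / D) * mat2 a b c d = 1\<^sub>m 2"
      using D by (simp_all add: mat2_mult mat2_one divide_simps) (simp_all add: algebra_simps)
  qed simp_all
qed

text \<open>The columns of the conjugating matrix are a cyclic vector \<open>(x, y)\<close> and its image. Their
  determinant is a binary quadratic form, which is nonzero as \<open>C\<close> is not scalar, and a nonzero form
  takes a nonzero value at one of \<open>(1, 0)\<close>, \<open>(0, 1)\<close> and \<open>(1, 1)\<close>.\<close>

lemma regular_mat2_conj_companion:
  fixes C :: "'a :: field mat"
  assumes "C \<in> carrier_mat 2 2" "regular_mat C"
  obtains g c s where "g \<in> carrier (GL 2)" "g * C = companion2 c s * g"
proof -
  obtain p q r t where C: "C = mat2 p q r t" using assms(1) by (rule mat2_cases)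
  have ns: "\<not> (q = 0 \<and> r = 0 \<and> p = t)"
    using assms regular_mat2_iff[OF assms(1)] by (auto simp: scalar_mat2_def C)
  obtain x y where xy: "r * x\<^sup>2 + (t - p) * x * y - q * y\<^sup>2 \<noteq> 0"
  proof -
    consider "r \<noteq> 0" | "q \<noteq> 0" | "r = 0" "q = 0" "t - p \<noteq> 0" using ns by auto
    then show thesis
    proof cases
      case 1 then show thesis by (intro that[of 1 0]) simp
    next
      case 2 then show thesis by (intro that[of 0 1]) simp
    next
      case 3 then show thesis by (intro that[of 1 1]) simp
    qed
  qed
  define P where "P = mat2 x (p * x + q * y) y (r * x + t * y)"
  define K where "K = companion2 (q * r - p * t) (p + t)"
  have "P \<in> carrier (GL 2)"
    unfolding P_def by (rule GL2_I) (use xy in \<open>simp add: algebra_simps power2_eq_square\<close>)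
  then obtain g where g: "g \<in> carrier (GL 2)" "P \<in> carrier_mat 2 2" "g \<in> carrier_mat 2 2"
      "P * g = 1\<^sub>m 2" "g * P = 1\<^sub>m 2" by (rule GL_cases)
  have CP: "C * P = P * K"
    by (simp add: C P_def K_def companion2_def mat2_mult algebra_simps)
  have Kc: "K \<in> carrier_mat 2 2" by (simp add: K_def)
  have "g * C = g * (C * P) * g"
    using GL_cancel'[OF g(4,2,3), of "g * C" 2] g assms(1)
    by (simp add: assoc2)
  also have "\<dots> = K * g"
    unfolding CP using GL_cancel[OF g(5,3,2) Kc] by simp
  finally show thesis using that[OF g(1)] by (simp add: K_def)
qed

section \<open>Multiplicity one for regular representations\<close>

text \<open>Companion matrices of the same trace are conjugate only if they are equal, and the centralizer of
  a companion matrix \<open>C\<close> consists of the \<open>x + y C\<close>.\<close>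

lemma companion2_intertwiner:
  fixes X :: "'a :: field mat"
  assumes "X \<in> carrier (GL 2)" "X * companion2 c s = companion2 c' s * X"
  obtains x y where "c' = c" "X = mat2 x (c * y) y (x + s * y)"
proof -
  obtain Y where Y: "X \<in> carrier_mat 2 2" "Y \<in> carrier_mat 2 2" "X * Y = 1\<^sub>m 2"
    using assms(1) by (rule GL_cases)
  obtain a b u f where X: "X = mat2 a b u f" using Y(1) by (rule mat2_cases)
  obtain a' b' u' f' where Y': "Y = mat2 a' b' u' f'" using Y(2) by (rule mat2_cases)
  have eqs: "b = c' * u" "a * c + b * s = c' * f" "f = a + s * u" "u * c + f * s = b + s * f"
  proof -
    have "mat2 b (a * c + b * s) f (u * c + f * s) = mat2 (c' * u) (c' * f) (a + s * u) (b + s * f)"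
      using assms(2) unfolding X companion2_def mat2_mult by (simp del: mat2_eq_iff)
    then show "b = c' * u" "a * c + b * s = c' * f" "f = a + s * u" "u * c + f * s = b + s * f"
      unfolding mat2_eq_iff by blast+
  qed
  have 1: "(c - c') * a = 0" "(c - c') * u = 0"
  proof -
    have "(c - c') * u = (u * c + f * s) - s * f - c' * u" by (simp add: algebra_simps)
    then show "(c - c') * u = 0" unfolding eqs(4) using eqs(1) by simp
    have "(c - c') * a = (a * c + b * s) - c' * (a + s * u) - s * (b - c' * u)"
      by (simp add: algebra_simps)
    then show "(c - c') * a = 0" unfolding eqs(2) eqs(3) using eqs(1) by simp
  qed
  have "c' = c"
  proof (rule ccontr)
    assume "c' \<noteq> c"
    then have "a = 0" "u = 0" using 1 by auto
    then have "X = mat2 0 0 0 0" using eqs X by simp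
    then show False using Y(3) by (simp add: Y' mat2_mult mat2_one)
  qed
  then show thesis using that[of a u] eqs X by simp
qed

locale irreducible_GL2_representation =
  GL_representation \<omega> red \<psi> 2 \<tau> + irreducible_representation "GL 2 :: 'r mat monoid" \<tau>
  for \<omega> :: "'r :: comm_ring_1" and red :: "'r \<Rightarrow> 'k :: {field, finite}" and \<psi>
    and \<tau> :: "('r mat, 'v :: ab_group_add) rep"
begin

lemma subspace_eigenvectors: "vs.subspace (eigenvectors 2 C \<tau>)"
  by (auto simp: vs.subspace_def eigenvectors_def congr_GL act_add act_sc vs.scale_right_distrib
      mult.commute)

text \<open>The stabilizer of the character attached to a companion matrix is generated by the
  congruence subgroup and the commuting matrices \<open>x + y C\<close>, with \<open>C\<close> lifted.\<close>

lemma stabilizer_eigenvector: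
  assumes w: "w \<in> eigenvectors 2 (companion2 c s) \<tau>" "w \<noteq> 0"
  obtains v where "v \<in> eigenvectors 2 (companion2 c s) \<tau>" "v \<noteq> 0"
    "\<And>g. g \<in> carrier (GL 2) \<Longrightarrow> redm g * companion2 c s = companion2 c s * redm g \<Longrightarrow>
       \<exists>a. act g v = sc a v"
proof -
  define m where "m x y = mat2 x (lift c * y) y (x + lift s * y)" for x y :: 'r
  define S where "S = {m x y | x y. m x y \<in> carrier (GL 2)}"
  have S: "S \<subseteq> carrier (GL 2)" by (auto simp: S_def)
  have red_m: "redm (m x y) = mat2 (red x) (c * red y) (red y) (red x + s * red y)" for x y
    by (simp add: m_def red_add red_mult)
  have fin: "finite (carrier (GL 2) :: 'r mat set)"
    by (rule finite_subset[OF _ finite_carrier_mat[OF finite_UNIV_ring, of 2 2]]) (auto simp: GL_mat)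
  have comm: "a \<otimes>\<^bsub>GL 2\<^esub> b = b \<otimes>\<^bsub>GL 2\<^esub> a" if "a \<in> S" "b \<in> S" for a b
    using that by (auto simp: S_def m_def mat2_mult algebra_simps)
  have stable: "act t x \<in> eigenvectors 2 (companion2 c s) \<tau>"
    if "t \<in> S" "x \<in> eigenvectors 2 (companion2 c s) \<tau>" for t x
  proof (rule act_eigenvectors[OF that(2)])
    show "t \<in> carrier (GL 2)" using that S by blast
    show "redm t * companion2 c s = companion2 c s * redm t"
      using that(1) by (auto simp: S_def red_m companion2_def mat2_mult algebra_simps)
  qed simp_all
  have sub: "eigenvectors 2 (companion2 c s) \<tau> \<subseteq> V" by (auto simp: eigenvectors_def)
  obtain v where v: "v \<in> eigenvectors 2 (companion2 c s) \<tau>" "v \<noteq> 0"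
    and ev: "\<And>t. t \<in> S \<Longrightarrow> \<exists>a. act t v = sc a v"
    by (rule common_eigenvector[OF fin S comm subspace_eigenvectors sub stable w]) blast+
  have vV: "v \<in> V" using v sub by blast
  show thesis
  proof (rule that[OF v])
    fix g :: "'r mat" assume g: "g \<in> carrier (GL 2)"
      and eq: "redm g * companion2 c s = companion2 c s * redm g"
    obtain x y where xy: "redm g = mat2 x (c * y) y (x + s * y)"
      using companion2_intertwiner[OF GL_redm[OF g] eq] by blast
    define t where "t = m (lift x) (lift y)"
    have rt: "redm t = redm g" by (simp add: t_def red_m xy)
    have tG: "t \<in> carrier (GL 2)" using GL_redm[OF g] by (intro GL_redmD) (simp add: rt)
    then have tS: "t \<in> S" by (auto simp: S_def t_def)
    obtain h where h: "h \<in> carrier (GL 2)" "t \<in> carrier_mat 2 2" "h \<in> carrier_mat 2 2"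
      "t * h = 1\<^sub>m 2" "h * t = 1\<^sub>m 2" using tG by (rule GL_cases)
    have gc: "g \<in> carrier_mat 2 2" using g by (rule GL_mat)
    have "redm (h * g) = redm h * redm t" using redm_mult[of h 2 2 g 2] h gc by (simp add: rt)
    also have "\<dots> = 1\<^sub>m 2" using redm_mult[of h 2 2 t 2] h by simp
    finally obtain M where M: "M \<in> carrier_mat 2 2" "h * g = congr M"
      using mult_carrier_mat[OF h(3) gc] by (rule redm_eq_congrE)
    have "g = t * congr M" using GL_cancel[OF h(4,2,3) gc] M by simp
    then have "act g v = act t (act (congr M) v)"
      using act_mult_GL[OF tG congr_GL[OF M(1)] vV] by simp
    also have "\<dots> = sc (e (mat_trace (companion2 c s * M))) (act t v)"
      using v(1) M tG vV by (simp add: eigenvectors_def act_sc)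
    finally show "\<exists>a. act g v = sc a v" using ev[OF tS] by auto
  qed
qed

text \<open>A functional with a given character under the congruence subgroup is determined by its value
  at one vector \<open>v\<close> that is an eigenvector of the whole stabilizer: on every translate of \<open>v\<close> it
  either vanishes or is a fixed multiple of that value, and the translates span.\<close>

lemma eigenfunctional_unique:
  assumes l: "eigenfunctional 2 (companion2 c s) \<tau> l" "u \<in> V" "l u \<noteq> 0"
    and l': "eigenfunctional 2 (companion2 c' s) \<tau> l'" "u' \<in> V" "l' u' \<noteq> 0"
  obtains a where "c' = c" "\<And>w. w \<in> V \<Longrightarrow> l' w = a * l w"
proof -
  obtain w0 where "w0 \<in> eigenvectors 2 (companion2 c s) \<tau>" "w0 \<noteq> 0"
    using exists_eigenvector[OF _ l(2,1,3)] by auto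
  then obtain v where v: "v \<in> eigenvectors 2 (companion2 c s) \<tau>" "v \<noteq> 0"
    and ev: "\<And>g. g \<in> carrier (GL 2) \<Longrightarrow> redm g * companion2 c s = companion2 c s * redm g \<Longrightarrow>
       \<exists>a. act g v = sc a v"
    by (rule stabilizer_eigenvector) blast
  have vV: "v \<in> V" using v by (simp add: eigenvectors_def)
  have lin: "linear_functional \<tau> l" "linear_functional \<tau> l'"
    using l l' by (simp_all add: eigenfunctional_def)
  have translate: "\<exists>g \<in> carrier (GL 2). m (act g v) \<noteq> 0"
    if "linear_functional \<tau> m" "x \<in> V" "m x \<noteq> 0" for m x
    using functional_eq_0[OF that(1) vV v(2) _ that(2)] that(3) by blast
  obtain g where g: "g \<in> carrier (GL 2)" "l' (act g v) \<noteq> 0"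
    using translate[OF lin(2) l'(2,3)] by blast
  have eq: "redm g * companion2 c s = companion2 c' s * redm g"
    by (rule eigenfunctional_act_nonzero[OF v(1) _ _ l'(1) g]) simp_all
  have c': "c' = c" by (rule companion2_intertwiner[OF GL_redm[OF g(1)] eq])
  have van: "m (act g v) = 0"
    if m: "eigenfunctional 2 (companion2 c s) \<tau> m" "m v = 0" and g: "g \<in> carrier (GL 2)" for m g
  proof (rule ccontr)
    assume ne: "m (act g v) \<noteq> 0"
    have "redm g * companion2 c s = companion2 c s * redm g"
      by (rule eigenfunctional_act_nonzero[OF v(1) _ _ m(1) g ne]) simp_all
    then obtain a where "act g v = sc a v" using ev[OF g] by blast
    then show False using ne m vV by (simp add: eigenfunctional_def linear_functional_def)
  qed
  have lv: "l v \<noteq> 0" using translate[OF lin(1) l(2,3)] van[OF l(1)] by blast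
  define a where "a = l' v / l v"
  define m where "m w = l' w - a * l w" for w
  have m: "eigenfunctional 2 (companion2 c s) \<tau> m"
    using l(1) l'(1) unfolding c'
    by (simp add: eigenfunctional_def linear_functional_def m_def algebra_simps)
  have "m v = 0" using lv by (simp add: m_def a_def)
  then have "m w = 0" if "w \<in> V" for w
    using functional_eq_0[of m v w] van[OF m] vV v(2) that m by (simp add: eigenfunctional_def)
  then show thesis using that[of a] c' by (simp add: m_def)
qed

text \<open>The functionals that arise from the Whittaker space are prescribed only on the part of the
  congruence subgroup where the lower left entry vanishes. Decomposing them under the remaining
  coordinate gives one eigenfunctional for each companion matrix with trace \<open>s\<close>.\<close>

definition triangular_functional :: "'k \<Rightarrow> ('v \<Rightarrow> complex) \<Rightarrow> bool" where
  "triangular_functional s l \<longleftrightarrow> linear_functional \<tau> l \<and>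
     (\<forall>a b d. \<forall>v \<in> V. l (act (congr (mat2 a b 0 d)) v) = e (b + s * d) * l v)"

lemma trace_companion2_mult:
  "mat_trace (companion2 c s * mat2 a b y d) = c * y + (b + s * d)" for c :: 'k
  by (simp add: companion2_def mat2_mult algebra_simps)

lemma eigenfunctional_triangular:
  "eigenfunctional 2 (companion2 c s) \<tau> l \<Longrightarrow> triangular_functional s l"
  by (auto simp: eigenfunctional_def triangular_functional_def trace_companion2_mult)

definition component :: "'k \<Rightarrow> ('v \<Rightarrow> complex) \<Rightarrow> 'v \<Rightarrow> complex" where
  "component c l v = (\<Sum>y\<in>UNIV. e (- (c * y)) * l (act (congr (mat2 0 0 y 0)) v))"

lemma component_eigenfunctional:
  assumes l: "triangular_functional s l"
  shows "eigenfunctional 2 (companion2 c s) \<tau> (component c l)"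
  unfolding eigenfunctional_def
proof (intro conjI ballI)
  have lin: "linear_functional \<tau> l" using l by (simp add: triangular_functional_def)
  show "linear_functional \<tau> (component c l)"
    using lin
    by (simp add: linear_functional_def component_def act_add act_sc congr_GL distrib_left
        sum.distrib sum_distrib_left ac_simps)
  fix M :: "'k mat" and v assume M: "M \<in> carrier_mat 2 2" and v: "v \<in> V"
  obtain a b z d where Mz: "M = mat2 a b z d" using M by (rule mat2_cases)
  have "component c l (act (congr M) v)
      = (\<Sum>y\<in>UNIV. e (- (c * y)) * (e (b + s * d) * l (act (congr (mat2 0 0 (y + z) 0)) v)))"
    unfolding component_def
  proof (intro sum.cong refl)
    fix y
    have "congr (mat2 0 0 y 0) * congr M = congr (mat2 a b 0 d) * congr (mat2 0 0 (y + z) 0)"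
      by (simp add: congr_add[of _ 2] Mz mat2_add)
    then have "act (congr (mat2 0 0 y 0)) (act (congr M) v)
        = act (congr (mat2 a b 0 d)) (act (congr (mat2 0 0 (y + z) 0)) v)"
      using M v by (simp add: act_mult_GL[symmetric] congr_GL)
    then show "e (- (c * y)) * l (act (congr (mat2 0 0 y 0)) (act (congr M) v))
        = e (- (c * y)) * (e (b + s * d) * l (act (congr (mat2 0 0 (y + z) 0)) v))"
      using l v by (simp add: triangular_functional_def congr_GL)
  qed
  also have "\<dots> = (\<Sum>y\<in>UNIV. e (- (c * (y - z))) * (e (b + s * d) * l (act (congr (mat2 0 0 y 0)) v)))"
    by (rule sum.reindex_bij_witness[of _ "\<lambda>y. y - z" "\<lambda>y. y + z"]) auto
  also have "\<dots> = (\<Sum>y\<in>UNIV. e (c * z + (b + s * d)) * (e (- (c * y)) * l (act (congr (mat2 0 0 y 0)) v)))"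
  proof (intro sum.cong refl)
    fix y
    have "e (- (c * (y - z))) = e (c * z) * e (- (c * y))"
      by (simp add: e_add[symmetric] algebra_simps)
    then show "e (- (c * (y - z))) * (e (b + s * d) * l (act (congr (mat2 0 0 y 0)) v))
        = e (c * z + (b + s * d)) * (e (- (c * y)) * l (act (congr (mat2 0 0 y 0)) v))"
      by (simp add: e_add)
  qed
  also have "\<dots> = e (mat_trace (companion2 c s * M)) * component c l v"
    by (simp add: component_def sum_distrib_left Mz trace_companion2_mult)
  finally show "component c l (act (congr M) v) = e (mat_trace (companion2 c s * M)) * component c l v" .
qed

lemma sum_component:
  assumes v: "v \<in> V"
  shows "(\<Sum>c\<in>UNIV. component c l v) = of_nat CARD('k) * l v"
proof -
  have "(\<Sum>c\<in>UNIV. component c l v)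
      = (\<Sum>y\<in>UNIV. (\<Sum>c\<in>UNIV. e (- y * c)) * l (act (congr (mat2 0 0 y 0)) v))"
    unfolding component_def by (subst sum.swap) (simp add: sum_distrib_right mult.commute)
  also have "\<dots> = (\<Sum>y\<in>(UNIV :: 'k set). if y = 0 then of_nat CARD('k) * l v else 0)"
  proof (intro sum.cong refl)
    fix y :: 'k
    have "mat2 0 0 0 0 = (0\<^sub>m 2 2 :: 'k mat)" by (rule eq_matI) (auto simp: less_small)
    then have "act (congr (mat2 0 0 0 0)) v = v" using v act_one_GL[OF v] by simp
    then show "(\<Sum>c\<in>UNIV. e (- y * c)) * l (act (congr (mat2 0 0 y 0)) v)
        = (if y = 0 then of_nat CARD('k) * l v else 0)"
      using sum_e[of "- y"] by simp
  qed
  finally show ?thesis by simp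
qed

lemma exists_component:
  assumes "v \<in> V" "l v \<noteq> 0"
  obtains c where "component c l v \<noteq> 0"
proof -
  have "(\<Sum>c\<in>UNIV. component c l v) \<noteq> 0" using assms by (simp add: sum_component)
  then show thesis using that by (metis sum.neutral)
qed

text \<open>By \<open>eigenfunctional_unique\<close>, all triangular functionals on \<open>\<tau>\<close> have their nonzero components
  at the same \<open>c\<close>, so each of them is a multiple of that component, and the components are
  proportional.\<close>

lemma triangular_functional_unique:
  assumes l: "triangular_functional s l" "u \<in> V" "l u \<noteq> 0" and l': "triangular_functional s l'"
  obtains a where "\<And>w. w \<in> V \<Longrightarrow> l' w = a * l w"
proof -
  obtain c where c: "component c l u \<noteq> 0" using exists_component[of u l, OF l(2,3)] .
  note ce = component_eigenfunctional
  have proportional: "\<exists>a. \<forall>w \<in> V. component c m w = a * component c l w"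
    and other: "c1 \<noteq> c \<Longrightarrow> w \<in> V \<Longrightarrow> component c1 m w = 0"
    if m: "triangular_functional s m" for m c1 w
  proof -
    have "\<exists>a. \<forall>w \<in> V. component c m w = a * component c l w" if "u' \<in> V" "component c m u' \<noteq> 0" for u'
      by (rule eigenfunctional_unique[OF ce[OF l(1)] l(2) c ce[OF m] that]) blast
    then show "\<exists>a. \<forall>w \<in> V. component c m w = a * component c l w"
      by (metis mult_zero_left)
    show "component c1 m w = 0" if "c1 \<noteq> c" "w \<in> V"
    proof (rule ccontr)
      assume "component c1 m w \<noteq> 0"
      then have "c1 = c" by (rule eigenfunctional_unique[OF ce[OF l(1)] l(2) c ce[OF m] that(2)])
      then show False using that(1) by simp
    qed
  qed
  have single: "of_nat CARD('k) * m w = component c m w" if m: "triangular_functional s m" and w: "w \<in> V" for m w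
  proof -
    have "(\<Sum>c1\<in>UNIV. component c1 m w) = (\<Sum>c1\<in>UNIV. if c1 = c then component c m w else 0)"
      using other[OF m _ w] by (intro sum.cong) auto
    then show ?thesis using sum_component[OF w, of m] by simp
  qed
  obtain a where "\<forall>w \<in> V. component c l' w = a * component c l w" using proportional[OF l'] by blast
  then have "of_nat CARD('k) * l' w = of_nat CARD('k) * (a * l w)" if "w \<in> V" for w
    using single[OF l' that] single[OF l(1) that] that by simp
  then show thesis using that[of a] by simp
qed

lemma triangular_functional_regular:
  assumes "triangular_functional s l" "u \<in> V" "l u \<noteq> 0"
  shows "regular_rep \<omega> red \<psi> 2 \<tau>"
proof -
  obtain c where "component c l u \<noteq> 0" using exists_component[of u l, OF assms(2,3)] .
  then obtain w where w: "w \<in> eigenvectors 2 (companion2 c s) \<tau>" "w \<noteq> 0"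
    by (rule exists_eigenvector[OF companion2_carrier assms(2) component_eigenfunctional[OF assms(1)]])
  have "\<forall>k \<in> congruence_subgroup \<omega> 2. act k w = sc (phi \<omega> red \<psi> 2 (companion2 c s) k) w"
    using w by (auto simp: congruence_subgroup_eq phi_congr eigenvectors_def)
  moreover have "w \<in> V" using w by (simp add: eigenvectors_def)
  ultimately show ?thesis
    unfolding regular_rep_def
    using irreducible w(2) regular_companion2[of c s] companion2_carrier[of c s] by blast
qed

text \<open>A translate of an eigenvector for a regular matrix is an eigenvector for a companion matrix; the
  scalar matrices in the congruence subgroup see the trace of the latter, so the central character
  forces it to be \<open>s\<close>.\<close>

lemma regular_triangular_functional:
  assumes reg: "regular_rep \<omega> red \<psi> 2 \<tau>"
    and central: "\<And>a v. v \<in> V \<Longrightarrow> act (congr (mat2 a 0 0 a)) v = sc (e (s * a)) v"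
  obtains l u where "triangular_functional s l" "u \<in> V" "l u \<noteq> 0"
proof -
  obtain C v where C: "C \<in> carrier_mat 2 2" "regular_mat C" and v: "v \<in> V" "v \<noteq> 0"
    and k: "\<forall>k \<in> congruence_subgroup \<omega> 2. act k v = sc (phi \<omega> red \<psi> 2 C k) v"
    using reg unfolding regular_rep_def by blast
  have vC: "v \<in> eigenvectors 2 C \<tau>"
    using v k C by (auto simp: eigenvectors_def congruence_subgroup_eq phi_congr)
  obtain g c s' where g: "g \<in> carrier (GL 2)" "g * C = companion2 c s' * g"
    using regular_mat2_conj_companion[OF C] .
  define h where "h = liftm g"
  have h: "redm h = g" "h \<in> carrier (GL 2)"
    using g by (auto simp: h_def intro!: GL_redmD)
  define w where "w = act h v"
  have w: "w \<in> eigenvectors 2 (companion2 c s') \<tau>"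
    unfolding w_def by (rule act_eigenvectors[OF vC C(1) _ h(2)]) (simp_all add: h g)
  have wV: "w \<in> V" using w by (simp add: eigenvectors_def)
  have "w \<noteq> 0"
  proof
    assume "w = 0"
    obtain h' where h': "h' \<in> carrier (GL 2)" "h' * h = 1\<^sub>m 2" using h(2) by (rule GL_cases)
    have "v = act (h' * h) v" using v(1) h' by (simp add: act_one_GL)
    also have "\<dots> = act h' 0"
      using \<open>w = 0\<close> act_mult_GL[OF h'(1) h(2) v(1)] by (simp add: w_def)
    finally show False using v(2) h' by simp
  qed
  have "e (s' * a) = e (s * a)" for a
  proof -
    have "sc (e (s' * a)) w = sc (e (s * a)) w"
      using w central[OF wV, of a] by (simp add: eigenvectors_def trace_companion2_mult)
    then show ?thesis using \<open>w \<noteq> 0\<close> by (metis vs.scale_cancel_right)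
  qed
  then have "s' = s" by (rule e_inj)
  obtain l where "eigenfunctional 2 (companion2 c s') \<tau> l" "l w \<noteq> 0"
    using exists_eigenfunctional[OF _ w \<open>w \<noteq> 0\<close>] by auto
  then show thesis using that[of l w] eigenfunctional_triangular \<open>s' = s\<close> wV by blast
qed

end

section \<open>Cyclic vectors for an irreducible matrix of size three\<close>

lemma cross_product_eq_0:
  fixes u1 u2 u3 :: "'a :: field"
  assumes "u2 * v3 = u3 * v2" "u3 * v1 = u1 * v3" "u1 * v2 = u2 * v1"
    and "\<not> (u1 = 0 \<and> u2 = 0 \<and> u3 = 0)"
  obtains g where "v1 = g * u1" "v2 = g * u2" "v3 = g * u3"
proof -
  consider "u1 \<noteq> 0" | "u2 \<noteq> 0" | "u3 \<noteq> 0" using assms(4) by blast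
  then show thesis
  proof cases
    case 1
    then show thesis using assms(1-3) by (intro that[of "v1 / u1"]) (simp_all add: field_simps)
  next
    case 2
    then show thesis using assms(1-3) by (intro that[of "v2 / u2"]) (simp_all add: field_simps)
  next
    case 3
    then show thesis using assms(1-3) by (intro that[of "v3 / u3"]) (simp_all add: field_simps)
  qed
qed

definition no_eigenvector3 :: "'a :: field mat \<Rightarrow> bool" where
  "no_eigenvector3 B \<longleftrightarrow> (\<forall>l x y z. B $$ (0,0) * x + B $$ (0,1) * y + B $$ (0,2) * z = l * x \<longrightarrow>
     B $$ (1,0) * x + B $$ (1,1) * y + B $$ (1,2) * z = l * y \<longrightarrow>
     B $$ (2,0) * x + B $$ (2,1) * y + B $$ (2,2) * z = l * z \<longrightarrow> x = 0 \<and> y = 0 \<and> z = 0)"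

lemma no_eigenvector3D:
  assumes "no_eigenvector3 (mat3 a b c d e f g h i)"
    and "a * x + b * y + c * z = l * x" "d * x + e * y + f * z = l * y" "g * x + h * y + i * z = l * z"
  shows "x = 0 \<and> y = 0 \<and> z = 0"
  using assms unfolding no_eigenvector3_def by (metis (no_types, lifting) One_nat_def mat3_index)

lemma no_eigenvector3:
  fixes B :: "'a :: field mat"
  assumes B: "B \<in> carrier_mat 3 3" and irr: "Factorial_Ring.irreducible (char_poly B)"
  shows "no_eigenvector3 B"
  unfolding no_eigenvector3_def
proof (intro allI impI)
  fix l x y z
  assume eqs: "B $$ (0,0) * x + B $$ (0,1) * y + B $$ (0,2) * z = l * x"
    "B $$ (1,0) * x + B $$ (1,1) * y + B $$ (1,2) * z = l * y"
    "B $$ (2,0) * x + B $$ (2,1) * y + B $$ (2,2) * z = l * z"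
  have deg: "Polynomial.degree (char_poly B) = 3" using degree_monic_char_poly[OF B] by simp
  have noroot: "poly (char_poly B) l \<noteq> 0"
  proof
    assume "poly (char_poly B) l = 0"
    then obtain q where q: "char_poly B = [:- l, 1:] * q" by (auto simp: poly_eq_0_iff_dvd dvd_def)
    then have "q \<noteq> 0" using deg by auto
    then have "Polynomial.degree q = 2" using deg unfolding q by (subst (asm) degree_mult_eq) auto
    then have "\<not> q dvd 1" by (auto simp: is_unit_iff_degree \<open>q \<noteq> 0\<close>)
    moreover have "\<not> [:- l, 1:] dvd 1" by (auto simp: is_unit_iff_degree)
    ultimately show False using irr irreducibleD[OF irr q] by blast
  qed
  define v where "v = vec 3 (\<lambda>i. [x, y, z] ! i)"
  have v: "v \<in> carrier_vec 3" by (simp add: v_def)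
  have "B *\<^sub>v v = l \<cdot>\<^sub>v v"
  proof (rule eq_vecI)
    fix i assume "i < dim_vec (l \<cdot>\<^sub>v v)"
    then have "i = 0 \<or> i = Suc 0 \<or> i = 2" by (auto simp: v_def less_small)
    then show "(B *\<^sub>v v) $ i = (l \<cdot>\<^sub>v v) $ i"
      using B eqs by (auto simp: v_def scalar_prod_def atLeast0LessThan lessThan_small add.assoc)
  qed (use B v in auto)
  then have "v = 0\<^sub>v 3"
    using noroot eigenvalue_root_char_poly[OF B, of l] v B
    by (auto simp: eigenvalue_def eigenvector_def)
  then have "v $ 0 = 0" "v $ 1 = 0" "v $ 2 = 0" by auto
  then show "x = 0 \<and> y = 0 \<and> z = 0" by (simp add: v_def)
qed

text \<open>If the iterates \<open>w\<close>, \<open>B w\<close>, \<open>B\<^sup>2 w\<close> were contained in a plane \<open>u \<cdot> x = 0\<close>, then \<open>w\<close> and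
  \<open>B w\<close> would both lie on the line orthogonal to the independent covectors \<open>u\<close> and \<open>u B\<close>.\<close>

lemma iterates_not_in_plane:
  fixes B :: "'a :: field mat"
  assumes ev: "no_eigenvector3 B" "no_eigenvector3 B\<^sup>T" and B: "B = mat3 a b c d e f g h i"
    and w: "\<not> (w1 = 0 \<and> w2 = 0 \<and> w3 = 0)"
    and v: "v1 = a * w1 + b * w2 + c * w3" "v2 = d * w1 + e * w2 + f * w3" "v3 = g * w1 + h * w2 + i * w3"
    and z: "z1 = a * v1 + b * v2 + c * v3" "z2 = d * v1 + e * v2 + f * v3" "z3 = g * v1 + h * v2 + i * v3"
    and u: "u1 * w1 + u2 * w2 + u3 * w3 = 0" "u1 * v1 + u2 * v2 + u3 * v3 = 0"
      "u1 * z1 + u2 * z2 + u3 * z3 = 0"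
  shows "u1 = 0 \<and> u2 = 0 \<and> u3 = 0"
proof (rule ccontr)
  assume nu: "\<not> (u1 = 0 \<and> u2 = 0 \<and> u3 = 0)"
  define s1 where "s1 = u1 * a + u2 * d + u3 * g"
  define s2 where "s2 = u1 * b + u2 * e + u3 * h"
  define s3 where "s3 = u1 * c + u2 * f + u3 * i"
  have s: "s1 * w1 + s2 * w2 + s3 * w3 = 0" "s1 * v1 + s2 * v2 + s3 * v3 = 0"
    using u(2,3) by (simp_all add: s1_def s2_def s3_def v(1,2,3) z algebra_simps)
  define n1 where "n1 = u2 * s3 - u3 * s2"
  define n2 where "n2 = u3 * s1 - u1 * s3"
  define n3 where "n3 = u1 * s2 - u2 * s1"
  have T: "B\<^sup>T = mat3 a d g b e h c f i"
    unfolding B by (rule eq_matI) (auto simp: less_small)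
  have nn: "\<not> (n1 = 0 \<and> n2 = 0 \<and> n3 = 0)"
  proof
    assume "n1 = 0 \<and> n2 = 0 \<and> n3 = 0"
    then have "u2 * s3 = u3 * s2" "u3 * s1 = u1 * s3" "u1 * s2 = u2 * s1"
      by (simp_all add: n1_def n2_def n3_def)
    then obtain l where "s1 = l * u1" "s2 = l * u2" "s3 = l * u3"
      using nu by (rule cross_product_eq_0)
    then have "u1 = 0 \<and> u2 = 0 \<and> u3 = 0"
      by (intro no_eigenvector3D[OF ev(2)[unfolded T], of u1 u2 u3 l])
        (simp_all add: s1_def s2_def s3_def mult.commute)
    then show False using nu by blast
  qed
  have par: "\<exists>l. x1 = l * n1 \<and> x2 = l * n2 \<and> x3 = l * n3"
    if x: "u1 * x1 + u2 * x2 + u3 * x3 = 0" "s1 * x1 + s2 * x2 + s3 * x3 = 0" for x1 x2 x3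
  proof -
    have "n2 * x3 - n3 * x2 = s1 * (u1 * x1 + u2 * x2 + u3 * x3) - u1 * (s1 * x1 + s2 * x2 + s3 * x3)"
      "n3 * x1 - n1 * x3 = s2 * (u1 * x1 + u2 * x2 + u3 * x3) - u2 * (s1 * x1 + s2 * x2 + s3 * x3)"
      "n1 * x2 - n2 * x1 = s3 * (u1 * x1 + u2 * x2 + u3 * x3) - u3 * (s1 * x1 + s2 * x2 + s3 * x3)"
      by (simp_all add: n1_def n2_def n3_def algebra_simps)
    then have "n2 * x3 = n3 * x2" "n3 * x1 = n1 * x3" "n1 * x2 = n2 * x1" using x by simp_all
    then show ?thesis using nn by (rule cross_product_eq_0) blast
  qed
  obtain l where l: "w1 = l * n1" "w2 = l * n2" "w3 = l * n3" using par[OF u(1) s(1)] by blast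
  obtain m where m: "v1 = m * n1" "v2 = m * n2" "v3 = m * n3" using par[OF u(2) s(2)] by blast
  have "l \<noteq> 0" using w l by auto
  then have "v1 = m / l * w1" "v2 = m / l * w2" "v3 = m / l * w3" using l m by simp_all
  then have "a * w1 + b * w2 + c * w3 = m / l * w1" "d * w1 + e * w2 + f * w3 = m / l * w2"
    "g * w1 + h * w2 + i * w3 = m / l * w3" using v by simp_all
  then have "w1 = 0 \<and> w2 = 0 \<and> w3 = 0"
    by (rule no_eigenvector3D[OF ev(1)[unfolded B]])
  then show False using w by blast
qed

lemma iterates_GL3:
  fixes B :: "'a :: field mat"
  assumes ev: "no_eigenvector3 B" "no_eigenvector3 B\<^sup>T" and B: "B = mat3 a b c d e f g h i"
    and w: "\<not> (w1 = 0 \<and> w2 = 0 \<and> w3 = 0)"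
    and v: "v1 = a * w1 + b * w2 + c * w3" "v2 = d * w1 + e * w2 + f * w3" "v3 = g * w1 + h * w2 + i * w3"
    and z: "z1 = a * v1 + b * v2 + c * v3" "z2 = d * v1 + e * v2 + f * v3" "z3 = g * v1 + h * v2 + i * v3"
  shows "mat3 w1 v1 z1 w2 v2 z2 w3 v3 z3 \<in> carrier (GL 3)"
proof -
  let ?P = "mat3 w1 v1 z1 w2 v2 z2 w3 v3 z3" and ?T = "mat3 w1 w2 w3 v1 v2 v3 z1 z2 z3"
  have T: "?P\<^sup>T = ?T" by (rule eq_matI) (auto simp: less_small)
  have "det ?T \<noteq> 0"
  proof
    assume "det ?T = 0"
    then obtain u where u: "u \<in> carrier_vec 3" "u \<noteq> 0\<^sub>v 3" "?T *\<^sub>v u = 0\<^sub>v 3"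
      using det_0_iff_vec_prod_zero_field[OF mat3_carrier] by blast
    have "(?T *\<^sub>v u) $ 0 = 0" "(?T *\<^sub>v u) $ 1 = 0" "(?T *\<^sub>v u) $ 2 = 0" using u(3) by simp_all
    then have "u $ 0 * w1 + u $ 1 * w2 + u $ 2 * w3 = 0" "u $ 0 * v1 + u $ 1 * v2 + u $ 2 * v3 = 0"
      "u $ 0 * z1 + u $ 1 * z2 + u $ 2 * z3 = 0"
      using u(1) by (simp_all add: scalar_prod_def atLeast0LessThan lessThan_small ac_simps)
    from iterates_not_in_plane[OF ev B w v z this]
    have "u = 0\<^sub>v 3" using u(1) by (intro eq_vecI) (auto simp: less_small)
    then show False using u(2) by blast
  qed
  then have "det ?P \<noteq> 0" using det_transpose[OF mat3_carrier, of w1 v1 z1 w2 v2 z2 w3 v3 z3] T by simp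
  then have "?P \<in> Units (ring_mat TYPE('a) 3 ())" by (intro det_non_zero_imp_unit) simp
  then show ?thesis by (simp add: GL_def units_of_def)
qed

definition companion3 :: "'a \<Rightarrow> 'a \<Rightarrow> 'a \<Rightarrow> 'a :: {zero, one} mat" where
  "companion3 c0 c1 t = mat3 0 0 c0 1 0 c1 0 1 t"

lemma companion3_carrier [simp]: "companion3 c0 c1 t \<in> carrier_mat 3 3"
  by (simp add: companion3_def)

text \<open>The conjugating matrix has the columns \<open>w\<close>, \<open>B w\<close>, \<open>B\<^sup>2 w\<close>, where \<open>w\<close> is the first basis
  vector.\<close>

lemma irreducible_conj_companion3:
  fixes B :: "'a :: field mat"
  assumes B: "B \<in> carrier_mat 3 3" and irr: "Factorial_Ring.irreducible (char_poly B)"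
  obtains P c0 c1 t where "P \<in> carrier (GL 3)" "B * P = P * companion3 c0 c1 t"
    "no_eigenvector3 (companion3 c0 c1 t)" "no_eigenvector3 (companion3 c0 c1 t)\<^sup>T"
proof -
  obtain a b c d e f g h i where B3: "B = mat3 a b c d e f g h i" using B by (rule mat3_cases)
  have evs: "no_eigenvector3 C" "no_eigenvector3 C\<^sup>T" if "C \<in> carrier_mat 3 3" "char_poly C = char_poly B" for C
  proof -
    show "no_eigenvector3 C" using that irr by (intro no_eigenvector3) auto
    show "no_eigenvector3 C\<^sup>T"
      using that irr char_poly_transpose_mat[OF that(1)] by (intro no_eigenvector3) auto
  qed
  define z1 where "z1 = a * a + b * d + c * g"
  define z2 where "z2 = d * a + e * d + f * g"
  define z3 where "z3 = g * a + h * d + i * g"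
  define P where "P = mat3 1 a z1 0 d z2 0 g z3"
  have P: "P \<in> carrier (GL 3)"
    unfolding P_def using iterates_GL3[OF evs[OF B refl] B3, of 1 0 0 a d g z1 z2 z3]
    by (simp add: z1_def z2_def z3_def)
  obtain E where E: "E \<in> carrier (GL 3)" "P \<in> carrier_mat 3 3" "E \<in> carrier_mat 3 3"
    "P * E = 1\<^sub>m 3" "E * P = 1\<^sub>m 3" using P by (rule GL_cases)
  obtain e1 e2 e3 e4 e5 e6 e7 e8 e9 where E3: "E = mat3 e1 e2 e3 e4 e5 e6 e7 e8 e9"
    using E(3) by (rule mat3_cases)
  define X where "X = E * (B * P)"
  have X: "X \<in> carrier_mat 3 3" using E B by (simp add: X_def)
  have BP: "B * P = P * X" using GL_cancel[OF E(4,2,3), of "B * P" 3] E B by (simp add: X_def)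
  have "\<exists>x y z. X = companion3 x y z"
  proof -
    have "mat3 e1 (e1 * a + e2 * d + e3 * g) (e1 * z1 + e2 * z2 + e3 * z3)
        e4 (e4 * a + e5 * d + e6 * g) (e4 * z1 + e5 * z2 + e6 * z3)
        e7 (e7 * a + e8 * d + e9 * g) (e7 * z1 + e8 * z2 + e9 * z3) = mat3 1 0 0 0 1 0 0 0 1"
      using E(5) unfolding E3 P_def mat3_mult mat3_one by (simp del: mat3_eq_iff)
    then have q: "e1 * a + e2 * d + e3 * g = 0" "e1 * z1 + e2 * z2 + e3 * z3 = 0"
      "e4 * a + e5 * d + e6 * g = 1" "e4 * z1 + e5 * z2 + e6 * z3 = 0"
      "e7 * a + e8 * d + e9 * g = 0" "e7 * z1 + e8 * z2 + e9 * z3 = 1"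
      unfolding mat3_eq_iff by blast+
    have "B * P = mat3 a z1 (a * z1 + b * z2 + c * z3) d z2 (d * z1 + e * z2 + f * z3)
        g z3 (g * z1 + h * z2 + i * z3)"
      unfolding B3 P_def mat3_mult by (simp add: z1_def z2_def z3_def)
    then show ?thesis
      unfolding X_def E3 companion3_def by (simp only: mat3_mult q) blast
  qed
  then obtain x y z where Xc: "X = companion3 x y z" by blast
  have "similar_mat X B"
  proof (rule similar_matI)
    show "{X, B, E, P} \<subseteq> carrier_mat 3 3" using X B E by simp
    show "X = E * B * P" unfolding X_def using E B by (simp add: assoc3)
  qed (use E in auto)
  then have "char_poly X = char_poly B" by (rule char_poly_similar)
  then show thesis using that[of P x y z] P BP evs[OF X] Xc by simp
qed

text \<open>Multiplication by \<open>w\<^sub>1 + w\<^sub>2 C + w\<^sub>3 C\<^sup>2\<close>, with \<open>C\<close> the companion matrix, is the element of the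
  centralizer that sends the first basis vector to \<open>w\<close>.\<close>

lemma companion3_commutant:
  fixes c0 c1 t :: "'a :: field"
  assumes ev: "no_eigenvector3 (companion3 c0 c1 t)" "no_eigenvector3 (companion3 c0 c1 t)\<^sup>T"
    and H: "H \<in> carrier (GL 3)" and X: "companion3 c0 c1 t * H = H * X" "X \<in> carrier_mat 3 3"
    and X1: "X $$ (1, 0) = 1" "X $$ (2, 0) = 0"
  obtains Z x y b m where "Z \<in> carrier (GL 3)" "Z * companion3 c0 c1 t = companion3 c0 c1 t * Z"
    "H = Z * mat3 1 x y 0 1 b 0 0 m" "m \<noteq> 0"
proof -
  let ?C = "companion3 c0 c1 t"
  obtain G where G: "G \<in> carrier (GL 3)" "H \<in> carrier_mat 3 3" "G \<in> carrier_mat 3 3"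
    "H * G = 1\<^sub>m 3" "G * H = 1\<^sub>m 3" using H by (rule GL_cases)
  obtain h1 h2 h3 h4 h5 h6 h7 h8 h9 where H3: "H = mat3 h1 h2 h3 h4 h5 h6 h7 h8 h9"
    using G(2) by (rule mat3_cases)
  obtain g1 g2 g3 g4 g5 g6 g7 g8 g9 where G3: "G = mat3 g1 g2 g3 g4 g5 g6 g7 g8 g9"
    using G(3) by (rule mat3_cases)
  have nz: "\<not> (h1 = 0 \<and> h4 = 0 \<and> h7 = 0)"
    using G(5) unfolding G3 H3 mat3_mult mat3_one by auto
  define v1 where "v1 = c0 * h7"
  define v2 where "v2 = h1 + c1 * h7"
  define v3 where "v3 = h4 + t * h7"
  define z1 where "z1 = c0 * v3"
  define z2 where "z2 = v1 + c1 * v3"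
  define z3 where "z3 = v2 + t * v3"
  define Z where "Z = mat3 h1 v1 z1 h4 v2 z2 h7 v3 z3"
  have Z: "Z \<in> carrier (GL 3)"
    unfolding Z_def using iterates_GL3[OF ev companion3_def nz, of v1 v2 v3 z1 z2 z3]
    by (simp add: v1_def v2_def v3_def z1_def z2_def z3_def)
  have comm: "Z * ?C = ?C * Z"
    unfolding Z_def companion3_def
    by (simp add: mat3_mult v1_def v2_def v3_def z1_def z2_def z3_def algebra_simps)
  obtain Y where Y: "Y \<in> carrier (GL 3)" "Z \<in> carrier_mat 3 3" "Y \<in> carrier_mat 3 3"
    "Z * Y = 1\<^sub>m 3" "Y * Z = 1\<^sub>m 3" using Z by (rule GL_cases)
  define K where "K = Y * H"
  have K: "K \<in> carrier_mat 3 3" using Y G by (simp add: K_def)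
  have HK: "H = Z * K" using GL_cancel[OF Y(4,2,3) G(2)] by (simp add: K_def)
  have KG: "K \<in> carrier (GL 3)" unfolding K_def using Y(1) H by (rule GL_mult)
  have CK: "?C * K = K * X"
  proof -
    have "Z * (?C * K) = ?C * Z * K"
      using K Y comm by (simp add: assoc3[symmetric])
    also have "\<dots> = ?C * H" using K Y by (simp add: HK assoc3)
    also have "\<dots> = Z * (K * X)"
      using K Y X by (simp add: HK assoc3)
    finally have "Y * (Z * (?C * K)) = Y * (Z * (K * X))" by simp
    moreover have "?C * K \<in> carrier_mat 3 3" "K * X \<in> carrier_mat 3 3"
      using mult_carrier_mat[OF companion3_carrier K] mult_carrier_mat[OF K X(2)] by auto
    ultimately show ?thesis
      using GL_cancel[OF Y(5,3,2), of "?C * K" 3] GL_cancel[OF Y(5,3,2), of "K * X" 3] by simp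
  qed
  obtain y1 y2 y3 y4 y5 y6 y7 y8 y9 where Y3: "Y = mat3 y1 y2 y3 y4 y5 y6 y7 y8 y9"
    using Y(3) by (rule mat3_cases)
  have YZ: "y1 * h1 + y2 * h4 + y3 * h7 = 1" "y4 * h1 + y5 * h4 + y6 * h7 = 0"
    "y7 * h1 + y8 * h4 + y9 * h7 = 0"
    using Y(5) unfolding Y3 Z_def mat3_mult mat3_one by auto
  obtain k2 k3 k5 k6 k8 k9 where K3: "K = mat3 1 k2 k3 0 k5 k6 0 k8 k9"
    using that unfolding K_def Y3 H3 mat3_mult YZ by blast
  obtain x1 x2 x3 x4 x5 x6 x7 x8 x9 where X3: "X = mat3 x1 x2 x3 x4 x5 x6 x7 x8 x9"
    using X(2) by (rule mat3_cases)
  have x: "x4 = 1" "x7 = 0" using X1 by (simp_all add: X3)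
  have "x1 + k2 = 0" "k5 = 1" "k8 = 0"
    using CK unfolding K3 X3 companion3_def mat3_mult x by auto
  then have K4: "K = mat3 1 k2 k3 0 1 k6 0 0 k9" using K3 by simp
  have "k9 \<noteq> 0"
  proof
    assume "k9 = 0"
    obtain L where L: "L \<in> carrier_mat 3 3" "K * L = 1\<^sub>m 3" using KG by (rule GL_cases)
    obtain l1 l2 l3 l4 l5 l6 l7 l8 l9 where L3: "L = mat3 l1 l2 l3 l4 l5 l6 l7 l8 l9"
      using L(1) by (rule mat3_cases)
    show False using L(2) unfolding K4 L3 mat3_mult mat3_one \<open>k9 = 0\<close> by simp
  qed
  then show thesis using that[OF Z comm] HK K4 by blast
qed

text \<open>The first basis vector is cyclic for a companion matrix, so a commuting matrix that has it as an
  eigenvector is scalar.\<close>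

lemma companion3_commutant_triangular:
  fixes c0 c1 t :: "'a :: field"
  assumes "mat3 a x y 0 a' b 0 0 m * companion3 c0 c1 t = companion3 c0 c1 t * mat3 a x y 0 a' b 0 0 m"
  shows "x = 0" "y = 0" "a' = a" "b = 0" "m = a"
  using assms unfolding companion3_def mat3_mult mat3_eq_iff by auto

section \<open>The functional attached to a strongly cuspidal representation\<close>

context length_two_ring_character
begin

text \<open>Conjugation by \<open>g\<close> replaces \<open>B\<close> by its conjugate, and a matrix is determined by its character.\<close>

lemma phi_stabilizer_eq:
  assumes B: "B \<in> carrier_mat n n"
  shows "phi_stabilizer \<omega> red \<psi> n B = {g \<in> carrier (GL n). redm g * B = B * redm g}"
proof -
  have "(\<forall>k \<in> congruence_subgroup \<omega> n.
      phi \<omega> red \<psi> n B (inv\<^bsub>GL n\<^esub> g * k * g) = phi \<omega> red \<psi> n B k) \<longleftrightarrow> redm g * B = B * redm g"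
    (is "?L \<longleftrightarrow> _") if g: "g \<in> carrier (GL n)" for g
  proof -
    define h where "h = inv\<^bsub>GL n\<^esub> g"
    have h: "g \<in> carrier_mat n n" "h \<in> carrier_mat n n" "g * h = 1\<^sub>m n" "h * g = 1\<^sub>m n"
      using GL_inv[OF g] g by (auto simp: h_def GL_mat)
    have r: "redm g \<in> carrier_mat n n" "redm h \<in> carrier_mat n n"
      "redm g * redm h = 1\<^sub>m n" "redm h * redm g = 1\<^sub>m n"
      using h redm_mult[of g n n h n] redm_mult[of h n n g n] by auto
    define B' where "B' = redm g * B * redm h"
    have B': "B' \<in> carrier_mat n n" using r B by (simp add: B'_def)
    have eq: "redm g * B = B' * redm g"
      unfolding B'_def using GL_cancel'[OF r(4,2,1), of "redm g * B" n] r B by simp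
    have "phi \<omega> red \<psi> n B (h * congr M * g) = e (mat_trace (B' * M))" if "M \<in> carrier_mat n n" for M
      unfolding congr_conj[OF h(2,1) that h(4)]
      using mat_trace_conj[OF r(1,2) B B' that r(3) eq] that r B by (simp add: phi_congr)
    then have "?L \<longleftrightarrow> (\<forall>M \<in> carrier_mat n n. e (mat_trace (B' * M)) = e (mat_trace (B * M)))"
      by (simp add: congruence_subgroup_eq h_def[symmetric] phi_congr B)
    also have "\<dots> \<longleftrightarrow> B' = B" using trace_character_inj[OF B' B] by blast
    also have "\<dots> \<longleftrightarrow> redm g * B = B * redm g"
    proof
      assume "redm g * B = B * redm g"
      then have "B' = B * redm g * redm h" by (simp add: B'_def)
      then show "B' = B" using GL_cancel'[OF r(3,1,2) B] by simp
    qed (use eq in simp)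
    finally show ?thesis .
  qed
  then show ?thesis unfolding phi_stabilizer_def by blast
qed

definition centralizer3 :: "'k mat \<Rightarrow> 'r mat set" where
  "centralizer3 C = {h \<in> carrier (GL 3). redm h * C = C * redm h}"

end

text \<open>A strongly cuspidal representation, seen through Frobenius reciprocity: the functional
  \<open>lam\<close>, evaluation of functions at a point, transforms under the centralizer by the character
  \<open>\<phi>\<close>, and matrix coefficients against \<open>lam\<close> identify the representation with the space of all
  functions on \<open>GL 3\<close> that transform in this way. The evaluation point is chosen so that the matrix
  becomes a companion matrix.\<close>

locale cuspidal_functional = length_two_ring_character \<omega> red \<psi> +
    \<rho>: fin_dim_representation "GL 3 :: 'r mat monoid" \<rho>
  for \<omega> :: "'r :: comm_ring_1" and red :: "'r \<Rightarrow> 'k :: {field, finite}" and \<psi>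
    and \<rho> :: "('r mat, 'v :: ab_group_add) rep" +
  fixes c0 c1 t :: 'k and \<phi> :: "'r mat \<Rightarrow> complex" and lam :: "'v \<Rightarrow> complex"
  assumes no_eigenvector: "no_eigenvector3 (companion3 c0 c1 t)" "no_eigenvector3 (companion3 c0 c1 t)\<^sup>T"
    and phi_mult: "\<And>h h'. h \<in> centralizer3 (companion3 c0 c1 t) \<Longrightarrow>
      h' \<in> centralizer3 (companion3 c0 c1 t) \<Longrightarrow> \<phi> (h * h') = \<phi> h * \<phi> h'"
    and phi_nz: "\<And>h. h \<in> centralizer3 (companion3 c0 c1 t) \<Longrightarrow> \<phi> h \<noteq> 0"
    and phi_congr3: "\<And>M. M \<in> carrier_mat 3 3 \<Longrightarrow>
      \<phi> (congr M) = e (mat_trace (companion3 c0 c1 t * M))"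
    and lam_linear: "linear_functional \<rho> lam"
    and lam_act: "\<And>h v. h \<in> centralizer3 (companion3 c0 c1 t) \<Longrightarrow> v \<in> rep_space \<rho> \<Longrightarrow>
      lam (rep_act \<rho> h v) = \<phi> h * lam v"
    and lam_separates: "\<And>v. v \<in> rep_space \<rho> \<Longrightarrow>
      (\<And>h. h \<in> carrier (GL 3) \<Longrightarrow> lam (rep_act \<rho> h v) = 0) \<Longrightarrow> v = 0"
    and lam_surj: "\<And>\<Phi>. (\<And>i h. i \<in> centralizer3 (companion3 c0 c1 t) \<Longrightarrow> h \<in> carrier (GL 3) \<Longrightarrow>
        \<Phi> (i * h) = \<phi> i * \<Phi> h) \<Longrightarrow>
      \<exists>v \<in> rep_space \<rho>. \<forall>h \<in> carrier (GL 3). lam (rep_act \<rho> h v) = \<Phi> h"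

context length_two_ring_character
begin

lemma strongly_cuspidal_functional:
  fixes \<rho> :: "('r mat, 'v :: ab_group_add) rep"
  assumes "strongly_cuspidal \<omega> red \<psi> 3 \<rho>"
  obtains c0 c1 t \<phi> lam where "cuspidal_functional \<omega> red \<psi> \<rho> c0 c1 t \<phi> lam"
proof -
  obtain B \<phi>0 E where fd: "finite_dim_rep (GL 3) \<rho>" and B: "B \<in> carrier_mat 3 3"
    and irr: "Factorial_Ring.irreducible (char_poly B)"
    and char: "character ((GL 3)\<lparr>carrier := phi_stabilizer \<omega> red \<psi> 3 B\<rparr>) \<phi>0"
    and \<phi>0: "\<forall>k \<in> congruence_subgroup \<omega> 3. \<phi>0 k = phi \<omega> red \<psi> 3 B k"
    and E: "intertwiner (GL 3) \<rho> (induced_rep (GL 3) (phi_stabilizer \<omega> red \<psi> 3 B) (character_rep \<phi>0)) E"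
    and bij: "bij_betw E (rep_space \<rho>)
        (rep_space (induced_rep (GL 3) (phi_stabilizer \<omega> red \<psi> 3 B) (character_rep \<phi>0)))"
    using assms unfolding strongly_cuspidal_def equivalent_reps_def by blast
  interpret \<rho>: fin_dim_representation "GL 3 :: 'r mat monoid" \<rho>
    by (rule fin_dim_representation.intro) (simp_all add: fd group_GL)
  define I where "I = phi_stabilizer \<omega> red \<psi> 3 B"
  have I: "g \<in> I \<longleftrightarrow> g \<in> carrier (GL 3) \<and> redm g * B = B * redm g" for g
    by (simp add: I_def phi_stabilizer_eq[OF B])
  have \<phi>0_nz: "\<phi>0 g \<noteq> 0" and \<phi>0_mult: "h \<in> I \<Longrightarrow> \<phi>0 (g * h) = \<phi>0 g * \<phi>0 h" if "g \<in> I" for g h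
    using char that by (auto simp: character_def I_def)
  obtain P c0 c1 t where P: "P \<in> carrier (GL 3)" and BP: "B * P = P * companion3 c0 c1 t"
    and ev: "no_eigenvector3 (companion3 c0 c1 t)" "no_eigenvector3 (companion3 c0 c1 t)\<^sup>T"
    using irreducible_conj_companion3[OF B irr] .
  define C where "C = companion3 c0 c1 t"
  have C: "C \<in> carrier_mat 3 3" by (simp add: C_def)
  \<comment> \<open>Evaluation at \<open>1\<close> would give a functional for the centralizer of \<open>B\<close>; evaluating at \<open>p\<close>
    conjugates it to the centralizer of the companion matrix.\<close>
  define p where "p = liftm P"
  have rp: "redm p = P" by (simp add: p_def)
  have pG: "p \<in> carrier (GL 3)" using P by (intro GL_redmD) (simp add: rp)
  obtain q where qG: "q \<in> carrier (GL 3)" and pq: "p \<in> carrier_mat 3 3" "q \<in> carrier_mat 3 3"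
    "p * q = 1\<^sub>m 3" "q * p = 1\<^sub>m 3" using pG by (rule GL_cases)
  have r: "P \<in> carrier_mat 3 3" "redm q \<in> carrier_mat 3 3" "P * redm q = 1\<^sub>m 3" "redm q * P = 1\<^sub>m 3"
    using pq redm_mult[OF pq(1,2)] redm_mult[OF pq(2,1)] by (auto simp: rp[symmetric])
  have qB: "redm q * B = C * redm q"
  proof -
    have "redm q * B = redm q * (B * P) * redm q"
      using GL_cancel'[OF r(3,1,2), of "redm q * B" 3] r B by (simp add: assoc3)
    also have "\<dots> = C * redm q"
      unfolding BP using GL_cancel[OF r(4,2,1) C] by (simp add: C_def)
    finally show ?thesis .
  qed
  have into: "p * h * q \<in> I" if h: "h \<in> centralizer3 C" for h
  proof -
    have hG: "h \<in> carrier (GL 3)" and hc: "redm h * C = C * redm h" using h by (auto simp: centralizer3_def)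
    have hm: "h \<in> carrier_mat 3 3" "redm h \<in> carrier_mat 3 3" using hG by (auto simp: GL_mat)
    have rr: "redm (p * h * q) = P * redm h * redm q"
      using pq r hm by (simp add: redm_mult[of _ 3 3 _ 3] rp assoc3)
    have "P * redm h * redm q * B = P * (redm h * (redm q * B))"
      using r hm B by (simp add: assoc3)
    also have "\<dots> = P * (redm h * C * redm q)"
      unfolding qB using r hm C by (simp add: assoc3)
    also have "\<dots> = P * C * redm h * redm q"
      unfolding hc using r hm C by (simp add: assoc3)
    also have "\<dots> = B * (P * redm h * redm q)"
      unfolding C_def BP[symmetric] using r hm B by (simp add: assoc3)
    finally show ?thesis using GL_mult[OF GL_mult[OF pG hG] qG] by (simp add: I rr)
  qed
  have conj_back: "q * i * p \<in> centralizer3 C" if i: "i \<in> I" for i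
  proof -
    have iG: "i \<in> carrier (GL 3)" and ic: "redm i * B = B * redm i" using i by (auto simp: I)
    have im: "i \<in> carrier_mat 3 3" "redm i \<in> carrier_mat 3 3" using iG by (auto simp: GL_mat)
    have rr: "redm (q * i * p) = redm q * redm i * P"
      using pq r im by (simp add: redm_mult[of _ 3 3 _ 3] rp assoc3)
    have "redm q * redm i * P * C = redm q * (redm i * (P * C))"
      using r im C by (simp add: assoc3)
    also have "\<dots> = redm q * (redm i * B * P)"
      unfolding C_def BP[symmetric] using r im B by (simp add: assoc3)
    also have "\<dots> = redm q * B * redm i * P"
      unfolding ic using r im B by (simp add: assoc3)
    also have "\<dots> = C * (redm q * redm i * P)"
      unfolding qB using r im C by (simp add: assoc3)
    finally show ?thesis using GL_mult[OF GL_mult[OF qG iG] pG] by (simp add: centralizer3_def rr)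
  qed
  define \<phi> where "\<phi> h = \<phi>0 (p * h * q)" for h
  define lam where "lam v = E v p" for v
  have E_space: "E v \<in> rep_space (induced_rep (GL 3) I (character_rep \<phi>0))" if "v \<in> rep_space \<rho>" for v
    using bij that by (auto simp: bij_betw_def I_def)
  have E_left: "E v (i * g) = \<phi>0 i * E v g" if "v \<in> rep_space \<rho>" "i \<in> I" "g \<in> carrier (GL 3)" for v i g
    using E_space[OF that(1)] that by (simp add: induced_rep_def character_rep_def)
  have E_out: "E v g = 0" if "v \<in> rep_space \<rho>" "g \<notin> carrier (GL 3)" for v g
    using E_space[OF that(1)] that by (simp add: induced_rep_def)
  have E_act: "E (rep_act \<rho> h v) g = E v (g * h)"
    if "v \<in> rep_space \<rho>" "h \<in> carrier (GL 3)" "g \<in> carrier (GL 3)" for v h g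
    using E that by (simp add: intertwiner_def induced_rep_def)
  have E_add: "E (v + w) = E v + E w" if "v \<in> rep_space \<rho>" "w \<in> rep_space \<rho>" for v w
    using E that by (simp add: intertwiner_def)
  have E_scale: "E (rep_scale \<rho> c v) g = c * E v g" if "v \<in> rep_space \<rho>" for c v g
    using E that by (simp add: intertwiner_def induced_rep_def character_rep_def)
  have E_0: "E 0 = 0" using E_add[of 0 0] by simp
  have coeff: "lam (rep_act \<rho> h v) = E v (p * h)" if "v \<in> rep_space \<rho>" "h \<in> carrier (GL 3)" for v h
    using E_act[OF that pG] by (simp add: lam_def)
  have "cuspidal_functional \<omega> red \<psi> \<rho> c0 c1 t \<phi> lam"
  proof (unfold_locales, fold C_def)
    show "no_eigenvector3 C" "no_eigenvector3 C\<^sup>T" using ev by (simp_all add: C_def)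
    fix h assume h: "h \<in> centralizer3 C"
    then have hG: "h \<in> carrier (GL 3)" by (simp add: centralizer3_def)
    show "\<phi> h \<noteq> 0" unfolding \<phi>_def by (rule \<phi>0_nz[OF into[OF h]])
    show "lam (rep_act \<rho> h v) = \<phi> h * lam v" if v: "v \<in> rep_space \<rho>" for v
    proof -
      have "p * h = p * h * q * p"
        using GL_cancel'[OF pq(4,2,1), of "p * h" 3] pq GL_mat[OF hG] by simp
      then have "lam (rep_act \<rho> h v) = E v (p * h * q * p)" using coeff[OF v hG] by simp
      then show ?thesis using E_left[OF v into[OF h] pG] by (simp add: \<phi>_def lam_def)
    qed
    fix h' assume h': "h' \<in> centralizer3 C"
    then have "h' \<in> carrier_mat 3 3" "h \<in> carrier_mat 3 3" using hG by (auto simp: centralizer3_def GL_mat)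
    then have "p * (h * h') * q = (p * h * q) * (p * h' * q)"
      using pq GL_cancel[OF pq(4,2,1), of "h' * q" 3] by (simp add: assoc3)
    then show "\<phi> (h * h') = \<phi> h * \<phi> h'"
      using \<phi>0_mult[OF into[OF h] into[OF h']] by (simp add: \<phi>_def)
  next
    fix M :: "'k mat" assume M: "M \<in> carrier_mat 3 3"
    have "congr (P * M * redm q) \<in> congruence_subgroup \<omega> 3"
      using M r by (auto simp: congruence_subgroup_eq)
    then show "\<phi> (congr M) = e (mat_trace (C * M))"
      using \<phi>0 M r B mat_trace_conj[OF r(2,1) B C M r(4) qB]
      by (simp add: \<phi>_def congr_conj[OF pq(1,2) M pq(3)] rp phi_congr)
  next
    show "linear_functional \<rho> lam"
      by (simp add: linear_functional_def lam_def E_add E_scale)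
  next
    fix v assume v: "v \<in> rep_space \<rho>" and 0: "\<And>h. h \<in> carrier (GL 3) \<Longrightarrow> lam (rep_act \<rho> h v) = 0"
    have "E v g = 0" for g
    proof (cases "g \<in> carrier (GL 3)")
      case True
      have "E v (p * (q * g)) = 0" using 0[OF GL_mult[OF qG True]] coeff[OF v GL_mult[OF qG True]] by simp
      then show ?thesis using GL_cancel[OF pq(3,1,2) GL_mat[OF True]] by simp
    qed (rule E_out[OF v])
    then have "E v = E 0" by (simp add: E_0 fun_eq_iff)
    then show "v = 0" using bij v by (auto simp: bij_betw_def inj_on_def)
  next
    fix \<Phi> assume \<Phi>: "\<And>i h. i \<in> centralizer3 C \<Longrightarrow> h \<in> carrier (GL 3) \<Longrightarrow> \<Phi> (i * h) = \<phi> i * \<Phi> h"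
    define F where "F g = (if g \<in> carrier (GL 3) then \<Phi> (q * g) else 0)" for g
    have "F (i * g) = \<phi>0 i * F g" if i: "i \<in> I" and g: "g \<in> carrier (GL 3)" for i g
    proof -
      have iG: "i \<in> carrier (GL 3)" using i by (simp add: I)
      have m: "i \<in> carrier_mat 3 3" "g \<in> carrier_mat 3 3" using iG g by (auto simp: GL_mat)
      have "q * (i * g) = (q * i * p) * (q * g)"
        using pq m GL_cancel[OF pq(3,1,2) m(2)] by (simp add: assoc3)
      moreover have "\<phi> (q * i * p) = \<phi>0 i"
      proof -
        have "p * (q * i * p) * q = p * (q * (i * (p * q)))"
          using pq(1,2) m by (simp add: assoc3)
        then show ?thesis
          using pq m GL_cancel[OF pq(3,1,2) m(1)] by (simp add: \<phi>_def)
      qed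
      ultimately show ?thesis
        using \<Phi>[OF conj_back[OF i] GL_mult[OF qG g]] GL_mult[OF iG g] g by (simp add: F_def)
    qed
    then have "F \<in> rep_space (induced_rep (GL 3) I (character_rep \<phi>0))"
      by (simp add: induced_rep_def character_rep_def F_def)
    then obtain v where v: "v \<in> rep_space \<rho>" "E v = F"
      using bij unfolding bij_betw_def I_def[symmetric] by (metis imageE)
    have "lam (rep_act \<rho> h v) = \<Phi> h" if h: "h \<in> carrier (GL 3)" for h
      using coeff[OF v(1) h] GL_mult[OF pG h] GL_cancel[OF pq(4,2,1) GL_mat[OF h]]
      by (simp add: v(2) F_def)
    then show "\<exists>v \<in> rep_space \<rho>. \<forall>h \<in> carrier (GL 3). lam (rep_act \<rho> h v) = \<Phi> h" using v(1) by blast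
  qed
  then show thesis by (rule that)
qed

end

section \<open>Block matrices of size four\<close>

definition block31 :: "'a :: comm_ring_1 mat \<Rightarrow> 'a mat \<Rightarrow> 'a \<Rightarrow> 'a mat" where
  "block31 h Y m = four_block_mat h Y (0\<^sub>m 1 3) (mat 1 1 (\<lambda>_. m))"

definition diag22 :: "'a :: comm_ring_1 mat \<Rightarrow> 'a mat" where
  "diag22 d = four_block_mat d (0\<^sub>m 2 2) (0\<^sub>m 2 2) d"

definition unip22 :: "'a :: comm_ring_1 mat \<Rightarrow> 'a mat" where
  "unip22 X = four_block_mat (1\<^sub>m 2) X (0\<^sub>m 2 2) (1\<^sub>m 2)"

text \<open>The permutation matrix with rows \<open>e\<^sub>1, e\<^sub>3, e\<^sub>4, e\<^sub>2\<close>.\<close>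

definition perm4 :: "'a :: comm_ring_1 mat" where
  "perm4 = mat 4 4 (\<lambda>(i, j). if j = [0, 2, 3, 1] ! i then 1 else 0)"

lemma block31_carrier [simp]: "h \<in> carrier_mat 3 3 \<Longrightarrow> block31 h Y m \<in> carrier_mat 4 4"
  by (rule carrier_matI) (auto simp: block31_def)

lemma diag22_carrier [simp]: "d \<in> carrier_mat 2 2 \<Longrightarrow> diag22 d \<in> carrier_mat 4 4"
  by (rule carrier_matI) (auto simp: diag22_def)

lemma unip22_carrier [simp]: "unip22 X \<in> carrier_mat 4 4"
  by (rule carrier_matI) (auto simp: unip22_def)

lemma perm4_carrier [simp]: "perm4 \<in> carrier_mat 4 4"
  by (simp add: perm4_def)

lemma block31_index:
  assumes "h \<in> carrier_mat 3 3" "i < 4" "j < 4"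
  shows "block31 h Y m $$ (i, j) =
    (if i < 3 then if j < 3 then h $$ (i, j) else Y $$ (i, 0) else if j < 3 then 0 else m)"
  using assms by (auto simp: block31_def)

lemma block31_mult:
  assumes "h \<in> carrier_mat 3 3" "h' \<in> carrier_mat 3 3" "Y \<in> carrier_mat 3 1" "Y' \<in> carrier_mat 3 1"
  shows "block31 h Y m * block31 h' Y' m' = block31 (h * h') (h * Y' + m' \<cdot>\<^sub>m Y) (m * m')"
proof -
  have "block31 h Y m * block31 h' Y' m' =
      four_block_mat (h * h' + Y * 0\<^sub>m 1 3) (h * Y' + Y * mat 1 1 (\<lambda>_. m'))
        (0\<^sub>m 1 3 * h' + mat 1 1 (\<lambda>_. m) * 0\<^sub>m 1 3) (0\<^sub>m 1 3 * Y' + mat 1 1 (\<lambda>_. m) * mat 1 1 (\<lambda>_. m'))"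
    unfolding block31_def using assms by (intro mult_four_block_mat[of _ 3 3 _ 1 _ 1]) auto
  also have "Y * mat 1 1 (\<lambda>_. m') = m' \<cdot>\<^sub>m Y"
    using assms by (intro eq_matI) (auto simp: scalar_prod_def mult.commute)
  also have "h * h' + Y * 0\<^sub>m 1 3 = h * h'" using assms by (simp add: right_mult_zero_mat[of _ 3 1])
  also have "0\<^sub>m 1 3 * h' + mat 1 1 (\<lambda>_. m) * 0\<^sub>m 1 3 = 0\<^sub>m 1 3"
    using assms by (intro eq_matI) (auto simp: scalar_prod_def)
  also have "0\<^sub>m 1 3 * Y' + mat 1 1 (\<lambda>_. m) * mat 1 1 (\<lambda>_. m') = mat 1 1 (\<lambda>_. m * m')"
    using assms by (intro eq_matI) (auto simp: scalar_prod_def)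
  finally show ?thesis by (simp add: block31_def)
qed

lemma diag22_unip22:
  assumes "d \<in> carrier_mat 2 2" "X \<in> carrier_mat 2 2"
  shows "diag22 d * unip22 X = four_block_mat d (d * X) (0\<^sub>m 2 2) d"
  unfolding diag22_def unip22_def using assms
  by (subst mult_four_block_mat[of _ 2 2 _ 2 _ 2]) auto

lemma unip22_diag22:
  assumes "d \<in> carrier_mat 2 2" "X \<in> carrier_mat 2 2"
  shows "unip22 X * diag22 d = four_block_mat d (X * d) (0\<^sub>m 2 2) d"
  unfolding diag22_def unip22_def using assms
  by (subst mult_four_block_mat[of _ 2 2 _ 2 _ 2]) auto

lemma diag22_mult:
  assumes "d \<in> carrier_mat 2 2" "d' \<in> carrier_mat 2 2"
  shows "diag22 d * diag22 d' = diag22 (d * d')"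
  unfolding diag22_def using assms
  by (subst mult_four_block_mat[of _ 2 2 _ 2 _ 2]) auto

lemma unip22_mult:
  assumes "X \<in> carrier_mat 2 2" "X' \<in> carrier_mat 2 2"
  shows "unip22 X * unip22 X' = unip22 (X + X')"
  unfolding unip22_def using assms comm_add_mat[OF assms]
  by (subst mult_four_block_mat[of _ 2 2 _ 2 _ 2]) auto

lemma unip22_0 [simp]: "unip22 (0\<^sub>m 2 2) = 1\<^sub>m 4"
  by (rule eq_matI) (auto simp: unip22_def)

lemma diag22_1 [simp]: "diag22 (1\<^sub>m 2) = 1\<^sub>m 4"
  by (rule eq_matI) (auto simp: diag22_def)

lemma block31_dim [simp]: "dim_row (block31 h Y m) = Suc (dim_row h)" "dim_col (block31 h Y m) = Suc (dim_col h)"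
  by (simp_all add: block31_def)

lemma block31_1: "block31 (1\<^sub>m 3) (0\<^sub>m 3 1) 1 = 1\<^sub>m 4"
  by (rule eq_matI) (auto simp: block31_index less_small)

lemma diag22_GL:
  assumes "d \<in> carrier (GL 2)"
  shows "diag22 d \<in> carrier (GL 4)"
proof -
  obtain d' where d': "d \<in> carrier_mat 2 2" "d' \<in> carrier_mat 2 2" "d * d' = 1\<^sub>m 2" "d' * d = 1\<^sub>m 2"
    using assms by (rule GL_cases)
  show ?thesis
    by (rule GL_I[of _ _ "diag22 d'"]) (simp_all add: d' diag22_mult)
qed

lemma unip22_GL:
  assumes "X \<in> carrier_mat 2 2"
  shows "unip22 X \<in> carrier (GL 4)"
proof (rule GL_I)
  have "- X + X = 0\<^sub>m 2 2" "X + - X = 0\<^sub>m 2 2"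
    using uminus_l_inv_mat[OF assms] comm_add_mat[OF assms, of "- X"] assms by auto
  then show "unip22 X * unip22 (- X) = 1\<^sub>m 4" "unip22 (- X) * unip22 X = 1\<^sub>m 4"
    using assms by (simp_all add: unip22_mult)
qed simp_all

lemma block31_GL:
  assumes "h \<in> carrier (GL 3)" "Y \<in> carrier_mat 3 1" "m dvd 1"
  obtains h' Y' m' where "h' \<in> carrier (GL 3)" "Y' \<in> carrier_mat 3 1" "m' dvd 1" "h' * h = 1\<^sub>m 3"
    "h * h' = 1\<^sub>m 3" "m' * m = 1" "block31 h Y m * block31 h' Y' m' = 1\<^sub>m 4"
    "block31 h' Y' m' * block31 h Y m = 1\<^sub>m 4" "block31 h Y m \<in> carrier (GL 4)"
proof -
  obtain h' where h: "h' \<in> carrier (GL 3)" "h \<in> carrier_mat 3 3" "h' \<in> carrier_mat 3 3"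
    "h * h' = 1\<^sub>m 3" "h' * h = 1\<^sub>m 3" using assms(1) by (rule GL_cases)
  obtain m' where m: "m * m' = 1" using assms(3) by (metis dvdE)
  define Y' where "Y' = - (m' \<cdot>\<^sub>m (h' * Y))"
  have Y': "Y' \<in> carrier_mat 3 1" using h assms by (simp add: Y'_def)
  have 1: "h' * Y + m \<cdot>\<^sub>m Y' = 0\<^sub>m 3 1"
    unfolding Y'_def using h assms m
    by (intro eq_matI) (auto simp: mult.assoc[symmetric])
  have "h * (h' * Y + m \<cdot>\<^sub>m Y') = h * (h' * Y) + h * (m \<cdot>\<^sub>m Y')"
    using h Y' assms by (intro mult_add_distrib_mat[of _ 3 3 _ 1]) auto
  also have "\<dots> = Y + m \<cdot>\<^sub>m (h * Y')"
    using GL_cancel[OF h(4,2,3) assms(2)] mult_smult_distrib[OF h(2) Y'] by simp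
  finally have "Y + m \<cdot>\<^sub>m (h * Y') = 0\<^sub>m 3 1" using 1 h by (simp add: right_mult_zero_mat[of _ 3 3])
  then have "m' \<cdot>\<^sub>m (Y + m \<cdot>\<^sub>m (h * Y')) = 0\<^sub>m 3 1" by (simp add: smult_zero_mat)
  moreover have "m' \<cdot>\<^sub>m (Y + m \<cdot>\<^sub>m (h * Y')) = h * Y' + m' \<cdot>\<^sub>m Y"
    using h Y' assms m
    by (intro eq_matI) (auto simp: algebra_simps mult.assoc[symmetric] mult.commute[of m' m])
  ultimately have 2: "h * Y' + m' \<cdot>\<^sub>m Y = 0\<^sub>m 3 1" by simp
  have i1: "block31 h Y m * block31 h' Y' m' = 1\<^sub>m 4"
    unfolding block31_mult[OF h(2,3) assms(2) Y'] h(4) 2 m block31_1 ..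
  have i2: "block31 h' Y' m' * block31 h Y m = 1\<^sub>m 4"
    unfolding block31_mult[OF h(3,2) Y' assms(2)] h(5) 1 mult.commute[of m' m] m block31_1 ..
  have "block31 h Y m \<in> carrier (GL 4)"
    using i1 i2 h by (intro GL_I[of _ _ "block31 h' Y' m'"]) auto
  moreover have "m' dvd 1" using m by (metis dvd_triv_right)
  ultimately show thesis using that[OF h(1) Y'] h m i1 i2 by (simp add: mult.commute)
qed

lemma block31_in_GL:
  "h \<in> carrier (GL 3) \<Longrightarrow> Y \<in> carrier_mat 3 1 \<Longrightarrow> m dvd 1 \<Longrightarrow> block31 h Y m \<in> carrier (GL 4)"
  by (rule block31_GL)

lemma perm4_mult_index:
  assumes "A \<in> carrier_mat 4 4" "i < 4" "j < 4"
  shows "(perm4 * A) $$ (i, j) = A $$ ([0, 2, 3, 1] ! i, j)"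
proof -
  have "(perm4 * A) $$ (i, j) = (\<Sum>l<4. perm4 $$ (i, l) * A $$ (l, j))"
    using assms by (intro index_mult_sum[of _ 4 4 _ 4]) auto
  then show ?thesis using assms(2,3) by (auto simp: perm4_def lessThan_small less_small)
qed

lemma mult_perm4_index:
  assumes "A \<in> carrier_mat 4 4" "i < 4" "j < 4"
  shows "(A * perm4) $$ (i, j) = A $$ (i, [0, 3, 1, 2] ! j)"
proof -
  have "(A * perm4) $$ (i, j) = (\<Sum>l<4. A $$ (i, l) * perm4 $$ (l, j))"
    using assms by (intro index_mult_sum[of _ 4 4 _ 4]) auto
  then show ?thesis using assms(2,3) by (auto simp: perm4_def lessThan_small less_small)
qed

lemma perm4_GL: "perm4 \<in> carrier (GL 4)"
proof (rule GL_I)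
  have T: "perm4\<^sup>T \<in> carrier_mat 4 4" by simp
  show "perm4 * perm4\<^sup>T = (1\<^sub>m 4 :: 'a mat)"
  proof (rule eq_matI)
    fix i j assume "i < dim_row (1\<^sub>m 4 :: 'a mat)" "j < dim_col (1\<^sub>m 4 :: 'a mat)"
    then have ij: "i < 4" "j < 4" by simp_all
    show "(perm4 * perm4\<^sup>T) $$ (i, j) = (1\<^sub>m 4 :: 'a mat) $$ (i, j)"
      unfolding perm4_mult_index[OF T ij] using ij by (auto simp: perm4_def less_small)
  qed (auto simp: perm4_def)
  show "perm4\<^sup>T * perm4 = (1\<^sub>m 4 :: 'a mat)"
  proof (rule eq_matI)
    fix i j assume "i < dim_row (1\<^sub>m 4 :: 'a mat)" "j < dim_col (1\<^sub>m 4 :: 'a mat)"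
    then have ij: "i < 4" "j < 4" by simp_all
    show "(perm4\<^sup>T * perm4) $$ (i, j) = (1\<^sub>m 4 :: 'a mat) $$ (i, j)"
      unfolding mult_perm4_index[OF T ij] using ij by (auto simp: perm4_def less_small)
  qed (auto simp: perm4_def)
qed simp_all

definition col3 :: "'a \<Rightarrow> 'a \<Rightarrow> 'a \<Rightarrow> 'a mat" where
  "col3 a b c = mat 3 1 (\<lambda>(i, j). [a, b, c] ! i)"

lemma col3_carrier [simp]: "col3 a b c \<in> carrier_mat 3 1"
  by (simp add: col3_def)

lemma col3_index [simp]:
  "col3 a b c $$ (0, 0) = a" "col3 a b c $$ (Suc 0, 0) = b" "col3 a b c $$ (2, 0) = c"
  by (simp_all add: col3_def)

text \<open>The intersection of the parabolic subgroup with the conjugate by \<open>perm4\<close> of the group of all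
  \<open>diag22 d * unip22 X\<close>.\<close>

lemma block31_perm4:
  "block31 (mat3 a (a * x) (a * y) 0 a b 0 0 m) (col3 b 0 0) m * perm4 =
     perm4 * (diag22 (mat2 a b 0 m) * unip22 (mat2 x y 0 0))"
proof (rule eq_matI)
  have c: "diag22 (mat2 a b 0 m) * unip22 (mat2 x y 0 0) \<in> carrier_mat 4 4"
    by (rule mult_carrier_mat[of _ 4 4]) simp_all
  fix i j assume "i < dim_row (perm4 * (diag22 (mat2 a b 0 m) * unip22 (mat2 x y 0 0)))"
    "j < dim_col (perm4 * (diag22 (mat2 a b 0 m) * unip22 (mat2 x y 0 0)))"
  then have ij: "i < 4" "j < 4" using c by (auto simp: perm4_def)
  have "(block31 (mat3 a (a * x) (a * y) 0 a b 0 0 m) (col3 b 0 0) m * perm4) $$ (i, j)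
      = block31 (mat3 a (a * x) (a * y) 0 a b 0 0 m) (col3 b 0 0) m $$ (i, [0, 3, 1, 2] ! j)"
    using ij by (intro mult_perm4_index) auto
  moreover have "(perm4 * (diag22 (mat2 a b 0 m) * unip22 (mat2 x y 0 0))) $$ (i, j)
      = (diag22 (mat2 a b 0 m) * unip22 (mat2 x y 0 0)) $$ ([0, 2, 3, 1] ! i, j)"
    using ij c by (intro perm4_mult_index) auto
  moreover have "block31 (mat3 a (a * x) (a * y) 0 a b 0 0 m) (col3 b 0 0) m $$ (i, [0, 3, 1, 2] ! j)
      = (diag22 (mat2 a b 0 m) * unip22 (mat2 x y 0 0)) $$ ([0, 2, 3, 1] ! i, j)"
    using ij unfolding less_small
    by (elim disjE) (simp_all add: diag22_unip22 mat2_mult block31_index)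
  ultimately show "(block31 (mat3 a (a * x) (a * y) 0 a b 0 0 m) (col3 b 0 0) m * perm4) $$ (i, j)
      = (perm4 * (diag22 (mat2 a b 0 m) * unip22 (mat2 x y 0 0))) $$ (i, j)" by simp
qed (auto simp: perm4_def block31_def diag22_def unip22_def)

lemma block31_perm4_converse:
  assumes i: "i \<in> carrier_mat 3 3" and m: "m dvd (1 :: 'a :: comm_ring_1)"
    and d: "d \<in> carrier_mat 2 2" and X: "X \<in> carrier_mat 2 2"
    and eq: "block31 i Y m * perm4 = perm4 * (diag22 d * unip22 X)"
  obtains a b x y where "i = mat3 a (a * x) (a * y) 0 a b 0 0 m" "d = mat2 a b 0 m" "X = mat2 x y 0 0"
proof -
  obtain i1 i2 i3 i4 i5 i6 i7 i8 i9 where i3: "i = mat3 i1 i2 i3 i4 i5 i6 i7 i8 i9"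
    using i by (rule mat3_cases)
  obtain a b c m' where d2: "d = mat2 a b c m'" using d by (rule mat2_cases)
  obtain x y z w where X2: "X = mat2 x y z w" using X by (rule mat2_cases)
  have c: "diag22 d * unip22 X \<in> carrier_mat 4 4"
    by (rule mult_carrier_mat[of _ 4 4]) (simp_all add: d)
  have entry: "block31 i Y m $$ (k, [0, 3, 1, 2] ! l) = (diag22 d * unip22 X) $$ ([0, 2, 3, 1] ! k, l)"
    if kl: "k < 4" "l < 4" for k l
    using perm4_mult_index[OF c kl] mult_perm4_index[OF block31_carrier[OF i, of Y m] kl] eq by simp
  have R: "diag22 d * unip22 X = four_block_mat (mat2 a b c m')
      (mat2 (a * x + b * z) (a * y + b * w) (c * x + m' * z) (c * y + m' * w)) (0\<^sub>m 2 2) (mat2 a b c m')"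
    unfolding diag22_unip22[OF d X] by (simp add: d2 X2 mat2_mult)
  have r3: "c = 0" "m' = m" "c * x + m' * z = 0" "c * y + m' * w = 0"
    using entry[of 3 0] entry[of 3 1] entry[of 3 2] entry[of 3 3]
    by (simp_all add: R block31_index[OF i])
  obtain n where n: "n * m = 1" using m by (metis dvdE mult.commute)
  have "z = n * m * z" "w = n * m * w" by (simp_all add: n)
  then have zw: "z = 0" "w = 0" using r3 by (simp_all add: mult.assoc)
  have "i1 = a" "i2 = a * x" "i3 = a * y"
    using entry[of 0 0] entry[of 0 2] entry[of 0 3]
    by (simp_all add: R block31_index[OF mat3_carrier] i3 zw)
  moreover have "i4 = 0" "i5 = a" "i6 = b"
    using entry[of 1 0] entry[of 1 2] entry[of 1 3]
    by (simp_all add: R block31_index[OF mat3_carrier] i3 zw)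
  moreover have "i7 = 0" "i8 = 0" "i9 = m"
    using entry[of 2 0] entry[of 2 2] entry[of 2 3]
    by (simp_all add: R block31_index[OF mat3_carrier] i3 zw r3)
  ultimately show thesis using that[of a x y b] by (simp add: i3 d2 X2 r3 zw)
qed

text \<open>Two matrices with the same last row differ by an element of the parabolic subgroup.\<close>

lemma same_last_row:
  assumes g: "g \<in> carrier (GL 4)" and g': "g' \<in> carrier (GL 4)"
    and row: "\<And>j. j < 4 \<Longrightarrow> g $$ (3, j) = g' $$ (3, j)"
  obtains h Y where "h \<in> carrier (GL 3)" "Y \<in> carrier_mat 3 1" "g = block31 h Y 1 * g'"
proof -
  have shape: "\<exists>h \<in> carrier_mat 3 3. \<exists>Y \<in> carrier_mat 3 1. A * B = block31 h Y 1"
    if A: "A \<in> carrier_mat 4 4" and B: "B \<in> carrier_mat 4 4" and C: "C \<in> carrier_mat 4 4"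
      and CB: "C * B = 1\<^sub>m 4" and r: "\<And>j. j < 4 \<Longrightarrow> A $$ (3, j) = C $$ (3, j)" for A B C :: "'a mat"
  proof -
    have last: "(A * B) $$ (3, j) = (if j = 3 then 1 else 0)" if j: "j < 4" for j
    proof -
      have "(A * B) $$ (3, j) = (\<Sum>l<4. C $$ (3, l) * B $$ (l, j))"
        using A B j r by (subst index_mult_sum[of _ 4 4 _ 4]) auto
      also have "\<dots> = (C * B) $$ (3, j)"
        using B C j by (subst index_mult_sum[of _ 4 4 _ 4]) auto
      finally show ?thesis using j by (simp add: CB)
    qed
    define h where "h = mat 3 3 (\<lambda>ij. (A * B) $$ ij)"
    define Y where "Y = mat 3 1 (\<lambda>(i, j). (A * B) $$ (i, 3))"
    have "A * B = block31 h Y 1"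
    proof (rule eq_matI)
      fix i j assume "i < dim_row (block31 h Y 1)" "j < dim_col (block31 h Y 1)"
      then have ij: "i < 4" "j < 4" by (auto simp: block31_def h_def)
      have hc: "h \<in> carrier_mat 3 3" by (simp add: h_def)
      show "(A * B) $$ (i, j) = block31 h Y 1 $$ (i, j)"
      proof (cases "i = 3")
        case True
        then show ?thesis using last[OF ij(2)] ij by (auto simp: block31_index[OF hc])
      next
        case False
        then have "i < 3" using ij by simp
        moreover have "j = 3" if "\<not> j < 3" using that ij by simp
        ultimately show ?thesis
          unfolding block31_index[OF hc ij] by (auto simp: h_def Y_def simp del: index_mult_mat(1))
      qed
    qed (use A B in \<open>auto simp: block31_def h_def\<close>)
    then show ?thesis by (intro bexI[of _ h] bexI[of _ Y]) (auto simp: h_def Y_def)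
  qed
  obtain k where k: "k \<in> carrier (GL 4)" "g \<in> carrier_mat 4 4" "k \<in> carrier_mat 4 4"
    "g * k = 1\<^sub>m 4" "k * g = 1\<^sub>m 4" using g by (rule GL_cases)
  obtain k' where k': "k' \<in> carrier (GL 4)" "g' \<in> carrier_mat 4 4" "k' \<in> carrier_mat 4 4"
    "g' * k' = 1\<^sub>m 4" "k' * g' = 1\<^sub>m 4" using g' by (rule GL_cases)
  obtain h Y where h: "h \<in> carrier_mat 3 3" "Y \<in> carrier_mat 3 1" "g * k' = block31 h Y 1"
    using shape[OF k(2) k'(3,2,4) row] by blast
  obtain h' Y' where h': "h' \<in> carrier_mat 3 3" "Y' \<in> carrier_mat 3 1" "g' * k = block31 h' Y' 1"
    using shape[OF k'(2) k(3,2,4)] row by metis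
  have upper: "u = 1\<^sub>m 3" if u: "u \<in> carrier_mat 3 3" "block31 u Z 1 = 1\<^sub>m 4" for u Z :: "'a mat"
  proof (rule eq_matI)
    fix i j assume "i < dim_row (1\<^sub>m 3 :: 'a mat)" "j < dim_col (1\<^sub>m 3 :: 'a mat)"
    then show "u $$ (i, j) = 1\<^sub>m 3 $$ (i, j)"
      using block31_index[OF u(1), of i j Z 1] u(2) by simp
  qed (use u in auto)
  have "(g * k') * (g' * k) = 1\<^sub>m 4"
    using k k' GL_cancel[OF k'(5,3,2) k(3)] by (simp add: assoc4)
  then have 1: "h * h' = 1\<^sub>m 3"
    unfolding h(3) h'(3) block31_mult[OF h(1) h'(1) h(2) h'(2)]
    using upper[of "h * h'" "h * Y' + 1 \<cdot>\<^sub>m Y"] h h' by simp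
  have "(g' * k) * (g * k') = 1\<^sub>m 4"
    using k k' GL_cancel[OF k(5,3,2) k'(3)] by (simp add: assoc4)
  then have 2: "h' * h = 1\<^sub>m 3"
    unfolding h(3) h'(3) block31_mult[OF h'(1) h(1) h'(2) h(2)]
    using upper[of "h' * h" "h' * Y + 1 \<cdot>\<^sub>m Y'"] h h' by simp
  have "g = block31 h Y 1 * g'"
    unfolding h(3)[symmetric] using GL_cancel'[OF k'(5,3,2) k(2)] by simp
  then show thesis using that GL_I[OF h(1) h'(1) 1 2] h(2) by blast
qed

lemma parabolic_3_1_eq:
  "(parabolic_3_1 :: 'a :: comm_ring_1 mat set) =
    {block31 h Y m | h Y m. h \<in> carrier (GL 3) \<and> Y \<in> carrier_mat 3 1 \<and> m dvd 1}"
proof -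
  have "(\<exists>h2 \<in> carrier (GL 1). A = four_block_mat h1 Y (0\<^sub>m 1 3) h2) \<longleftrightarrow>
      (\<exists>m. m dvd 1 \<and> A = block31 h1 Y m)" for A h1 Y :: "'a mat"
  proof
    assume "\<exists>h2 \<in> carrier (GL 1). A = four_block_mat h1 Y (0\<^sub>m 1 3) h2"
    then obtain h2 where h2: "h2 \<in> carrier (GL 1)" "A = four_block_mat h1 Y (0\<^sub>m 1 3) h2" by blast
    obtain k where k: "h2 \<in> carrier_mat 1 1" "k \<in> carrier_mat 1 1" "h2 * k = 1\<^sub>m 1"
      using h2(1) by (rule GL_cases)
    have "1 = (h2 * k) $$ (0, 0)" by (simp add: k(3))
    also have "\<dots> = h2 $$ (0, 0) * k $$ (0, 0)"
      using k by (subst index_mult_sum[of _ 1 1 _ 1]) auto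
    finally have "h2 $$ (0, 0) dvd 1" by (metis dvd_triv_left)
    moreover have "h2 = mat 1 1 (\<lambda>_. h2 $$ (0, 0))" using k by (intro eq_matI) auto
    ultimately show "\<exists>m. m dvd 1 \<and> A = block31 h1 Y m" using h2(2) unfolding block31_def by metis
  next
    assume "\<exists>m. m dvd 1 \<and> A = block31 h1 Y m"
    then obtain m where m: "m dvd 1" "A = block31 h1 Y m" by blast
    obtain n where n: "1 = m * n" using m(1) by (auto simp: dvd_def)
    have "mat 1 1 (\<lambda>_. m) \<in> carrier (GL 1)"
    proof (rule GL_I)
      show "mat 1 1 (\<lambda>_. m) * mat 1 1 (\<lambda>_. n) = 1\<^sub>m 1" "mat 1 1 (\<lambda>_. n) * mat 1 1 (\<lambda>_. m) = 1\<^sub>m 1"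
        using n by (auto intro!: eq_matI simp: scalar_prod_def mult.commute)
    qed simp_all
    then show "\<exists>h2 \<in> carrier (GL 1). A = four_block_mat h1 Y (0\<^sub>m 1 3) h2"
      using m(2) by (auto simp: block31_def)
  qed
  note h2_iff = this
  show ?thesis
  proof (rule Set.set_eqI)
    fix A :: "'a mat"
    have "A \<in> parabolic_3_1 \<longleftrightarrow> (\<exists>h \<in> carrier (GL 3). \<exists>Y \<in> carrier_mat 3 1.
        \<exists>h2 \<in> carrier (GL 1). A = four_block_mat h Y (0\<^sub>m 1 3) h2)"
      unfolding parabolic_3_1_def by blast
    also have "\<dots> \<longleftrightarrow> (\<exists>h \<in> carrier (GL 3). \<exists>Y \<in> carrier_mat 3 1. \<exists>m. m dvd 1 \<and> A = block31 h Y m)"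
      by (simp only: h2_iff)
    finally show "A \<in> parabolic_3_1 \<longleftrightarrow> A \<in> {block31 h Y m | h Y m.
        h \<in> carrier (GL 3) \<and> Y \<in> carrier_mat 3 1 \<and> m dvd 1}"
      by blast
  qed
qed

section \<open>The degenerate Whittaker space\<close>

locale whittaker_model = cuspidal_functional \<omega> red \<psi> \<rho> c0 c1 t \<phi> lam
  for \<omega> :: "'r :: comm_ring_1" and red :: "'r \<Rightarrow> 'k :: {field, finite}" and \<psi>
    and \<rho> :: "('r mat, 'v :: ab_group_add) rep" and c0 c1 t \<phi> lam +
  fixes \<chi> :: "'r \<Rightarrow> complex"
  assumes chi_character: "character unit_group \<chi>"
begin

abbreviation "VR \<equiv> rep_space \<rho>"
abbreviation "scR \<equiv> rep_scale \<rho>"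
abbreviation "actR \<equiv> rep_act \<rho>"
abbreviation "C3 \<equiv> companion3 c0 c1 t"
abbreviation "I3 \<equiv> centralizer3 C3"

lemma C3_simps [simp]:
  "1\<^sub>m 3 * C3 = C3" "C3 * 1\<^sub>m 3 = C3"
  "A \<in> carrier_mat 3 3 \<Longrightarrow> A * C3 \<in> carrier_mat 3 3"
  "A \<in> carrier_mat 3 3 \<Longrightarrow> C3 * A \<in> carrier_mat 3 3"
  using left_mult_one_mat[OF companion3_carrier[of c0 c1 t]]
    right_mult_one_mat[OF companion3_carrier[of c0 c1 t]]
    mult_carrier_mat[OF _ companion3_carrier[of c0 c1 t]]
    mult_carrier_mat[OF companion3_carrier[of c0 c1 t]] by auto

lemma chi_mult: "x dvd 1 \<Longrightarrow> y dvd 1 \<Longrightarrow> \<chi> (x * y) = \<chi> x * \<chi> y"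
  using chi_character by (simp add: character_def unit_group_def)

lemma chi_nz: "x dvd 1 \<Longrightarrow> \<chi> x \<noteq> 0"
  using chi_character by (simp add: character_def unit_group_def)

lemma chi_1 [simp]: "\<chi> 1 = 1"
  using chi_mult[of 1 1] chi_nz[of 1] by simp

lemma unit_mult: "x dvd (1 :: 'r) \<Longrightarrow> y dvd 1 \<Longrightarrow> x * y dvd 1"
  by (simp add: unit_iff red_mult)

lemma unit_eps: "1 + eps a dvd 1"
  by (simp add: unit_iff red_add red_1)

text \<open>On \<open>1 + eps x\<close> the character \<open>\<chi>\<close> is an additive character of the residue field, hence given by a
  scalar.\<close>

definition chi_exponent :: 'k where
  "chi_exponent = (SOME a. \<forall>x. \<chi> (1 + eps x) = e (a * x))"

lemma chi_eps: "\<chi> (1 + eps x) = e (chi_exponent * x)"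
proof -
  have "\<chi> (1 + eps (x + y)) = \<chi> (1 + eps x) * \<chi> (1 + eps y)" for x y
    using chi_mult[OF unit_eps unit_eps, of x y] by (simp add: eps_add algebra_simps)
  then obtain a where "\<And>x. \<chi> (1 + eps x) = e (a * x)"
    using additive_character_eq[of "\<lambda>x. \<chi> (1 + eps x)"] chi_nz[OF unit_eps] by blast
  then have "\<exists>a. \<forall>x. \<chi> (1 + eps x) = e (a * x)" by blast
  from someI_ex[OF this] show ?thesis unfolding chi_exponent_def by blast
qed

text \<open>The trace of the companion matrices of size two that occur in the Whittaker space.\<close>

definition trace_exponent :: 'k where "trace_exponent = t + chi_exponent"

text \<open>The character by which the centre acts on the induced representation.\<close>

definition central :: "'r \<Rightarrow> complex" where "central z = \<chi> z * \<phi> (z \<cdot>\<^sub>m 1\<^sub>m 3)"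

lemma I3_GL: "h \<in> I3 \<Longrightarrow> h \<in> carrier (GL 3)"
  by (simp add: centralizer3_def)

lemma I3_mat: "h \<in> I3 \<Longrightarrow> h \<in> carrier_mat 3 3"
  by (simp add: I3_GL GL_mat)

lemma redm_smult: "redm (z \<cdot>\<^sub>m A) = red z \<cdot>\<^sub>m redm A"
  by (rule eq_matI) (auto simp: red_mult)

lemma scalar_I3: "z dvd 1 \<Longrightarrow> z \<cdot>\<^sub>m 1\<^sub>m 3 \<in> I3"
  using GL_scalar[of z 3]
  by (simp add: centralizer3_def redm_smult mult_smult_assoc_mat[of _ 3 3 _ 3]
      mult_smult_distrib[of _ 3 3 _ 3])

lemma one_I3: "1\<^sub>m 3 \<in> I3"
  by (simp add: centralizer3_def GL_one)

lemma congr_I3: "M \<in> carrier_mat 3 3 \<Longrightarrow> congr M \<in> I3"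
  by (simp add: centralizer3_def congr_GL)

lemma mult_I3:
  assumes "h \<in> I3" "h' \<in> I3"
  shows "h * h' \<in> I3"
proof -
  have m: "redm h \<in> carrier_mat 3 3" "redm h' \<in> carrier_mat 3 3" using assms by (simp_all add: I3_mat)
  have c: "redm h * C3 = C3 * redm h" "redm h' * C3 = C3 * redm h'"
    using assms by (simp_all add: centralizer3_def)
  have "redm h * redm h' * C3 = redm h * C3 * redm h'"
    using m c(2) by (simp add: assoc3)
  also have "\<dots> = C3 * (redm h * redm h')"
    unfolding c(1) using m
    by (simp add: assoc3)
  finally show ?thesis
    using assms GL_mult[of h 3 h'] by (simp add: centralizer3_def redm_mult[OF I3_mat I3_mat] assms)
qed

lemma inverse_I3:
  assumes "h \<in> I3" "h' \<in> carrier (GL 3)" "h * h' = 1\<^sub>m 3" "h' * h = 1\<^sub>m 3"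
  shows "h' \<in> I3"
proof -
  have m: "h \<in> carrier_mat 3 3" "h' \<in> carrier_mat 3 3" using assms by (simp_all add: I3_mat GL_mat)
  have r: "redm h \<in> carrier_mat 3 3" "redm h' \<in> carrier_mat 3 3"
    "redm h * redm h' = 1\<^sub>m 3" "redm h' * redm h = 1\<^sub>m 3"
    using m assms redm_mult[OF m] redm_mult[OF m(2,1)] by auto
  have c: "redm h * C3 = C3 * redm h" using assms by (simp add: centralizer3_def)
  have "redm h' * C3 = redm h' * (C3 * redm h * redm h')"
    using GL_cancel'[OF r(3,1,2) companion3_carrier] by simp
  also have "\<dots> = C3 * redm h'"
    unfolding c[symmetric]
    using GL_cancel[OF r(4,2,1), of "C3 * redm h'" 3] r
    by (simp add: assoc3)
  finally show ?thesis using assms by (simp add: centralizer3_def)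
qed

lemma phi_1: "\<phi> (1\<^sub>m 3) = 1"
  using phi_mult[OF one_I3 one_I3] phi_nz[OF one_I3] by simp

lemma act_mult_R: "g \<in> carrier (GL 3) \<Longrightarrow> h \<in> carrier (GL 3) \<Longrightarrow> v \<in> VR \<Longrightarrow> actR (g * h) v = actR g (actR h v)"
  using \<rho>.act_mult[of g h v] by simp

lemma act_one_R: "v \<in> VR \<Longrightarrow> actR (1\<^sub>m 3) v = v"
  using \<rho>.act_one[of v] by simp

lemma lam_add: "v \<in> VR \<Longrightarrow> w \<in> VR \<Longrightarrow> lam (v + w) = lam v + lam w"
  using lam_linear by (simp add: linear_functional_def)

lemma lam_scale: "v \<in> VR \<Longrightarrow> lam (scR c v) = c * lam v"
  using lam_linear by (simp add: linear_functional_def)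

lemma lam_0: "lam 0 = 0"
  using \<rho>.linear_functional_sum[OF lam_linear, of "{}"] by simp

lemma lam_eqI:
  assumes v: "v \<in> VR" and w: "w \<in> VR"
    and eq: "\<And>h. h \<in> carrier (GL 3) \<Longrightarrow> lam (actR h v) = lam (actR h w)"
  shows "v = w"
proof -
  define u where "u = scR (- 1) w"
  have u: "u \<in> VR" using w \<rho>.sc_V[of w "- 1"] by (simp only: u_def)
  have "lam (actR h u) = - lam (actR h w)" if h: "h \<in> carrier (GL 3)" for h
    unfolding u_def \<rho>.act_sc[OF h w] lam_scale[OF \<rho>.act_V[OF h w]] by simp
  then have "v + u = 0"
    using v u eq by (intro lam_separates) (simp_all add: \<rho>.act_add lam_add)
  then show ?thesis by (simp add: u_def)
qed

lemma scalar_mult3: "A \<in> carrier_mat 3 3 \<Longrightarrow> (z \<cdot>\<^sub>m 1\<^sub>m 3) * A = A * (z \<cdot>\<^sub>m 1\<^sub>m 3)" for A :: "'r mat"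
  by (simp add: mult_smult_assoc_mat[of _ 3 3 _ 3] mult_smult_distrib[of _ 3 3 _ 3])

lemma act_scalar:
  assumes z: "z dvd 1" and v: "v \<in> VR"
  shows "actR (z \<cdot>\<^sub>m 1\<^sub>m 3) v = scR (\<phi> (z \<cdot>\<^sub>m 1\<^sub>m 3)) v"
proof (rule lam_eqI)
  have zG: "z \<cdot>\<^sub>m 1\<^sub>m 3 \<in> carrier (GL 3)" using z by (rule GL_scalar)
  fix h :: "'r mat" assume h: "h \<in> carrier (GL 3)"
  have "actR h (actR (z \<cdot>\<^sub>m 1\<^sub>m 3) v) = actR (z \<cdot>\<^sub>m 1\<^sub>m 3) (actR h v)"
    unfolding act_mult_R[OF h zG v, symmetric] act_mult_R[OF zG h v, symmetric]
    by (simp only: scalar_mult3[OF GL_mat[OF h]])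
  then show "lam (actR h (actR (z \<cdot>\<^sub>m 1\<^sub>m 3) v)) = lam (actR h (scR (\<phi> (z \<cdot>\<^sub>m 1\<^sub>m 3)) v))"
    using lam_act[OF scalar_I3[OF z]] h v by (simp add: \<rho>.act_sc lam_scale)
qed (use GL_scalar[OF z] v in simp_all)

definition induced :: "('r mat, 'r mat \<Rightarrow> 'v) rep" where
  "induced = induced_rep (GL 4) parabolic_3_1 (inflated_rep \<rho> \<chi>)"

definition whittaker :: "('r mat, 'r mat \<Rightarrow> 'v) rep" where
  "whittaker = degenerate_whittaker \<psi> induced"

lemma induced_space_iff:
  "f \<in> rep_space induced \<longleftrightarrow>
    (\<forall>g \<in> carrier (GL 4). f g \<in> VR) \<and> (\<forall>g. g \<notin> carrier (GL 4) \<longrightarrow> f g = 0) \<and>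
    (\<forall>h Y m g. h \<in> carrier (GL 3) \<longrightarrow> Y \<in> carrier_mat 3 1 \<longrightarrow> m dvd 1 \<longrightarrow> g \<in> carrier (GL 4) \<longrightarrow>
      f (block31 h Y m * g) = scR (\<chi> m) (actR h (f g)))"
proof -
  have "rep_act (inflated_rep \<rho> \<chi>) (block31 h Y m) v = scR (\<chi> m) (actR h v)"
    if "h \<in> carrier (GL 3)" for h Y m v
  proof -
    have h: "h \<in> carrier_mat 3 3" using that by (rule GL_mat)
    have "mat 3 3 (\<lambda>ij. block31 h Y m $$ ij) = h"
      using h by (intro eq_matI) (auto simp: block31_index)
    then show ?thesis using block31_index[OF h, of 3 3] by (simp add: inflated_rep_def)
  qed
  then have "(\<forall>q \<in> parabolic_3_1. \<forall>g \<in> carrier (GL 4). f (q * g) = rep_act (inflated_rep \<rho> \<chi>) q (f g)) \<longleftrightarrow>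
    (\<forall>h Y m g. h \<in> carrier (GL 3) \<longrightarrow> Y \<in> carrier_mat 3 1 \<longrightarrow> m dvd 1 \<longrightarrow> g \<in> carrier (GL 4) \<longrightarrow>
      f (block31 h Y m * g) = scR (\<chi> m) (actR h (f g)))"
    unfolding parabolic_3_1_eq by (auto; metis)
  then show ?thesis
    unfolding induced_def induced_rep_def by (simp add: inflated_rep_def)
qed

lemma rep_scale_induced: "rep_scale induced c f = (\<lambda>g. scR c (f g))"
  by (simp add: induced_def induced_rep_def inflated_rep_def)

lemma rep_act_induced: "rep_act induced g f = (\<lambda>x. if x \<in> carrier (GL 4) then f (x * g) else 0)"
  by (simp add: induced_def induced_rep_def cong: if_cong)

lemma whittaker_space_iff:
  "f \<in> rep_space whittaker \<longleftrightarrow> f \<in> rep_space induced \<and>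
    (\<forall>X g. X \<in> carrier_mat 2 2 \<longrightarrow> g \<in> carrier (GL 4) \<longrightarrow> f (g * unip22 X) = scR (\<psi> (mat_trace X)) (f g))"
proof -
  have "rep_act induced (unip22 X) f = rep_scale induced c f \<longleftrightarrow>
      (\<forall>g \<in> carrier (GL 4). f (g * unip22 X) = scR c (f g))"
    if "f \<in> rep_space induced" for X c
  proof -
    have "scR c (f g) = 0" if "g \<notin> carrier (GL 4)" for g
      using that \<open>f \<in> _\<close> by (simp add: induced_space_iff)
    then show ?thesis unfolding rep_act_induced rep_scale_induced fun_eq_iff by auto
  qed
  then show ?thesis
    unfolding whittaker_def degenerate_whittaker_def unip22_def[symmetric] by auto
qed

lemma rep_scale_whittaker: "rep_scale whittaker c f = (\<lambda>g. scR c (f g))"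
  by (simp add: whittaker_def degenerate_whittaker_def rep_scale_induced)

lemma rep_act_whittaker:
  "rep_act whittaker d f = (\<lambda>x. if x \<in> carrier (GL 4) then f (x * diag22 d) else 0)"
  by (simp add: whittaker_def degenerate_whittaker_def rep_act_induced diag22_def cong: if_cong)

context
  fixes f assumes f: "f \<in> rep_space whittaker"
begin

lemma whittaker_V: "g \<in> carrier (GL 4) \<Longrightarrow> f g \<in> VR"
  using f by (simp add: whittaker_space_iff induced_space_iff)

lemma whittaker_out: "g \<notin> carrier (GL 4) \<Longrightarrow> f g = 0"
  using f by (simp add: whittaker_space_iff induced_space_iff)

lemma whittaker_left:
  "h \<in> carrier (GL 3) \<Longrightarrow> Y \<in> carrier_mat 3 1 \<Longrightarrow> m dvd 1 \<Longrightarrow> g \<in> carrier (GL 4) \<Longrightarrow>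
     f (block31 h Y m * g) = scR (\<chi> m) (actR h (f g))"
  using f by (simp add: whittaker_space_iff induced_space_iff)

lemma whittaker_right:
  "X \<in> carrier_mat 2 2 \<Longrightarrow> g \<in> carrier (GL 4) \<Longrightarrow> f (g * unip22 X) = scR (\<psi> (mat_trace X)) (f g)"
  using f by (simp add: whittaker_space_iff)

end

lemma whittaker_combination:
  assumes f: "f \<in> rep_space whittaker" and f': "f' \<in> rep_space whittaker"
  shows "(\<lambda>g. f' g + scR a (f g)) \<in> rep_space whittaker"
  unfolding whittaker_space_iff induced_space_iff
proof (intro conjI allI impI ballI)
  fix g :: "'r mat" assume g: "g \<in> carrier (GL 4)"
  note V = whittaker_V[OF f g] whittaker_V[OF f' g]
  show "f' g + scR a (f g) \<in> VR" using V by simp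
  fix X :: "'r mat" assume X: "X \<in> carrier_mat 2 2"
  show "f' (g * unip22 X) + scR a (f (g * unip22 X)) = scR (\<psi> (mat_trace X)) (f' g + scR a (f g))"
    unfolding whittaker_right[OF f X g] whittaker_right[OF f' X g]
    by (simp only: \<rho>.vs.scale_right_distrib \<rho>.vs.scale_scale mult.commute)
next
  fix g :: "'r mat" assume "g \<notin> carrier (GL 4)"
  then show "f' g + scR a (f g) = 0" by (simp add: whittaker_out[OF f] whittaker_out[OF f'])
next
  fix h Y g :: "'r mat" and m :: 'r
  assume h: "h \<in> carrier (GL 3)" "Y \<in> carrier_mat 3 1" "m dvd 1" and g: "g \<in> carrier (GL 4)"
  note V = whittaker_V[OF f g] whittaker_V[OF f' g]
  show "f' (block31 h Y m * g) + scR a (f (block31 h Y m * g)) =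
      scR (\<chi> m) (actR h (f' g + scR a (f g)))"
    unfolding whittaker_left[OF f h g] whittaker_left[OF f' h g]
      \<rho>.act_add[OF h(1) V(2) \<rho>.sc_V[OF V(1)]] \<rho>.act_sc[OF h(1) V(1)]
    by (simp only: \<rho>.vs.scale_right_distrib \<rho>.vs.scale_scale mult.commute)
qed

lemma unip22_diag22_commute:
  fixes d :: "'r mat"
  assumes "d * d' = 1\<^sub>m 2" "d \<in> carrier_mat 2 2" "d' \<in> carrier_mat 2 2" "X \<in> carrier_mat 2 2"
  shows "unip22 X * diag22 d = diag22 d * unip22 (d' * X * d)"
proof -
  have "d * (d' * X * d) = X * d"
    using assms GL_cancel[OF assms(1-3), of "X * d" 2] by (simp add: assoc2)
  then show ?thesis using assms by (simp add: unip22_diag22 diag22_unip22)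
qed

lemma trace_conj2:
  fixes d :: "'r mat"
  assumes "d * d' = 1\<^sub>m 2" "d \<in> carrier_mat 2 2" "d' \<in> carrier_mat 2 2" "X \<in> carrier_mat 2 2"
  shows "mat_trace (d' * X * d) = mat_trace X"
  using mat_trace_conj[of d 2 d' "1\<^sub>m 2" "1\<^sub>m 2" X] assms by simp

lemma whittaker_act:
  assumes f: "f \<in> rep_space whittaker" and d: "d \<in> carrier (GL 2)"
  shows "rep_act whittaker d f \<in> rep_space whittaker"
proof -
  obtain d' where d': "d \<in> carrier_mat 2 2" "d' \<in> carrier_mat 2 2" "d * d' = 1\<^sub>m 2" "d' * d = 1\<^sub>m 2"
    using d by (rule GL_cases)
  note dG = diag22_GL[OF d]
  show ?thesis
    unfolding whittaker_space_iff induced_space_iff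
  proof (intro conjI allI impI ballI)
    fix g :: "'r mat" assume "g \<in> carrier (GL 4)"
    then show "rep_act whittaker d f g \<in> VR"
      using whittaker_V[OF f GL_mult[OF _ dG]] by (simp add: rep_act_whittaker)
  next
    fix g :: "'r mat" assume "g \<notin> carrier (GL 4)"
    then show "rep_act whittaker d f g = 0" by (simp add: rep_act_whittaker)
  next
    fix h Y g :: "'r mat" and m :: 'r assume h: "h \<in> carrier (GL 3)" "Y \<in> carrier_mat 3 1" "m dvd 1"
      and g: "g \<in> carrier (GL 4)"
    have "block31 h Y m * g * diag22 d = block31 h Y m * (g * diag22 d)"
      using GL_mat[OF g] GL_mat[OF h(1)] d' by (intro assoc4) auto
    then show "rep_act whittaker d f (block31 h Y m * g) = scR (\<chi> m) (actR h (rep_act whittaker d f g))"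
      using GL_mult[OF block31_in_GL[OF h] g] g whittaker_left[OF f h GL_mult[OF g dG]]
      by (simp add: rep_act_whittaker)
  next
    fix X g :: "'r mat" assume X: "X \<in> carrier_mat 2 2" and g: "g \<in> carrier (GL 4)"
    have "g * unip22 X * diag22 d = g * (unip22 X * diag22 d)"
      using GL_mat[OF g] d' by (intro assoc4) auto
    also have "\<dots> = g * diag22 d * unip22 (d' * X * d)"
      unfolding unip22_diag22_commute[OF d'(3,1,2) X]
      using GL_mat[OF g] d' by (intro assoc4[symmetric]) auto
    finally show "rep_act whittaker d f (g * unip22 X) = scR (\<psi> (mat_trace X)) (rep_act whittaker d f g)"
      using whittaker_right[OF f _ GL_mult[OF g dG], of "d' * X * d"] d' X g
        GL_mult[OF g unip22_GL[OF X]] trace_conj2[OF d'(3,1,2) X]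
      by (simp add: rep_act_whittaker)
  qed
qed

text \<open>Where the first half of the last row of \<open>g\<close> vanishes in the residue field, a unipotent element
  of the congruence subgroup on the right can be moved to the unipotent radical on the left, where
  it acts trivially.\<close>

lemma whittaker_vanish:
  assumes f: "f \<in> rep_space whittaker" and g: "g \<in> carrier (GL 4)"
    and 0: "red (g $$ (3, 0)) = 0" "red (g $$ (3, 1)) = 0"
  shows "f g = 0"
proof -
  have gm: "g \<in> carrier_mat 4 4" using g by (rule GL_mat)
  obtain k where k: "redm g \<in> carrier_mat 4 4" "k \<in> carrier_mat 4 4" "redm g * k = 1\<^sub>m 4"
    using GL_redm[OF g] by (rule GL_cases)
  have "1 = (redm g * k) $$ (3, 3)" by (simp add: k(3))
  also have "\<dots> = (\<Sum>l<4. redm g $$ (3, l) * k $$ (l, 3))"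
    using k by (intro index_mult_sum[of _ 4 4 _ 4]) auto
  also have "\<dots> = red (g $$ (3, 2)) * k $$ (2, 3) + red (g $$ (3, 3)) * k $$ (3, 3)"
    using gm 0 by (simp add: lessThan_small)
  finally have nz: "red (g $$ (3, 2)) \<noteq> 0 \<or> red (g $$ (3, 3)) \<noteq> 0" by auto
  obtain x0 x1 where x: "e (x0 * red (g $$ (3, 2)) + x1 * red (g $$ (3, 3))) \<noteq> 1"
  proof (cases "red (g $$ (3, 2)) = 0")
    case True
    then obtain x where "e (red (g $$ (3, 3)) * x) \<noteq> 1" using nz e_nontrivial by metis
    then show thesis using that[of 0 x] by (simp add: mult.commute)
  next
    case False
    then obtain x where "e (red (g $$ (3, 2)) * x) \<noteq> 1" using e_nontrivial by metis
    then show thesis using that[of x 0] by (simp add: mult.commute)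
  qed
  define X where "X = mat2 (eps (x0 * red (g $$ (3, 2)))) (eps (x0 * red (g $$ (3, 3))))
    (eps (x1 * red (g $$ (3, 2)))) (eps (x1 * red (g $$ (3, 3))))"
  have X: "X \<in> carrier_mat 2 2" by (simp add: X_def)
  define Y where "Y = mat 3 1 (\<lambda>(i, j). g $$ (i, 0) * eps x0 + g $$ (i, 1) * eps x1)"
  have Y: "Y \<in> carrier_mat 3 1" by (simp add: Y_def)
  have "g * unip22 X = block31 (1\<^sub>m 3) Y 1 * g"
  proof (rule eq_matI)
    fix i j assume "i < dim_row (block31 (1\<^sub>m 3) Y 1 * g)" "j < dim_col (block31 (1\<^sub>m 3) Y 1 * g)"
    then have ij: "i < 4" "j < 4" using gm by auto
    have "(g * unip22 X) $$ (i, j) = (\<Sum>l<4. g $$ (i, l) * unip22 X $$ (l, j))"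
      using gm ij by (intro index_mult_sum[of _ 4 4 _ 4]) auto
    also have "\<dots> = (\<Sum>l<4. block31 (1\<^sub>m 3) Y 1 $$ (i, l) * g $$ (l, j))"
      using ij 0 unfolding less_small
      by (elim disjE)
        (simp_all add: lessThan_small unip22_def X_def block31_index Y_def mult_eps eps_mult
          distrib_right distrib_left eps_add ac_simps red_mult)
    also have "\<dots> = (block31 (1\<^sub>m 3) Y 1 * g) $$ (i, j)"
      using gm ij by (intro index_mult_sum[of _ 4 4 _ 4, symmetric]) auto
    finally show "(g * unip22 X) $$ (i, j) = (block31 (1\<^sub>m 3) Y 1 * g) $$ (i, j)" .
  qed (use gm in \<open>auto simp: unip22_def\<close>)
  then have "scR (\<psi> (mat_trace X)) (f g) = f g"
    using whittaker_right[OF f X g] whittaker_left[OF f GL_one Y _ g, of 1] whittaker_V[OF f g]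
    by (simp add: act_one_R)
  moreover have "\<psi> (mat_trace X) \<noteq> 1"
    using x by (simp add: X_def e_def eps_add)
  ultimately have "scR (\<psi> (mat_trace X) - 1) (f g) = 0"
    by (simp add: \<rho>.vs.scale_left_diff_distrib)
  then show ?thesis using \<open>\<psi> (mat_trace X) \<noteq> 1\<close> by simp
qed

lemma perm4_diag22_GL: "d \<in> carrier (GL 2) \<Longrightarrow> perm4 * diag22 d \<in> carrier (GL 4)" for d :: "'r mat"
  by (intro GL_mult perm4_GL diag22_GL)

text \<open>The first half of the last row of \<open>g\<close> can be completed to an invertible matrix \<open>d\<close>, and the second
  half is then a combination of the first, with coefficients collected in \<open>X\<close>. So \<open>g\<close> has the same
  last row as \<open>perm4 * diag22 d * unip22 X\<close>.\<close>

lemma open_cell: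
  assumes g: "g \<in> carrier (GL 4)" and nz: "red (g $$ (3, 0)) \<noteq> 0 \<or> red (g $$ (3, 1)) \<noteq> 0"
  obtains d X h Y where "d \<in> carrier (GL 2)" "X \<in> carrier_mat 2 2" "h \<in> carrier (GL 3)"
    "Y \<in> carrier_mat 3 1" "g = block31 h Y 1 * (perm4 * diag22 d * unip22 X)"
proof -
  define a where "a j = g $$ (3, j)" for j
  obtain d X where d: "d \<in> carrier (GL 2)" "d $$ (1, 0) = a 0" "d $$ (1, 1) = a 1"
    and X: "X \<in> carrier_mat 2 2" "(d * X) $$ (1, 0) = a 2" "(d * X) $$ (1, 1) = a 3"
  proof (cases "red (a 1) = 0")
    case False
    then obtain u where u: "a 1 * u = 1" using unit_iff by (metis dvdE)
    have "mat2 1 0 (a 0) (a 1) \<in> carrier (GL 2)"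
      using False by (intro GL_redmD) (simp add: GL2_I red_1 red_0)
    moreover have "mat2 1 0 (a 0) (a 1) * mat2 0 0 (u * a 2) (u * a 3) = mat2 0 0 (a 2) (a 3)"
      using u by (simp add: mat2_mult mult.assoc[symmetric])
    ultimately show thesis
      using that[of "mat2 1 0 (a 0) (a 1)" "mat2 0 0 (u * a 2) (u * a 3)"] by simp
  next
    case True
    then have "red (a 0) \<noteq> 0" using nz by (simp add: a_def)
    then obtain u where u: "a 0 * u = 1" using unit_iff by (metis dvdE)
    have "mat2 0 1 (a 0) (a 1) \<in> carrier (GL 2)"
      using \<open>red (a 0) \<noteq> 0\<close> by (intro GL_redmD) (simp add: GL2_I red_1 red_0)
    moreover have "mat2 0 1 (a 0) (a 1) * mat2 (u * a 2) (u * a 3) 0 0 = mat2 0 0 (a 2) (a 3)"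
      using u by (simp add: mat2_mult mult.assoc[symmetric])
    ultimately show thesis
      using that[of "mat2 0 1 (a 0) (a 1)" "mat2 (u * a 2) (u * a 3) 0 0"] by simp
  qed
  have dm: "d \<in> carrier_mat 2 2" using d by (simp add: GL_mat)
  define m where "m = perm4 * diag22 d * unip22 X"
  have m: "m \<in> carrier (GL 4)"
    unfolding m_def by (intro GL_mult perm4_GL diag22_GL unip22_GL d X)
  have "m = perm4 * (diag22 d * unip22 X)"
    unfolding m_def using dm by (intro assoc4) auto
  then have mi: "m $$ (3, j) = (diag22 d * unip22 X) $$ (1, j)" if "j < 4" for j
    using that dm perm4_mult_index[of "diag22 d * unip22 X" 3 j] mult_carrier_mat[OF diag22_carrier[OF dm] unip22_carrier]
    by simp
  have "g $$ (3, j) = m $$ (3, j)" if "j < 4" for j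
    using that unfolding mi[OF that] diag22_unip22[OF dm X(1)] less_small
    using dm X d by (elim disjE) (simp_all add: a_def del: index_mult_mat(1))
  then obtain h Y where "h \<in> carrier (GL 3)" "Y \<in> carrier_mat 3 1" "g = block31 h Y 1 * m"
    by (rule same_last_row[OF g m])
  then show thesis using that d(1) X(1) m_def by blast
qed

lemma block31_perm4_act:
  assumes f: "f \<in> rep_space whittaker"
    and r: "mat3 a (a * x) (a * y) 0 a b 0 0 m \<in> carrier (GL 3)" and m: "m dvd 1"
    and d: "mat2 a b 0 m \<in> carrier (GL 2)"
  shows "scR (\<chi> m) (actR (mat3 a (a * x) (a * y) 0 a b 0 0 m) (f perm4)) =
    scR (\<psi> x) (f (perm4 * diag22 (mat2 a b 0 m)))"
proof -
  have "perm4 * (diag22 (mat2 a b 0 m) * unip22 (mat2 x y 0 0)) =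
      perm4 * diag22 (mat2 a b 0 m) * unip22 (mat2 x y 0 0)"
    by (intro assoc4[symmetric]) auto
  then have "f (block31 (mat3 a (a * x) (a * y) 0 a b 0 0 m) (col3 b 0 0) m * perm4) =
      scR (\<psi> x) (f (perm4 * diag22 (mat2 a b 0 m)))"
    using whittaker_right[OF f _ perm4_diag22_GL[OF d], of "mat2 x y 0 0"]
    by (simp add: block31_perm4)
  then show ?thesis using whittaker_left[OF f r col3_carrier m perm4_GL] by simp
qed

text \<open>At the representative \<open>perm4\<close>: if \<open>h\<close> carries the vector \<open>f perm4\<close> to a vector not killed by
  \<open>lam\<close>, comparing the characters of the unipotent elements in the congruence subgroup determines
  the first column of \<open>h\<^sup>-\<^sup>1 C h\<close> below the diagonal, and this forces \<open>h\<close> into the centralizer times triangular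
  matrices.\<close>

lemma whittaker_perm4_eq_0:
  assumes f: "f \<in> rep_space whittaker"
    and 0: "\<And>d. d \<in> carrier (GL 2) \<Longrightarrow> lam (f (perm4 * diag22 d)) = 0"
  shows "f perm4 = 0"
proof (rule lam_separates)
  define v where "v = f perm4"
  show V: "f perm4 \<in> VR" by (rule whittaker_V[OF f perm4_GL])
  have v: "v \<in> VR" using V by (simp add: v_def)
  fix h :: "'r mat" assume h: "h \<in> carrier (GL 3)"
  show "lam (actR h (f perm4)) = 0"
  proof (rule ccontr)
    assume "lam (actR h (f perm4)) \<noteq> 0"
    then have ne: "lam (actR h v) \<noteq> 0" by (simp add: v_def)
    obtain h' where h': "h' \<in> carrier (GL 3)" "h \<in> carrier_mat 3 3" "h' \<in> carrier_mat 3 3"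
      "h * h' = 1\<^sub>m 3" "h' * h = 1\<^sub>m 3" using h by (rule GL_cases)
    define H where "H = redm h"
    define H' where "H' = redm h'"
    have H: "H \<in> carrier_mat 3 3" "H' \<in> carrier_mat 3 3" "H * H' = 1\<^sub>m 3" "H' * H = 1\<^sub>m 3"
      using h' redm_mult[OF h'(2,3)] redm_mult[OF h'(3,2)] by (auto simp: H_def H'_def)
    define X where "X = H' * C3 * H"
    have X: "X \<in> carrier_mat 3 3"
      unfolding X_def by (intro mult_carrier_mat[of _ 3 3 _ 3] H companion3_carrier)
    have HX: "C3 * H = H * X"
      unfolding X_def using GL_cancel[OF H(3,1,2), of "C3 * H" 3] H
      by (simp add: assoc3)
    have chars: "e (X $$ (1, 0) * x + X $$ (2, 0) * y) = e x" for x y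
    proof -
      define M where "M = mat3 0 x y 0 0 0 0 0 (0 :: 'k)"
      have M: "M \<in> carrier_mat 3 3" by (simp add: M_def)
      have u: "congr M = mat3 1 (1 * eps x) (1 * eps y) 0 1 0 0 0 1"
        by (simp add: congr_def M_def mat3_one mat3_add)
      have p1: "perm4 * 1\<^sub>m 4 = (perm4 :: 'r mat)" by (rule right_mult_one_mat[OF perm4_carrier])
      then have "actR (congr M) v = scR (e x) v"
        using block31_perm4_act[OF f, of 1 "eps x" "eps y" 0 1] congr_GL[OF M] u v
          mat2_one[where 'a = 'r, symmetric] GL_one[of 2]
        by (simp add: v_def e_def p1)
      then have "e x * lam (actR h v) = lam (actR h (actR (congr M) v))"
        using h v by (simp add: \<rho>.act_sc lam_scale)
      also have "\<dots> = lam (actR (h * congr M) v)"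
        using h v congr_GL[OF M] by (simp add: act_mult_R)
      also have "h * congr M = h * congr M * h' * h"
        using GL_cancel'[OF h'(5,3,2), of "h * congr M" 3] h' M by simp
      also have "\<dots> = congr (H * M * H') * h"
        by (simp add: congr_conj[OF h'(2,3) M h'(4)] H_def H'_def)
      also have "lam (actR (congr (H * M * H') * h) v) = e (mat_trace (C3 * (H * M * H'))) * lam (actR h v)"
        using lam_act[OF congr_I3, of "H * M * H'" "actR h v"] phi_congr3[of "H * M * H'"] h v H M
        by (simp add: act_mult_R congr_GL)
      also have "mat_trace (C3 * (H * M * H')) = mat_trace (X * M)"
      proof (rule mat_trace_conj[of H' 3 H])
        show "H' * C3 = X * H'" unfolding X_def using GL_cancel'[OF H(3,1,2), of "H' * C3" 3] H by simp
      qed (use H M X in auto)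
      also have "\<dots> = X $$ (1, 0) * x + X $$ (2, 0) * y"
        by (subst mat3_eta[OF X]) (simp add: M_def mat3_mult)
      finally show ?thesis using ne by simp
    qed
    have "X $$ (1, 0) = 1" using chars[of _ 0] by (intro e_inj) simp
    moreover have "X $$ (2, 0) = 0" using chars[of 0] by (intro e_inj[of _ 0]) simp
    ultimately obtain Z x y b m where Z: "Z \<in> carrier (GL 3)" "Z * C3 = C3 * Z"
      and HZ: "H = Z * mat3 1 x y 0 1 b 0 0 m" and m: "m \<noteq> 0"
      using companion3_commutant[OF no_eigenvector GL_redm[OF h, folded H_def] HX X] by blast
    define r where "r = mat3 1 (1 * lift x) (1 * lift y) 0 1 (lift b) 0 0 (lift m)"
    have rr: "redm r = mat3 1 x y 0 1 b 0 0 m" by (simp add: r_def red_1 red_0)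
    have Zm: "Z \<in> carrier_mat 3 3" using Z by (simp add: GL_mat)
    obtain Z' where Z': "Z' \<in> carrier_mat 3 3" "Z' * Z = 1\<^sub>m 3" "Z * Z' = 1\<^sub>m 3" "Z' \<in> carrier (GL 3)"
      using Z(1) by (rule GL_cases)
    have "redm r = Z' * H"
      unfolding rr HZ using GL_cancel[OF Z'(2,1) Zm mat3_carrier] by simp
    then have rG: "r \<in> carrier (GL 3)"
      using GL_mult[OF Z'(4) GL_redm[OF h]] by (intro GL_redmD) (simp add: H_def)
    obtain r' where r': "r' \<in> carrier (GL 3)" "r \<in> carrier_mat 3 3" "r' \<in> carrier_mat 3 3"
      "r * r' = 1\<^sub>m 3" "r' * r = 1\<^sub>m 3" using rG by (rule GL_cases)
    define i where "i = h * r'"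
    have "redm i = Z * redm r * redm r'"
      unfolding i_def redm_mult[OF h'(2) r'(3)] using HZ by (simp add: rr H_def)
    also have "\<dots> = Z"
      using redm_mult[OF r'(2,3)] r' GL_cancel'[of "redm r" "redm r'" 3 Z 3] Zm by simp
    finally have "i \<in> I3"
      using Z GL_mult[OF h r'(1)] by (simp add: centralizer3_def i_def)
    moreover have "h = i * r" unfolding i_def using GL_cancel'[OF r'(5,3,2) h'(2)] by simp
    ultimately have "lam (actR h v) = \<phi> i * lam (actR r v)"
      using lam_act[of i "actR r v"] rG v by (simp add: act_mult_R I3_GL)
    moreover have "lam (actR r v) = 0"
    proof -
      have um: "lift m dvd 1" using m by (simp add: unit_iff)
      have d: "mat2 1 (lift b) 0 (lift m) \<in> carrier (GL 2)"
        using m by (intro GL_redmD) (simp add: GL2_I red_1 red_0)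
      have "scR (\<chi> (lift m)) (actR r v) = scR (\<psi> (lift x)) (f (perm4 * diag22 (mat2 1 (lift b) 0 (lift m))))"
        unfolding r_def v_def by (rule block31_perm4_act[OF f rG[unfolded r_def] um d])
      then have "\<chi> (lift m) * lam (actR r v) = \<psi> (lift x) * 0"
        using 0[OF d] whittaker_V[OF f perm4_diag22_GL[OF d]] rG v
        by (metis lam_scale \<rho>.act_V)
      then show ?thesis using chi_nz[OF um] by simp
    qed
    ultimately show False using ne by simp
  qed
qed

text \<open>An element of the Whittaker space is determined by the complex function
  \<open>d \<mapsto> lam (f (perm4 * diag22 d))\<close> on \<open>GL 2\<close>.\<close>

lemma whittaker_eq_0:
  assumes f: "f \<in> rep_space whittaker"
    and 0: "\<And>d. d \<in> carrier (GL 2) \<Longrightarrow> lam (f (perm4 * diag22 d)) = 0"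
  shows "f = 0"
proof
  fix g :: "'r mat"
  consider "g \<notin> carrier (GL 4)" | "g \<in> carrier (GL 4)" "red (g $$ (3, 0)) = 0" "red (g $$ (3, 1)) = 0"
    | "g \<in> carrier (GL 4)" "red (g $$ (3, 0)) \<noteq> 0 \<or> red (g $$ (3, 1)) \<noteq> 0" by blast
  then have "f g = 0"
  proof cases
    case 3
    obtain d X h Y where d: "d \<in> carrier (GL 2)" and X: "X \<in> carrier_mat 2 2" and h: "h \<in> carrier (GL 3)"
      "Y \<in> carrier_mat 3 1" and g: "g = block31 h Y 1 * (perm4 * diag22 d * unip22 X)"
      using open_cell[OF 3] .
    note pd = perm4_diag22_GL[OF d]
    have dm: "d \<in> carrier_mat 2 2" using d by (rule GL_mat)
    have "rep_act whittaker d f perm4 = 0"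
    proof (rule whittaker_perm4_eq_0[OF whittaker_act[OF f d]])
      fix d' :: "'r mat" assume d': "d' \<in> carrier (GL 2)"
      have "perm4 * diag22 d' * diag22 d = perm4 * diag22 (d' * d)"
        using dm GL_mat[OF d'] by (simp add: diag22_mult[symmetric] assoc4)
      then show "lam (rep_act whittaker d f (perm4 * diag22 d')) = 0"
        using 0[OF GL_mult[OF d' d]] perm4_diag22_GL[OF d'] by (simp add: rep_act_whittaker)
    qed
    then have "f (perm4 * diag22 d) = 0" by (simp add: rep_act_whittaker perm4_GL)
    then show ?thesis
      unfolding g using whittaker_left[OF f h _ GL_mult[OF pd unip22_GL[OF X]], of 1]
        whittaker_right[OF f X pd] h by simp
  next
    case 1
    then show ?thesis by (rule whittaker_out[OF f])
  next
    case 2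
    then show ?thesis by (rule whittaker_vanish[OF f])
  qed
  then show "f g = 0 g" by simp
qed

text \<open>The matrix \<open>perm4\<close> conjugates \<open>diag22\<close> of a triangular element of the congruence subgroup into the
  parabolic subgroup. There \<open>b\<close> is seen by the subdiagonal entry of the companion matrix, and \<open>d\<close>
  both by its trace \<open>t\<close> and by \<open>\<chi>\<close>.\<close>

lemma triangular_equivariance:
  assumes f: "f \<in> rep_space whittaker"
  shows "lam (f (perm4 * diag22 (congr (mat2 a b 0 d)))) = e (b + trace_exponent * d) * lam (f perm4)"
proof -
  define M where "M = mat3 a 0 0 0 a b 0 0 d"
  have M: "M \<in> carrier_mat 3 3" by (simp add: M_def)
  have r: "congr M = mat3 (1 + eps a) ((1 + eps a) * 0) ((1 + eps a) * 0) 0 (1 + eps a) (eps b) 0 0 (1 + eps d)"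
    by (simp add: congr_def M_def mat3_one mat3_add)
  have d: "congr (mat2 a b 0 d) = mat2 (1 + eps a) (eps b) 0 (1 + eps d)"
    by (simp add: congr_def mat2_one mat2_add)
  have V: "f perm4 \<in> VR" by (rule whittaker_V[OF f perm4_GL])
  have "f (perm4 * diag22 (congr (mat2 a b 0 d))) = scR (\<chi> (1 + eps d)) (actR (congr M) (f perm4))"
    using block31_perm4_act[OF f, of "1 + eps a" 0 0 "eps b" "1 + eps d"] congr_GL[OF M]
      congr_GL[of "mat2 a b 0 d" 2] unit_eps
    by (simp add: r d)
  then have "lam (f (perm4 * diag22 (congr (mat2 a b 0 d)))) =
      e (chi_exponent * d) * (e (mat_trace (C3 * M)) * lam (f perm4))"
    using V congr_GL[OF M] lam_act[OF congr_I3[OF M] V]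
    by (simp add: lam_scale chi_eps phi_congr3[OF M])
  also have "mat_trace (C3 * M) = b + t * d"
    by (simp add: companion3_def M_def mat3_mult)
  finally show ?thesis by (simp add: e_add trace_exponent_def algebra_simps)
qed

lemma central_character: "character unit_group central"
proof -
  have "\<phi> ((x * y) \<cdot>\<^sub>m 1\<^sub>m 3) = \<phi> (x \<cdot>\<^sub>m 1\<^sub>m 3) * \<phi> (y \<cdot>\<^sub>m 1\<^sub>m 3)" if "x dvd 1" "y dvd 1" for x y
  proof -
    have "(x * y) \<cdot>\<^sub>m 1\<^sub>m 3 = (x \<cdot>\<^sub>m 1\<^sub>m 3) * (y \<cdot>\<^sub>m 1\<^sub>m 3 :: 'r mat)"
      by (rule eq_matI) (auto simp: mult_smult_assoc_mat[of _ 3 3 _ 3])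
    then show ?thesis using phi_mult[OF scalar_I3 scalar_I3] that by simp
  qed
  then show ?thesis
    by (simp add: character_def unit_group_def central_def chi_mult chi_nz phi_nz scalar_I3)
qed

lemma induced_central:
  assumes f: "f \<in> rep_space induced" and z: "z dvd 1" and g: "g \<in> carrier (GL 4)"
  shows "f (g * (z \<cdot>\<^sub>m 1\<^sub>m 4)) = scR (central z) (f g)"
proof -
  have gm: "g \<in> carrier_mat 4 4" using g by (rule GL_mat)
  have "block31 (z \<cdot>\<^sub>m 1\<^sub>m 3) (0\<^sub>m 3 1) z = z \<cdot>\<^sub>m 1\<^sub>m 4"
    by (rule eq_matI) (auto simp: block31_index less_small)
  moreover have "g * (z \<cdot>\<^sub>m 1\<^sub>m 4) = (z \<cdot>\<^sub>m 1\<^sub>m 4) * g"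
    using gm by (simp add: mult_smult_assoc_mat[of _ 4 4 _ 4] mult_smult_distrib[of _ 4 4 _ 4])
  ultimately have "f (g * (z \<cdot>\<^sub>m 1\<^sub>m 4)) = f (block31 (z \<cdot>\<^sub>m 1\<^sub>m 3) (0\<^sub>m 3 1) z * g)" by simp
  also have "\<dots> = scR (\<chi> z) (actR (z \<cdot>\<^sub>m 1\<^sub>m 3) (f g))"
    using f GL_scalar[OF z, of 3] z g by (simp add: induced_space_iff)
  also have "\<dots> = scR (central z) (f g)"
    using f z g by (simp add: induced_space_iff act_scalar central_def)
  finally show ?thesis .
qed

lemma induced_central_character: "has_central_character 4 induced central"
  unfolding has_central_character_def
proof (intro conjI ballI)
  show "character unit_group central" by (rule central_character)
  fix z :: 'r and f assume "z \<in> carrier unit_group" and f: "f \<in> rep_space induced"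
  then have z: "z dvd 1" by (simp add: unit_group_def)
  show "rep_act induced (z \<cdot>\<^sub>m 1\<^sub>m 4) f = rep_scale induced (central z) f"
    using induced_central[OF f z] f
    by (auto simp: rep_act_induced rep_scale_induced fun_eq_iff induced_space_iff)
qed

lemma diag22_scalar: "diag22 (z \<cdot>\<^sub>m 1\<^sub>m 2) = z \<cdot>\<^sub>m 1\<^sub>m 4"
  by (rule eq_matI) (auto simp: diag22_def less_small)

lemma whittaker_central:
  assumes f: "f \<in> rep_space whittaker" and z: "z dvd 1"
  shows "rep_act whittaker (z \<cdot>\<^sub>m 1\<^sub>m 2) f = rep_scale whittaker (central z) f"
  using induced_central[of f z] f z whittaker_out[OF f]
  by (auto simp: rep_act_whittaker rep_scale_whittaker fun_eq_iff diag22_scalar whittaker_space_iff)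

end

section \<open>Irreducible constituents of the Whittaker space\<close>

locale whittaker_irreducible =
  whittaker_model \<omega> red \<psi> \<rho> c0 c1 t \<phi> lam \<chi> + T: irreducible_GL2_representation \<omega> red \<psi> \<tau>
  for \<omega> :: "'r :: comm_ring_1" and red :: "'r \<Rightarrow> 'k :: {field, finite}" and \<psi>
    and \<rho> :: "('r mat, 'v :: ab_group_add) rep" and c0 c1 t \<phi> lam \<chi>
    and \<tau> :: "('r mat, 'w :: ab_group_add) rep"
begin

abbreviation "VT \<equiv> rep_space \<tau>"

lemma intertwiner_scale:
  "intertwiner G \<sigma> \<pi> S \<Longrightarrow> v \<in> rep_space \<sigma> \<Longrightarrow> S (rep_scale \<sigma> c v) = rep_scale \<pi> c (S v)"
  by (simp add: intertwiner_def)

lemma intertwiner_act: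
  "intertwiner G \<sigma> \<pi> S \<Longrightarrow> v \<in> rep_space \<sigma> \<Longrightarrow> g \<in> carrier G \<Longrightarrow>
    S (rep_act \<sigma> g v) = rep_act \<pi> g (S v)"
  by (simp add: intertwiner_def)

lemma intertwinerD:
  assumes "intertwiner (GL 2) \<tau> whittaker S"
  shows "v \<in> VT \<Longrightarrow> S v \<in> rep_space whittaker"
    and "v \<in> VT \<Longrightarrow> w \<in> VT \<Longrightarrow> S (v + w) = S v + S w"
    and "v \<in> VT \<Longrightarrow> S (rep_scale \<tau> c v) g = scR c (S v g)"
    and "v \<in> VT \<Longrightarrow> d \<in> carrier (GL 2) \<Longrightarrow> g \<in> carrier (GL 4) \<Longrightarrow>
      S (rep_act \<tau> d v) g = S v (g * diag22 d)"
  using assms by (auto simp: intertwiner_def rep_scale_whittaker rep_act_whittaker)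

lemma intertwiner_triangular:
  assumes S: "intertwiner (GL 2) \<tau> whittaker S"
  shows "T.triangular_functional trace_exponent (\<lambda>v. lam (S v perm4))"
proof -
  have V: "S v perm4 \<in> VR" if "v \<in> VT" for v
    using whittaker_V[OF intertwinerD(1)[OF S that] perm4_GL] .
  have "lam (S (rep_act \<tau> (congr (mat2 a b 0 d)) v) perm4) = e (b + trace_exponent * d) * lam (S v perm4)"
    if "v \<in> VT" for a b d v
    using triangular_equivariance[OF intertwinerD(1)[OF S that]]
      intertwinerD(4)[OF S that congr_GL[OF mat2_carrier] perm4_GL] by simp
  then show ?thesis
    using V by (simp add: T.triangular_functional_def linear_functional_def intertwinerD(2,3)[OF S]
        lam_add lam_scale)
qed

lemma intertwiner_eq_0:
  assumes S: "intertwiner (GL 2) \<tau> whittaker S"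
    and 0: "\<And>v. v \<in> VT \<Longrightarrow> lam (S v perm4) = 0" and v: "v \<in> VT"
  shows "S v = 0"
proof (rule whittaker_eq_0[OF intertwinerD(1)[OF S v]])
  fix d :: "'r mat" assume d: "d \<in> carrier (GL 2)"
  show "lam (S v (perm4 * diag22 d)) = 0"
    using 0[OF T.act_V[OF d v]] intertwinerD(4)[OF S v d perm4_GL] by simp
qed

text \<open>The functionals \<open>v \<mapsto> lam (S v perm4)\<close> attached to the two intertwiners are proportional, and by
  \<open>whittaker_eq_0\<close> they determine the intertwiners.\<close>

lemma intertwiner_unique:
  assumes S: "intertwiner (GL 2) \<tau> whittaker S" "u \<in> VT" "S u \<noteq> 0"
    and S': "intertwiner (GL 2) \<tau> whittaker S'"
  obtains a where "\<And>v. v \<in> VT \<Longrightarrow> S' v = rep_scale whittaker a (S v)"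
proof -
  obtain u' where u': "u' \<in> VT" "lam (S u' perm4) \<noteq> 0"
    using intertwiner_eq_0[OF S(1) _ S(2)] S(3) by blast
  obtain a where a: "\<And>v. v \<in> VT \<Longrightarrow> lam (S' v perm4) = a * lam (S v perm4)"
    using T.triangular_functional_unique[OF intertwiner_triangular[OF S(1)] u' intertwiner_triangular[OF S']]
    by blast
  have in_V: "S v g \<in> VR" "S' v g \<in> VR" if "v \<in> VT" "g \<in> carrier (GL 4)" for v g
    using whittaker_V[OF intertwinerD(1)[OF S(1) that(1)] that(2)]
      whittaker_V[OF intertwinerD(1)[OF S' that(1)] that(2)] .
  have "S' v = rep_scale whittaker a (S v)" if v: "v \<in> VT" for v
  proof -
    have "(\<lambda>g. S' v g + scR (- a) (S v g)) = 0"
    proof (rule whittaker_eq_0[OF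
          whittaker_combination[OF intertwinerD(1)[OF S(1) v] intertwinerD(1)[OF S' v]]])
      fix d :: "'r mat" assume d: "d \<in> carrier (GL 2)"
      note dv = T.act_V[OF d v]
      note V = in_V[OF dv perm4_GL]
      have "lam (S' (rep_act \<tau> d v) perm4 + scR (- a) (S (rep_act \<tau> d v) perm4)) = 0"
        unfolding lam_add[OF V(2) \<rho>.sc_V[OF V(1)]] lam_scale[OF V(1)] a[OF dv] by simp
      then show "lam (S' v (perm4 * diag22 d) + scR (- a) (S v (perm4 * diag22 d))) = 0"
        unfolding intertwinerD(4)[OF S(1) v d perm4_GL] intertwinerD(4)[OF S' v d perm4_GL] .
    qed
    then show ?thesis unfolding rep_scale_whittaker fun_eq_iff by simp
  qed
  then show thesis by (rule that)
qed

text \<open>The double coset of \<open>perm4\<close> that supports the Whittaker space, with a chosen factorisation of its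
  element \<open>g\<close>. For the converse direction, a functional \<open>l\<close> on \<open>\<tau>\<close> has to be extended to this double
  coset by equivariance on both sides.\<close>

definition cell :: "'r mat \<Rightarrow> 'r mat \<Rightarrow> 'r mat \<Rightarrow> 'r \<Rightarrow> 'r mat \<Rightarrow> 'r mat \<Rightarrow> bool" where
  "cell g i Y m d X \<longleftrightarrow> i \<in> I3 \<and> Y \<in> carrier_mat 3 1 \<and> m dvd 1 \<and> d \<in> carrier (GL 2) \<and>
     X \<in> carrier_mat 2 2 \<and> g = block31 i Y m * (perm4 * (diag22 d * unip22 X))"

lemma cell_factors:
  assumes "cell g i Y m d X"
  shows "i \<in> carrier_mat 3 3" "d \<in> carrier_mat 2 2" "block31 i Y m \<in> carrier_mat 4 4"
    "diag22 d * unip22 X \<in> carrier_mat 4 4" "perm4 * (diag22 d * unip22 X) \<in> carrier_mat 4 4"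
    "g \<in> carrier_mat 4 4"
proof -
  show m: "i \<in> carrier_mat 3 3" "d \<in> carrier_mat 2 2"
    using assms by (auto simp: cell_def I3_mat GL_mat)
  show b: "block31 i Y m \<in> carrier_mat 4 4" using m by simp
  show du: "diag22 d * unip22 X \<in> carrier_mat 4 4" by (rule mult_carrier_mat[of _ 4 4]) (simp_all add: m)
  show pdu: "perm4 * (diag22 d * unip22 X) \<in> carrier_mat 4 4"
    by (rule mult_carrier_mat[OF perm4_carrier du])
  show "g \<in> carrier_mat 4 4" using assms mult_carrier_mat[OF b pdu] by (simp add: cell_def)
qed

lemma cell_left:
  assumes c: "cell g i Y m d X" and i0: "i0 \<in> I3" "Y0 \<in> carrier_mat 3 1" "m0 dvd 1"
  shows "cell (block31 i0 Y0 m0 * g) (i0 * i) (i0 * Y + m \<cdot>\<^sub>m Y0) (m0 * m) d X"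
proof -
  note f = cell_factors[OF c]
  have Y: "i \<in> I3" "Y \<in> carrier_mat 3 1" "m dvd 1" "d \<in> carrier (GL 2)" "X \<in> carrier_mat 2 2"
    and g: "g = block31 i Y m * (perm4 * (diag22 d * unip22 X))" using c by (auto simp: cell_def)
  have "block31 i0 Y0 m0 * g = block31 i0 Y0 m0 * block31 i Y m * (perm4 * (diag22 d * unip22 X))"
    unfolding g using f i0 by (intro assoc4[symmetric]) (auto simp: I3_mat)
  then show ?thesis
    unfolding cell_def block31_mult[OF I3_mat[OF i0(1)] f(1) i0(2) Y(2)]
    using mult_I3[OF i0(1) Y(1)] unit_mult[OF i0(3) Y(3)] i0 Y I3_mat[OF i0(1)]
    by (auto intro!: add_carrier_mat mult_carrier_mat[of _ 3 3])
qed

lemma cell_unip: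
  assumes c: "cell g i Y m d X" and X0: "X0 \<in> carrier_mat 2 2"
  shows "cell (g * unip22 X0) i Y m d (X + X0)"
proof -
  note f = cell_factors[OF c]
  have Y: "i \<in> I3" "Y \<in> carrier_mat 3 1" "m dvd 1" "d \<in> carrier (GL 2)" "X \<in> carrier_mat 2 2"
    and g: "g = block31 i Y m * (perm4 * (diag22 d * unip22 X))" using c by (auto simp: cell_def)
  have "g * unip22 X0 = block31 i Y m * (perm4 * (diag22 d * (unip22 X * unip22 X0)))"
    unfolding g using f by (simp add: assoc4)
  then show ?thesis using Y X0 by (simp add: cell_def unip22_mult)
qed

lemma cell_diag:
  assumes c: "cell g i Y m d X" and d0: "d0 \<in> carrier (GL 2)" "d1 \<in> carrier_mat 2 2" "d0 * d1 = 1\<^sub>m 2"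
  shows "cell (g * diag22 d0) i Y m (d * d0) (d1 * X * d0)"
proof -
  note f = cell_factors[OF c]
  have Y: "i \<in> I3" "Y \<in> carrier_mat 3 1" "m dvd 1" "d \<in> carrier (GL 2)" "X \<in> carrier_mat 2 2"
    and g: "g = block31 i Y m * (perm4 * (diag22 d * unip22 X))" using c by (auto simp: cell_def)
  have m0: "d0 \<in> carrier_mat 2 2" using d0 by (simp add: GL_mat)
  have "g * diag22 d0 = block31 i Y m * (perm4 * (diag22 d * (unip22 X * diag22 d0)))"
    unfolding g using f m0 by (simp add: assoc4)
  also have "diag22 d * (unip22 X * diag22 d0) = diag22 (d * d0) * unip22 (d1 * X * d0)"
    unfolding unip22_diag22_commute[OF d0(3) m0 d0(2) Y(5)] diag22_mult[OF f(2) m0, symmetric]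
    using f m0 by (simp add: assoc4)
  finally show ?thesis
    using Y GL_mult[OF Y(4) d0(1)] m0 d0(2)
    by (auto simp: cell_def intro!: mult_carrier_mat[of _ 2 2 _ 2])
qed

context
  fixes l
  assumes l: "T.triangular_functional trace_exponent l"
    and central_T: "\<And>z v. z dvd 1 \<Longrightarrow> v \<in> VT \<Longrightarrow>
      rep_act \<tau> (z \<cdot>\<^sub>m 1\<^sub>m 2) v = rep_scale \<tau> (central z) v"
begin

lemma l_linear: "linear_functional \<tau> l"
  using l by (simp add: T.triangular_functional_def)

lemma l_scale: "v \<in> VT \<Longrightarrow> l (rep_scale \<tau> c v) = c * l v"
  using l_linear by (simp add: linear_functional_def)

lemma l_add: "v \<in> VT \<Longrightarrow> w \<in> VT \<Longrightarrow> l (v + w) = l v + l w"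
  using l_linear by (simp add: linear_functional_def)

text \<open>The stabilizer of \<open>perm4\<close> under both groups: as the centralizer contains only scalar
  triangular matrices modulo the uniformizer, everything is a scalar times an element of the
  congruence subgroups, and the two characters are compared coordinate by coordinate.\<close>

lemma stabilizer_value:
  assumes i: "i \<in> I3" and m: "m dvd 1" and d: "d \<in> carrier (GL 2)" and X: "X \<in> carrier_mat 2 2"
    and u: "u \<in> VT" and eq: "block31 i Y m * perm4 = perm4 * (diag22 d * unip22 X)"
  shows "\<chi> m * \<phi> i * l u = \<psi> (mat_trace X) * l (rep_act \<tau> d u)"
proof -
  obtain a b x y where i3: "i = mat3 a (a * x) (a * y) 0 a b 0 0 m" and d2: "d = mat2 a b 0 m"
    and X2: "X = mat2 x y 0 0"
    using block31_perm4_converse[OF I3_mat[OF i] m GL_mat[OF d] X eq] .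
  have "redm i * C3 = C3 * redm i" using i by (simp add: centralizer3_def)
  then have "mat3 (red a) (red a * red x) (red a * red y) 0 (red a) (red b) 0 0 (red m) * C3 =
      C3 * mat3 (red a) (red a * red x) (red a * red y) 0 (red a) (red b) 0 0 (red m)"
    by (simp add: i3 red_mult red_0)
  from companion3_commutant_triangular[OF this]
  have r: "red a * red x = 0" "red a * red y = 0" "red b = 0" "red m = red a" by auto
  have ra: "red a \<noteq> 0" using m r by (simp add: unit_iff)
  then have ua: "a dvd 1" by (simp add: unit_iff)
  obtain x' where x': "x = eps x'" using r ra red_eq_0E by auto
  obtain y' where y': "y = eps y'" using r ra red_eq_0E by auto
  obtain b0 where b0: "b = eps b0" using r red_eq_0E by auto
  obtain m0 where m0: "m = a + eps m0" using r red_eqE by metis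
  define b' where "b' = b0 / red a"
  define m' where "m' = m0 / red a"
  have b: "b = a * eps b'" using ra by (simp add: b0 b'_def mult_eps)
  have m_eq: "m = a * (1 + eps m')" using ra by (simp add: m0 m'_def mult_eps distrib_left)
  define M where "M = mat3 0 x' y' 0 0 b' 0 0 m'"
  have M: "M \<in> carrier_mat 3 3" by (simp add: M_def)
  have "i = (a \<cdot>\<^sub>m 1\<^sub>m 3) * congr M"
    unfolding i3 b m_eq
    by (simp add: congr_def M_def mat3_one mat3_add mat3_smult mat3_mult x' y')
  then have "\<phi> i = \<phi> (a \<cdot>\<^sub>m 1\<^sub>m 3) * e (mat_trace (C3 * M))"
    using phi_mult[OF scalar_I3[OF ua] congr_I3[OF M]] phi_congr3[OF M] by simp
  also have "mat_trace (C3 * M) = x' + b' + t * m'"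
    by (simp add: companion3_def M_def mat3_mult)
  finally have phi: "\<phi> i = \<phi> (a \<cdot>\<^sub>m 1\<^sub>m 3) * e (x' + b' + t * m')" .
  have chi: "\<chi> m = \<chi> a * e (chi_exponent * m')"
    unfolding m_eq using chi_mult[OF ua unit_eps] by (simp add: chi_eps)
  have "d = (a \<cdot>\<^sub>m 1\<^sub>m 2) * congr (mat2 0 b' 0 m')"
    unfolding d2 b m_eq by (simp add: congr_def mat2_one mat2_add mat2_smult mat2_mult)
  then have "rep_act \<tau> d u = rep_scale \<tau> (central a) (rep_act \<tau> (congr (mat2 0 b' 0 m')) u)"
    using T.act_mult_GL[OF GL_scalar[OF ua] congr_GL[OF mat2_carrier] u]
      central_T[OF ua T.act_V[OF congr_GL[OF mat2_carrier] u]] by simp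
  then have "l (rep_act \<tau> d u) = central a * (e (b' + trace_exponent * m') * l u)"
    using l u by (simp add: l_scale congr_GL T.triangular_functional_def)
  moreover have "\<psi> (mat_trace X) = e x'" by (simp add: X2 x' e_def)
  ultimately show ?thesis
    by (simp add: phi chi central_def trace_exponent_def e_add distrib_right)
qed

definition cell_value :: "'w \<Rightarrow> 'r mat \<Rightarrow> 'r \<Rightarrow> 'r mat \<Rightarrow> 'r mat \<Rightarrow> complex" where
  "cell_value v i m d X = \<chi> m * \<phi> i * \<psi> (mat_trace X) * l (rep_act \<tau> d v)"

text \<open>Two factorisations of the same element differ by an element of the stabilizer of \<open>perm4\<close>, so
  \<open>stabilizer_value\<close> applies.\<close>

lemma cell_value_unique:
  assumes c: "cell g i Y m d X" and c': "cell g i' Y' m' d' X'" and v: "v \<in> VT"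
  shows "cell_value v i m d X = cell_value v i' m' d' X'"
proof -
  have Y: "i \<in> I3" "Y \<in> carrier_mat 3 1" "m dvd 1" "d \<in> carrier (GL 2)" "X \<in> carrier_mat 2 2"
    using c by (auto simp: cell_def)
  have Y': "i' \<in> I3" "Y' \<in> carrier_mat 3 1" "m' dvd 1" "d' \<in> carrier (GL 2)" "X' \<in> carrier_mat 2 2"
    using c' by (auto simp: cell_def)
  obtain i1 Y1 m1 where J: "i1 \<in> carrier (GL 3)" "Y1 \<in> carrier_mat 3 1" "m1 dvd 1" "i1 * i' = 1\<^sub>m 3"
    "i' * i1 = 1\<^sub>m 3" "m1 * m' = 1" "block31 i1 Y1 m1 * block31 i' Y' m' = 1\<^sub>m 4"
    using block31_GL[OF I3_GL[OF Y'(1)] Y'(2,3)] by metis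
  have i1: "i1 \<in> I3" by (rule inverse_I3[OF Y'(1) J(1,5,4)])
  obtain k where k: "k \<in> carrier (GL 2)" "d \<in> carrier_mat 2 2" "k \<in> carrier_mat 2 2" "d * k = 1\<^sub>m 2" "k * d = 1\<^sub>m 2"
    using Y(4) by (rule GL_cases)
  have mX: "- X \<in> carrier_mat 2 2" using Y by simp
  have C1: "cell (block31 i1 Y1 m1 * g) (i1 * i) (i1 * Y + m \<cdot>\<^sub>m Y1) (m1 * m) d X"
    by (rule cell_left[OF c i1 J(2,3)])
  note C2 = cell_diag[OF cell_unip[OF C1 mX] k(1,2,5)]
  have XX: "X + - X = 0\<^sub>m 2 2" using comm_add_mat[OF Y(5) mX] uminus_l_inv_mat[OF Y(5)] by simp
  have C2': "cell (block31 i1 Y1 m1 * g * unip22 (- X) * diag22 k) (i1 * i) (i1 * Y + m \<cdot>\<^sub>m Y1) (m1 * m) (1\<^sub>m 2) (0\<^sub>m 2 2)"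
    using C2 k by (simp add: XX)
  note D1 = cell_diag[OF cell_unip[OF cell_left[OF c' i1 J(2,3)] mX] k(1,2,5)]
  define d2 where "d2 = d' * k"
  define X2 where "X2 = d * (X' + - X) * k"
  have d2: "d2 \<in> carrier (GL 2)" unfolding d2_def by (rule GL_mult[OF Y'(4) k(1)])
  have X2: "X2 \<in> carrier_mat 2 2"
    unfolding X2_def using k Y Y' by (intro mult_carrier_mat[of _ 2 2 _ 2]) auto
  have 1: "block31 i1 Y1 m1 * g = perm4 * (diag22 d' * unip22 X')"
  proof -
    have "g = block31 i' Y' m' * (perm4 * (diag22 d' * unip22 X'))" using c' by (simp add: cell_def)
    then show ?thesis
      using GL_cancel[OF J(7) _ _ cell_factors(5)[OF c']] cell_factors[OF c'] J(1) by (simp add: GL_mat)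
  qed
  have 2: "block31 i1 Y1 m1 * g * unip22 (- X) * diag22 k = perm4 * (diag22 d2 * unip22 X2)"
  proof -
    have mm: "d' \<in> carrier_mat 2 2" using Y' by (simp add: GL_mat)
    have "block31 i1 Y1 m1 * g * unip22 (- X) = perm4 * (diag22 d' * (unip22 X' * unip22 (- X)))"
      unfolding 1 using cell_factors[OF c'] mm by (simp add: assoc4)
    then have "block31 i1 Y1 m1 * g * unip22 (- X) * diag22 k
        = perm4 * (diag22 d' * unip22 (X' + - X)) * diag22 k"
      by (simp only: unip22_mult[OF Y'(5) mX])
    also have "\<dots> = perm4 * (diag22 d' * (unip22 (X' + - X) * diag22 k))"
      using k mm mult_carrier_mat[OF diag22_carrier[OF mm] unip22_carrier]
      by (simp add: assoc4)
    also have "unip22 (X' + - X) * diag22 k = diag22 k * unip22 X2"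
      unfolding X2_def
      by (rule unip22_diag22_commute[OF k(5,3,2)]) (use Y Y' in simp)
    also have "diag22 d' * (diag22 k * unip22 X2) = diag22 d2 * unip22 X2"
      unfolding d2_def diag22_mult[OF mm k(3), symmetric]
      using mm k by (simp add: assoc4)
    finally show ?thesis .
  qed
  have "block31 (i1 * i) (i1 * Y + m \<cdot>\<^sub>m Y1) (m1 * m) * perm4 = perm4 * (diag22 d2 * unip22 X2)"
    using C2' right_mult_one_mat[OF perm4_carrier[where 'a = 'r]] unfolding 2 by (simp add: cell_def)
  from stabilizer_value[OF mult_I3[OF i1 Y(1)] unit_mult[OF J(3) Y(3)] d2 X2 T.act_V[OF Y(4) v] this]
  have "\<chi> (m1 * m) * \<phi> (i1 * i) * l (rep_act \<tau> d v) = \<psi> (mat_trace X2) * l (rep_act \<tau> d2 (rep_act \<tau> d v))" .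
  also have "rep_act \<tau> d2 (rep_act \<tau> d v) = rep_act \<tau> d' v"
    using T.act_mult_GL[OF d2 Y(4) v] GL_cancel'[OF k(5,3,2) GL_mat[OF Y'(4)]]
    by (simp add: d2_def)
  also have "mat_trace X2 = mat_trace (X' + - X)"
    unfolding X2_def by (rule trace_conj2[OF k(5,3,2)]) (use Y Y' in simp)
  finally have main: "\<chi> m1 * \<chi> m * (\<phi> i1 * \<phi> i) * l (rep_act \<tau> d v) =
      \<psi> (mat_trace (X' + - X)) * l (rep_act \<tau> d' v)"
    by (simp add: chi_mult[OF J(3) Y(3)] phi_mult[OF i1 Y(1)])
  have "\<chi> m' * \<chi> m1 = 1" using chi_mult[OF Y'(3) J(3)] J(6) by (simp add: mult.commute)
  moreover have "\<phi> i' * \<phi> i1 = 1" using phi_mult[OF Y'(1) i1] J(5) phi_1 by simp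
  moreover have "\<psi> (mat_trace X) * \<psi> (mat_trace (X' + - X)) = \<psi> (mat_trace X')"
  proof -
    have "X + (X' + - X) = X'" using Y Y' by (intro eq_matI) auto
    then show ?thesis
      using mat_trace_add[of X 2 "X' + - X"] Y Y' by (simp add: psi_add[symmetric])
  qed
  ultimately have "cell_value v i m d X =
      (\<chi> m' * \<chi> m1) * (\<phi> i' * \<phi> i1) * \<psi> (mat_trace X) * (\<chi> m * \<phi> i * l (rep_act \<tau> d v))"
    by (simp add: cell_value_def)
  also have "\<dots> = \<chi> m' * \<phi> i' * \<psi> (mat_trace X) * (\<chi> m1 * \<chi> m * (\<phi> i1 * \<phi> i) * l (rep_act \<tau> d v))"
    by (simp add: ac_simps)
  also have "\<dots> = \<chi> m' * \<phi> i' * (\<psi> (mat_trace X) * \<psi> (mat_trace (X' + - X))) * l (rep_act \<tau> d' v)"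
    unfolding main by (simp add: ac_simps)
  also have "\<dots> = cell_value v i' m' d' X'"
    unfolding \<open>\<psi> (mat_trace X) * _ = _\<close> by (simp add: cell_value_def)
  finally show ?thesis .
qed

text \<open>The choice of the factorisation is immaterial by \<open>cell_value_unique\<close>.\<close>

definition coefficient :: "'w \<Rightarrow> 'r mat \<Rightarrow> complex" where
  "coefficient v g = (if \<exists>i Y m d X. cell g i Y m d X
     then let (i, Y, m, d, X) = (SOME (i, Y, m, d, X). cell g i Y m d X) in cell_value v i m d X
     else 0)"

lemma coefficient_cell:
  assumes c: "cell g i Y m d X" and v: "v \<in> VT"
  shows "coefficient v g = cell_value v i m d X"
proof -
  obtain i' Y' m' d' X' where eq: "(SOME (i, Y, m, d, X). cell g i Y m d X) = (i', Y', m', d', X')"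
    by (metis prod_cases5)
  have "case (SOME (i, Y, m, d, X). cell g i Y m d X) of (i, Y, m, d, X) \<Rightarrow> cell g i Y m d X"
    by (rule someI[of _ "(i, Y, m, d, X)"]) (simp add: c)
  then have c': "cell g i' Y' m' d' X'" by (simp add: eq)
  have "coefficient v g = cell_value v i' m' d' X'"
    unfolding coefficient_def eq using c by auto
  also have "\<dots> = cell_value v i m d X" by (rule cell_value_unique[OF c' c v])
  finally show ?thesis .
qed

lemma coefficient_no_cell: "\<nexists>i Y m d X. cell g i Y m d X \<Longrightarrow> coefficient v g = 0"
  by (auto simp: coefficient_def)

lemma coefficient_left:
  assumes i0: "i0 \<in> I3" "Y0 \<in> carrier_mat 3 1" "m0 dvd 1" and g: "g \<in> carrier (GL 4)" and v: "v \<in> VT"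
  shows "coefficient v (block31 i0 Y0 m0 * g) = \<chi> m0 * \<phi> i0 * coefficient v g"
proof (cases "\<exists>i Y m d X. cell g i Y m d X")
  case True
  then obtain i Y m d X where c: "cell g i Y m d X" by blast
  then have "i \<in> I3" "m dvd 1" by (auto simp: cell_def)
  then show ?thesis
    using coefficient_cell[OF c v] coefficient_cell[OF cell_left[OF c i0] v] i0
    by (simp add: cell_value_def chi_mult phi_mult ac_simps)
next
  case False
  obtain i1 Y1 m1 where J: "i1 \<in> carrier (GL 3)" "Y1 \<in> carrier_mat 3 1" "m1 dvd 1" "i1 * i0 = 1\<^sub>m 3"
    "i0 * i1 = 1\<^sub>m 3" "block31 i1 Y1 m1 * block31 i0 Y0 m0 = 1\<^sub>m 4"
    using block31_GL[OF I3_GL[OF i0(1)] i0(2,3)] by metis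
  have i1: "i1 \<in> I3" by (rule inverse_I3[OF i0(1) J(1,5,4)])
  have eq: "block31 i1 Y1 m1 * (block31 i0 Y0 m0 * g) = g"
    by (rule GL_cancel[OF J(6)]) (use GL_mat[OF g] I3_mat[OF i1] I3_mat[OF i0(1)] in auto)
  have "\<nexists>i Y m d X. cell (block31 i0 Y0 m0 * g) i Y m d X"
    using cell_left[OF _ i1 J(2,3), of "block31 i0 Y0 m0 * g", unfolded eq] False by blast
  then show ?thesis using False by (simp add: coefficient_no_cell)
qed

lemma coefficient_unip:
  assumes X0: "X0 \<in> carrier_mat 2 2" and g: "g \<in> carrier (GL 4)" and v: "v \<in> VT"
  shows "coefficient v (g * unip22 X0) = \<psi> (mat_trace X0) * coefficient v g"
proof (cases "\<exists>i Y m d X. cell g i Y m d X")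
  case True
  then obtain i Y m d X where c: "cell g i Y m d X" by blast
  then have "X \<in> carrier_mat 2 2" by (auto simp: cell_def)
  then show ?thesis
    using coefficient_cell[OF c v] coefficient_cell[OF cell_unip[OF c X0] v] X0
    by (simp add: cell_value_def mat_trace_add[of _ 2] psi_add)
next
  case False
  have mX: "- X0 \<in> carrier_mat 2 2" using X0 by simp
  have XX: "X0 + - X0 = 0\<^sub>m 2 2" using comm_add_mat[OF X0 mX] uminus_l_inv_mat[OF X0] by simp
  have "g * unip22 X0 * unip22 (- X0) = g * (unip22 X0 * unip22 (- X0))"
    using GL_mat[OF g] by (intro assoc4) auto
  then have eq: "g * unip22 X0 * unip22 (- X0) = g"
    unfolding unip22_mult[OF X0 mX] XX using right_mult_one_mat[OF GL_mat[OF g]] by simp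
  have "\<nexists>i Y m d X. cell (g * unip22 X0) i Y m d X"
    using cell_unip[OF _ mX, of "g * unip22 X0", unfolded eq] False by blast
  then show ?thesis using False by (simp add: coefficient_no_cell)
qed

lemma coefficient_diag:
  assumes d0: "d0 \<in> carrier (GL 2)" and g: "g \<in> carrier (GL 4)" and v: "v \<in> VT"
  shows "coefficient v (g * diag22 d0) = coefficient (rep_act \<tau> d0 v) g"
proof -
  obtain d1 where d1: "d1 \<in> carrier (GL 2)" "d0 \<in> carrier_mat 2 2" "d1 \<in> carrier_mat 2 2"
    "d0 * d1 = 1\<^sub>m 2" "d1 * d0 = 1\<^sub>m 2" using d0 by (rule GL_cases)
  show ?thesis
  proof (cases "\<exists>i Y m d X. cell g i Y m d X")
    case True
    then obtain i Y m d X where c: "cell g i Y m d X" by blast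
    then have "X \<in> carrier_mat 2 2" "d \<in> carrier (GL 2)" by (auto simp: cell_def)
    then show ?thesis
      using coefficient_cell[OF c T.act_V[OF d0 v]] coefficient_cell[OF cell_diag[OF c d0 d1(3,4)] v]
        trace_conj2[OF d1(4,2,3)] T.act_mult_GL[OF _ d0 v]
      by (simp add: cell_value_def)
  next
    case False
    have "g * diag22 d0 * diag22 d1 = g * (diag22 d0 * diag22 d1)"
      using GL_mat[OF g] d1 by (intro assoc4) auto
    then have eq: "g * diag22 d0 * diag22 d1 = g"
      unfolding diag22_mult[OF d1(2,3)] d1(4) using right_mult_one_mat[OF GL_mat[OF g]] by simp
    have "\<nexists>i Y m d X. cell (g * diag22 d0) i Y m d X"
      using cell_diag[OF _ d1(1,2,5), of "g * diag22 d0", unfolded eq] False by blast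
    then show ?thesis using False by (simp add: coefficient_no_cell)
  qed
qed

lemma coefficient_add:
  assumes "v \<in> VT" "w \<in> VT"
  shows "coefficient (v + w) g = coefficient v g + coefficient w g"
proof (cases "\<exists>i Y m d X. cell g i Y m d X")
  case True
  then obtain i Y m d X where c: "cell g i Y m d X" by blast
  then have "d \<in> carrier (GL 2)" by (auto simp: cell_def)
  then show ?thesis
    using coefficient_cell[OF c] assms
    by (simp add: cell_value_def T.act_add l_add distrib_left)
qed (simp add: coefficient_no_cell)

lemma coefficient_scale:
  assumes "v \<in> VT"
  shows "coefficient (rep_scale \<tau> a v) g = a * coefficient v g"
proof (cases "\<exists>i Y m d X. cell g i Y m d X")
  case True
  then obtain i Y m d X where c: "cell g i Y m d X" by blast
  then have "d \<in> carrier (GL 2)" by (auto simp: cell_def)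
  then show ?thesis
    using coefficient_cell[OF c] assms by (simp add: cell_value_def T.act_sc l_scale)
qed (simp add: coefficient_no_cell)

abbreviation emb3 :: "'r mat \<Rightarrow> 'r mat" where "emb3 h \<equiv> block31 h (0\<^sub>m 3 1) 1"

lemma emb3_GL: "h \<in> carrier (GL 3) \<Longrightarrow> emb3 h \<in> carrier (GL 4)"
  by (rule block31_in_GL) auto

text \<open>The intertwiner constructed from \<open>l\<close>: its values are vectors of \<open>\<rho>\<close>, recovered from their
  matrix coefficients against \<open>lam\<close>.\<close>

definition realization :: "'w \<Rightarrow> 'r mat \<Rightarrow> 'v" where
  "realization v g = (if g \<in> carrier (GL 4)
     then SOME x. x \<in> VR \<and> (\<forall>h \<in> carrier (GL 3). lam (actR h x) = coefficient v (emb3 h * g)) else 0)"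

lemma realization:
  assumes v: "v \<in> VT" and g: "g \<in> carrier (GL 4)"
  shows "realization v g \<in> VR"
    and "h \<in> carrier (GL 3) \<Longrightarrow> lam (actR h (realization v g)) = coefficient v (emb3 h * g)"
proof -
  have "\<exists>x \<in> VR. \<forall>h \<in> carrier (GL 3). lam (actR h x) = coefficient v (emb3 h * g)"
  proof (rule lam_surj)
    fix i h :: "'r mat" assume i: "i \<in> I3" and h: "h \<in> carrier (GL 3)"
    have "emb3 (i * h) = emb3 i * emb3 h"
      using block31_mult[OF I3_mat[OF i] GL_mat[OF h], of "0\<^sub>m 3 1" "0\<^sub>m 3 1" 1 1] I3_mat[OF i]
      by (simp add: right_mult_zero_mat[of _ 3 3])
    then have "emb3 (i * h) * g = emb3 i * (emb3 h * g)"
      using I3_mat[OF i] GL_mat[OF h] GL_mat[OF g] by (simp add: assoc4)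
    then show "coefficient v (emb3 (i * h) * g) = \<phi> i * coefficient v (emb3 h * g)"
      using coefficient_left[OF i _ _ GL_mult[OF emb3_GL[OF h] g] v, of "0\<^sub>m 3 1" 1] by simp
  qed
  then have "\<exists>x. x \<in> VR \<and> (\<forall>h \<in> carrier (GL 3). lam (actR h x) = coefficient v (emb3 h * g))" by blast
  from someI_ex[OF this]
  show "realization v g \<in> VR"
    and "h \<in> carrier (GL 3) \<Longrightarrow> lam (actR h (realization v g)) = coefficient v (emb3 h * g)"
    using g by (simp_all add: realization_def)
qed

lemma realization_eqI:
  assumes "v \<in> VT" "g \<in> carrier (GL 4)" "x \<in> VR"
    and "\<And>h. h \<in> carrier (GL 3) \<Longrightarrow> coefficient v (emb3 h * g) = lam (actR h x)"
  shows "realization v g = x"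
  by (rule lam_eqI) (use assms realization[OF assms(1,2)] in simp_all)

lemma realization_whittaker:
  assumes v: "v \<in> VT"
  shows "realization v \<in> rep_space whittaker"
  unfolding whittaker_space_iff induced_space_iff
proof (intro conjI allI impI ballI)
  fix g :: "'r mat" assume g: "g \<in> carrier (GL 4)"
  show "realization v g \<in> VR" by (rule realization(1)[OF v g])
  note V = this
  fix X :: "'r mat" assume X: "X \<in> carrier_mat 2 2"
  show "realization v (g * unip22 X) = scR (\<psi> (mat_trace X)) (realization v g)"
  proof (rule realization_eqI[OF v GL_mult[OF g unip22_GL[OF X]] \<rho>.sc_V[OF V]])
    fix h :: "'r mat" assume h: "h \<in> carrier (GL 3)"
    have "emb3 h * (g * unip22 X) = emb3 h * g * unip22 X"
      using GL_mat[OF g] GL_mat[OF h] by (intro assoc4[symmetric]) auto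
    then show "coefficient v (emb3 h * (g * unip22 X)) =
        lam (actR h (scR (\<psi> (mat_trace X)) (realization v g)))"
      using coefficient_unip[OF X GL_mult[OF emb3_GL[OF h] g] v] realization(2)[OF v g h] h V
      by (simp add: \<rho>.act_sc lam_scale)
  qed
next
  fix g :: "'r mat" assume "g \<notin> carrier (GL 4)"
  then show "realization v g = 0" by (simp add: realization_def)
next
  fix h Y g :: "'r mat" and m :: 'r
  assume h: "h \<in> carrier (GL 3)" and Y: "Y \<in> carrier_mat 3 1" and m: "m dvd 1" and g: "g \<in> carrier (GL 4)"
  have V: "realization v g \<in> VR" by (rule realization(1)[OF v g])
  show "realization v (block31 h Y m * g) = scR (\<chi> m) (actR h (realization v g))"
  proof (rule realization_eqI[OF v GL_mult[OF block31_in_GL[OF h Y m] g] \<rho>.sc_V[OF \<rho>.act_V[OF h V]]])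
    fix h' :: "'r mat" assume h': "h' \<in> carrier (GL 3)"
    note hm = GL_mat[OF h] GL_mat[OF h']
    have hh: "h' * h \<in> carrier_mat 3 3" by (rule mult_carrier_mat[OF hm(2,1)])
    have "h' * Y + m \<cdot>\<^sub>m 0\<^sub>m 3 1 = 1\<^sub>m 3 * 0\<^sub>m 3 1 + 1 \<cdot>\<^sub>m (h' * Y)"
      using hm Y by (intro eq_matI) (auto simp: scalar_prod_def)
    then have "emb3 h' * block31 h Y m = block31 (1\<^sub>m 3) (h' * Y) m * emb3 (h' * h)"
      using block31_mult[OF hm(2,1), of "0\<^sub>m 3 1" Y 1 m] Y
        block31_mult[of "1\<^sub>m 3" "h' * h" "h' * Y" "0\<^sub>m 3 1" m 1] hm hh left_mult_one_mat[OF hh]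
        mult_carrier_mat[OF hm(2) Y]
      by simp
    then have "emb3 h' * (block31 h Y m * g) = block31 (1\<^sub>m 3) (h' * Y) m * (emb3 (h' * h) * g)"
      using hm hh GL_mat[OF g]
        assoc_mult_mat[of "emb3 h'" 4 4 "block31 h Y m" 4 g 4]
        assoc_mult_mat[of "block31 (1\<^sub>m 3) (h' * Y) m" 4 4 "emb3 (h' * h)" 4 g 4]
      by simp
    then have "coefficient v (emb3 h' * (block31 h Y m * g)) = \<chi> m * coefficient v (emb3 (h' * h) * g)"
      using coefficient_left[OF one_I3 mult_carrier_mat[OF hm(2) Y] m
          GL_mult[OF emb3_GL[OF GL_mult[OF h' h]] g] v] by (simp add: phi_1)
    also have "\<dots> = \<chi> m * lam (actR (h' * h) (realization v g))"
      using realization(2)[OF v g GL_mult[OF h' h]] by simp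
    also have "\<dots> = lam (actR h' (scR (\<chi> m) (actR h (realization v g))))"
      using h h' V by (simp add: act_mult_R \<rho>.act_sc lam_scale)
    finally show "coefficient v (emb3 h' * (block31 h Y m * g)) =
        lam (actR h' (scR (\<chi> m) (actR h (realization v g))))" .
  qed
qed

lemma realization_intertwiner: "intertwiner (GL 2) \<tau> whittaker realization"
  unfolding intertwiner_def
proof (intro conjI ballI allI)
  show "realization ` VT \<subseteq> rep_space whittaker" using realization_whittaker by blast
next
  fix v w assume v: "v \<in> VT" "w \<in> VT"
  show "realization (v + w) = realization v + realization w"
  proof
    fix g :: "'r mat"
    show "realization (v + w) g = (realization v + realization w) g"
    proof (cases "g \<in> carrier (GL 4)")
      case True
      note V = realization(1)[OF v(1) True] realization(1)[OF v(2) True]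
      have "realization (v + w) g = realization v g + realization w g"
        using v V True
        by (intro realization_eqI) (simp_all add: coefficient_add realization(2) \<rho>.act_add lam_add)
      then show ?thesis by simp
    qed (simp add: realization_def)
  qed
next
  fix c v assume v: "v \<in> VT"
  show "realization (rep_scale \<tau> c v) = rep_scale whittaker c (realization v)"
  proof
    fix g :: "'r mat"
    show "realization (rep_scale \<tau> c v) g = rep_scale whittaker c (realization v) g"
    proof (cases "g \<in> carrier (GL 4)")
      case True
      note V = realization(1)[OF v True]
      have "realization (rep_scale \<tau> c v) g = scR c (realization v g)"
        using v V True
        by (intro realization_eqI) (simp_all add: coefficient_scale realization(2) \<rho>.act_sc lam_scale)
      then show ?thesis by (simp add: rep_scale_whittaker)
    qed (simp add: realization_def rep_scale_whittaker)
  qed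
next
  fix d :: "'r mat" and v assume d: "d \<in> carrier (GL 2)" and v: "v \<in> VT"
  show "realization (rep_act \<tau> d v) = rep_act whittaker d (realization v)"
  proof
    fix g :: "'r mat"
    show "realization (rep_act \<tau> d v) g = rep_act whittaker d (realization v) g"
    proof (cases "g \<in> carrier (GL 4)")
      case True
      note gd = GL_mult[OF True diag22_GL[OF d]]
      have "realization (rep_act \<tau> d v) g = realization v (g * diag22 d)"
      proof (rule realization_eqI[OF T.act_V[OF d v] True realization(1)[OF v gd]])
        fix h :: "'r mat" assume h: "h \<in> carrier (GL 3)"
        have "emb3 h * (g * diag22 d) = emb3 h * g * diag22 d"
          using GL_mat[OF True] GL_mat[OF h] GL_mat[OF d]
          by (intro assoc4[symmetric]) auto
        then show "coefficient (rep_act \<tau> d v) (emb3 h * g) = lam (actR h (realization v (g * diag22 d)))"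
          using coefficient_diag[OF d GL_mult[OF emb3_GL[OF h] True] v] realization(2)[OF v gd h] by simp
      qed
      then show ?thesis using True by (simp add: rep_act_whittaker)
    qed (simp add: realization_def rep_act_whittaker)
  qed
qed

lemma lam_realization:
  assumes v: "v \<in> VT"
  shows "lam (realization v perm4) = l v"
proof -
  have r: "perm4 * 1\<^sub>m 4 = (perm4 :: 'r mat)" "1\<^sub>m 4 * perm4 = (perm4 :: 'r mat)" "1\<^sub>m 4 * 1\<^sub>m 4 = (1\<^sub>m 4 :: 'r mat)"
    using right_mult_one_mat[OF perm4_carrier] left_mult_one_mat[OF perm4_carrier] by auto
  have "cell perm4 (1\<^sub>m 3) (0\<^sub>m 3 1) 1 (1\<^sub>m 2) (0\<^sub>m 2 2)"
    unfolding cell_def block31_1 diag22_1 unip22_0 r using one_I3 GL_one by auto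
  from coefficient_cell[OF this v] have "coefficient v perm4 = l v"
    using T.act_one_GL[OF v] by (simp add: cell_value_def phi_1 mat_trace_def)
  then show ?thesis
    using realization(2)[OF v perm4_GL GL_one] act_one_R[OF realization(1)[OF v perm4_GL]]
    by (simp only: block31_1 r)
qed

end

end

context whittaker_irreducible
begin

lemma central_eps: "central (1 + eps a) = e (trace_exponent * a)"
proof -
  define M where "M = mat3 a 0 0 0 a 0 0 0 a"
  have M: "M \<in> carrier_mat 3 3" by (simp add: M_def)
  have "(1 + eps a) \<cdot>\<^sub>m 1\<^sub>m 3 = congr M"
    by (simp add: congr_def M_def mat3_one mat3_add mat3_smult)
  then have "\<phi> ((1 + eps a) \<cdot>\<^sub>m 1\<^sub>m 3) = e (t * a)"
    using phi_congr3[OF M] by (simp add: M_def companion3_def mat3_mult)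
  then show ?thesis
    by (simp add: central_def chi_eps trace_exponent_def distrib_left e_add mult.commute)
qed

lemma vector_space_whittaker: "vector_space (rep_scale whittaker)"
  by unfold_locales
    (simp_all add: rep_scale_whittaker fun_eq_iff \<rho>.vs.scale_right_distrib \<rho>.vs.scale_left_distrib)

lemma intertwiner_injective:
  assumes S: "intertwiner (GL 2) \<tau> whittaker S" and u: "u \<in> VT" "S u \<noteq> 0"
  shows "inj_on S VT"
proof -
  interpret W: vector_space "rep_scale whittaker" by (rule vector_space_whittaker)
  note S_scale = intertwiner_scale[OF S] and S_act = intertwiner_act[OF S]
  have S_0: "S 0 = 0" using S_scale[of 0 0] by simp
  define K where "K = {v \<in> VT. S v = 0}"
  have "invariant_subspace (GL 2) \<tau> K"
    unfolding invariant_subspace_def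
  proof (intro conjI ballI)
    show "T.vs.subspace K"
      by (auto simp: T.vs.subspace_def K_def S_0 intertwinerD(2)[OF S] S_scale)
    show "rep_act \<tau> d v \<in> K" if "d \<in> carrier (GL 2)" "v \<in> K" for d v
      using that by (auto simp: K_def S_act rep_act_whittaker)
  qed (auto simp: K_def)
  moreover have "K \<noteq> VT" using u by (auto simp: K_def)
  ultimately have K: "K = {0}" using T.irreducible by (auto simp: irreducible_rep_def)
  show ?thesis
  proof (rule inj_onI)
    fix v w assume v: "v \<in> VT" and w: "w \<in> VT" and eq: "S v = S w"
    define w' where "w' = rep_scale \<tau> (- 1) w"
    have w': "w' \<in> VT" using T.sc_V[OF w] by (simp only: w'_def)
    have "S (v + w') = S w + rep_scale whittaker (- 1) (S w)"
      unfolding intertwinerD(2)[OF S v w'] eq unfolding w'_def S_scale[OF w] ..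
    then have "v + w' \<in> K" using v w' by (simp add: K_def)
    then have "v + w' = 0" by (simp add: K)
    then show "v = w" by (simp add: w'_def)
  qed
qed

text \<open>An embedding of \<open>\<tau>\<close> gives a nonzero triangular functional, which makes \<open>\<tau>\<close> regular; conversely a
  regular \<open>\<tau>\<close> carries such a functional, and its realization is injective as \<open>\<tau>\<close> is
  irreducible.\<close>

lemma occurs_iff_regular:
  "occurs_in (GL 2) \<tau> whittaker \<longleftrightarrow>
    regular_rep \<omega> red \<psi> 2 \<tau> \<and> has_central_character 2 \<tau> central"
proof
  assume "occurs_in (GL 2) \<tau> whittaker"
  then obtain W S where W: "invariant_subspace (GL 2) whittaker W"
    and S0: "intertwiner (GL 2) \<tau> (subrep whittaker W) S" and bij: "bij_betw S VT W"
    by (auto simp: occurs_in_def equivalent_reps_def subrep_def)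
  interpret W: vector_space "rep_scale whittaker" by (rule vector_space_whittaker)
  have S: "intertwiner (GL 2) \<tau> whittaker S"
    using S0 W by (auto simp: intertwiner_def subrep_def invariant_subspace_def)
  note S_scale = intertwiner_scale[OF S] and S_act = intertwiner_act[OF S]
  have inj: "v = w" if "v \<in> VT" "w \<in> VT" "S v = S w" for v w
    using bij that by (auto simp: bij_betw_def inj_on_def)
  have S_0: "S 0 = 0" using S_scale[of 0 0] by simp
  obtain v where v: "v \<in> VT" "v \<noteq> 0" using T.irreducible T.zero_V by (auto simp: irreducible_rep_def)
  then have "S v \<noteq> 0" using inj[OF v(1) T.zero_V] S_0 by auto
  then obtain u where u: "u \<in> VT" "lam (S u perm4) \<noteq> 0"
    using intertwiner_eq_0[OF S _ v(1)] by blast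
  have "regular_rep \<omega> red \<psi> 2 \<tau>"
    by (rule T.triangular_functional_regular[OF intertwiner_triangular[OF S] u])
  moreover have "has_central_character 2 \<tau> central"
    unfolding has_central_character_def
  proof (intro conjI ballI)
    fix z :: 'r and v assume z: "z \<in> carrier unit_group" and v: "v \<in> VT"
    have z: "z dvd 1" using z by (simp add: unit_group_def)
    note zG = GL_scalar[OF z, of 2]
    have "S (rep_act \<tau> (z \<cdot>\<^sub>m 1\<^sub>m 2) v) = S (rep_scale \<tau> (central z) v)"
      unfolding S_act[OF v zG] S_scale[OF v] by (rule whittaker_central[OF intertwinerD(1)[OF S v] z])
    then show "rep_act \<tau> (z \<cdot>\<^sub>m 1\<^sub>m 2) v = rep_scale \<tau> (central z) v"
      by (rule inj[OF T.act_V[OF zG v] T.sc_V[OF v]])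
  qed (rule central_character)
  ultimately show "regular_rep \<omega> red \<psi> 2 \<tau> \<and> has_central_character 2 \<tau> central" ..
next
  assume "regular_rep \<omega> red \<psi> 2 \<tau> \<and> has_central_character 2 \<tau> central"
  then have reg: "regular_rep \<omega> red \<psi> 2 \<tau>" and cent: "has_central_character 2 \<tau> central" by auto
  interpret W: vector_space "rep_scale whittaker" by (rule vector_space_whittaker)
  have central_T: "rep_act \<tau> (z \<cdot>\<^sub>m 1\<^sub>m 2) v = rep_scale \<tau> (central z) v" if "z dvd 1" "v \<in> VT" for z v
    using cent that by (simp add: has_central_character_def unit_group_def)
  have "rep_act \<tau> (congr (mat2 a 0 0 a)) v = rep_scale \<tau> (e (trace_exponent * a)) v" if "v \<in> VT" for a v
  proof -
    have "congr (mat2 a 0 0 a) = (1 + eps a) \<cdot>\<^sub>m 1\<^sub>m 2"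
      by (simp add: congr_def mat2_one mat2_add mat2_smult)
    then show ?thesis using central_T[OF unit_eps that] by (simp add: central_eps)
  qed
  then obtain l u where l: "T.triangular_functional trace_exponent l" and u: "u \<in> VT" "l u \<noteq> 0"
    using T.regular_triangular_functional[OF reg] by blast
  define S where "S = realization l"
  have S: "intertwiner (GL 2) \<tau> whittaker S"
    unfolding S_def by (rule realization_intertwiner[OF l central_T])
  note S_scale = intertwiner_scale[OF S] and S_act = intertwiner_act[OF S]
  have S_0: "S 0 = 0" using S_scale[of 0 0] by simp
  have "lam (S u perm4) = l u" unfolding S_def by (rule lam_realization[OF l central_T u(1)])
  then have "S u \<noteq> 0" using u(2) lam_0 by auto
  then have inj: "inj_on S VT" by (rule intertwiner_injective[OF S u(1)])
  have "invariant_subspace (GL 2) whittaker (S ` VT)"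
    unfolding invariant_subspace_def
  proof (intro conjI ballI)
    show "W.subspace (S ` VT)"
      unfolding W.subspace_def
    proof (intro conjI ballI allI)
      show "0 \<in> S ` VT" using S_0 T.zero_V by (metis imageI)
      show "x + y \<in> S ` VT" if "x \<in> S ` VT" "y \<in> S ` VT" for x y
        using that by (auto simp: intertwinerD(2)[OF S, symmetric])
      show "rep_scale whittaker c x \<in> S ` VT" if "x \<in> S ` VT" for c x
        using that by (auto simp: S_scale[symmetric])
    qed
    show "S ` VT \<subseteq> rep_space whittaker" using intertwinerD(1)[OF S] by blast
    show "rep_act whittaker d x \<in> S ` VT" if "d \<in> carrier (GL 2)" "x \<in> S ` VT" for d x
      using that by (auto simp: S_act[symmetric])
  qed
  moreover have "intertwiner (GL 2) \<tau> (subrep whittaker (S ` VT)) S"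
    using S by (auto simp: intertwiner_def subrep_def)
  moreover have "bij_betw S VT (rep_space (subrep whittaker (S ` VT)))"
    using inj by (simp add: subrep_def inj_on_imp_bij_betw)
  ultimately show "occurs_in (GL 2) \<tau> whittaker"
    unfolding occurs_in_def equivalent_reps_def by blast
qed

end

context whittaker_model
begin

text \<open>By \<open>intertwiner_unique\<close> every intertwiner from an irreducible subspace is a multiple of the
  inclusion.\<close>

lemma multiplicity_free_whittaker: "multiplicity_free (GL 2) whittaker"
  unfolding multiplicity_free_def
proof (intro allI impI)
  fix W assume "invariant_subspace (GL 2) whittaker W \<and> irreducible_rep (GL 2) (subrep whittaker W)"
  then have W: "invariant_subspace (GL 2) whittaker W" and irr: "irreducible_rep (GL 2) (subrep whittaker W)"
    by auto
  define \<tau> where "\<tau> = subrep whittaker W"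
  have fd: "finite_dim_rep (GL 2) \<tau>" using irr by (simp add: irreducible_rep_def \<tau>_def)
  interpret T: fin_dim_representation "GL 2 :: 'r mat monoid" \<tau>
    by (rule fin_dim_representation.intro[OF group_GL fd])
  interpret T: irreducible_representation "GL 2 :: 'r mat monoid" \<tau>
    by unfold_locales (use irr in \<open>simp add: \<tau>_def\<close>)
  interpret whittaker_irreducible \<omega> red \<psi> \<rho> c0 c1 t \<phi> lam \<chi> \<tau>
    by unfold_locales
  interpret Wv: vector_space "rep_scale whittaker" by (rule vector_space_whittaker)
  have space: "rep_space \<tau> = W" by (simp add: \<tau>_def subrep_def)
  let ?scale = "\<lambda>c (S :: ('r mat \<Rightarrow> 'v) \<Rightarrow> 'r mat \<Rightarrow> 'v) w. rep_scale whittaker c (S w)"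
  interpret H: vector_space ?scale
    by unfold_locales
      (simp_all add: fun_eq_iff rep_scale_whittaker \<rho>.vs.scale_right_distrib \<rho>.vs.scale_left_distrib)
  define Hom where "Hom = {S. intertwiner (GL 2) \<tau> whittaker S \<and> (\<forall>w. w \<notin> rep_space \<tau> \<longrightarrow> S w = 0)}"
  define S0 where "S0 w = (if w \<in> W then w else 0)" for w
  have Wsub: "Wv.subspace W" "W \<subseteq> rep_space whittaker"
    "\<And>d w. d \<in> carrier (GL 2) \<Longrightarrow> w \<in> W \<Longrightarrow> rep_act whittaker d w \<in> W"
    using W by (auto simp: invariant_subspace_def)
  have S0: "S0 \<in> Hom"
    using Wsub Wv.subspace_add[OF Wsub(1)] Wv.subspace_scale[OF Wsub(1)]
    by (auto simp: Hom_def intertwiner_def S0_def space \<tau>_def subrep_def)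
  obtain u where u: "u \<in> W" "u \<noteq> 0"
    using irr Wv.subspace_0[OF Wsub(1)] by (auto simp: irreducible_rep_def subrep_def)
  have "S0 u \<noteq> 0" using u by (simp add: S0_def)
  then have S0_nz: "S0 \<noteq> 0" by auto
  have "\<exists>a. S = ?scale a S0" if "S \<in> Hom" for S
  proof -
    have S: "intertwiner (GL 2) \<tau> whittaker S" "intertwiner (GL 2) \<tau> whittaker S0"
      using that S0 by (auto simp: Hom_def)
    obtain a where a: "\<And>v. v \<in> rep_space \<tau> \<Longrightarrow> S v = rep_scale whittaker a (S0 v)"
      using intertwiner_unique[OF S(2) _ \<open>S0 u \<noteq> 0\<close> S(1)] u(1) space by blast
    have "S w = rep_scale whittaker a (S0 w)" for w
      using a[of w] that by (cases "w \<in> W") (auto simp: Hom_def S0_def space)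
    then show ?thesis by blast
  qed
  then have "Hom \<subseteq> H.span {S0}"
    by (auto simp: H.span_singleton)
  moreover have "H.independent {S0}" using S0_nz by simp
  ultimately have "H.dim Hom = 1"
    using S0 by (intro H.dim_unique[of "{S0}"]) auto
  then show "multiplicity_in (GL 2) (subrep whittaker W) whittaker = 1"
    by (simp add: multiplicity_in_def Hom_def \<tau>_def)
qed

end

section \<open>Rings of integers modulo the square of a uniformizer\<close>

lemma one_in_integers:
  fixes R :: "'f :: field set"
  assumes "integers_of_unramified_extension TYPE('p :: prime_card) R"
  shows "1 \<in> R"
proof -
  have one: "1 \<in> integral_closure \<iota> A"
    if "field_hom \<iota>" "0 \<in> A" "1 \<in> A" "- 1 \<in> A" for \<iota> :: "'a :: field \<Rightarrow> 'f" and A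
  proof -
    interpret \<iota>: field_hom \<iota> by fact
    show ?thesis
      unfolding integral_closure_def
    proof (intro CollectI exI[of _ "[:- 1, 1:]"] conjI allI)
      show "Polynomial.coeff [:- 1, 1:] i \<in> A" for i
        using that by (auto simp: coeff_pCons split: nat.split)
      show "poly (map_poly \<iota> [:- 1, 1:]) 1 = 0"
        by (simp add: map_poly_pCons \<iota>.hom_uminus)
    qed simp
  qed
  have padic: "0 \<in> padic_integers" "1 \<in> padic_integers" "- 1 \<in> (padic_integers :: 'p padic set)"
    unfolding padic_integers_def
    by (auto simp: Zero_fract_def One_fract_def intro: range_eqI[of _ _ 0] range_eqI[of _ _ 1] range_eqI[of _ _ "- 1"])
  have fps: "0 \<in> range fps_to_fls" "1 \<in> range fps_to_fls"
    "- 1 \<in> range (fps_to_fls :: 'p mod_ring fps \<Rightarrow> 'p mod_ring fls)"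
    by (auto intro: range_eqI[of _ _ 0] range_eqI[of _ _ 1] range_eqI[of _ _ "- 1"])
  from assms consider
      \<iota> :: "'p padic \<Rightarrow> 'f" where "field_hom \<iota>" "R = integral_closure \<iota> padic_integers"
    | \<iota> :: "'p mod_ring fls \<Rightarrow> 'f" where "field_hom \<iota>" "R = integral_closure \<iota> (range fps_to_fls)"
    unfolding integers_of_unramified_extension_def finite_unramified_extension_def finite_extension_def
    by metis
  then show ?thesis
  proof cases
    case 1
    show ?thesis unfolding 1(2) by (rule one[OF 1(1) padic])
  next
    case 2
    show ?thesis unfolding 2(2) by (rule one[OF 2(1) fps])
  qed
qed

lemma quotient_length_two:
  fixes R :: "'f :: field set" and proj :: "'f \<Rightarrow> 'r :: comm_ring_1" and red :: "'r \<Rightarrow> 'k :: {field, finite}"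
  assumes one: "1 \<in> R" and unif: "uniformizer R p"
    and q2: "quotient_map R (p ^ 2) proj" and q1: "quotient_map R p (red \<circ> proj)"
  shows "length_two_ring (proj p) red"
proof -
  have p0: "p \<noteq> 0" using unif by (simp add: uniformizer_def)
  have pR: "p * x \<in> R" if "x \<in> R" for x
    using unif that unfolding uniformizer_def by blast
  have pR1: "p \<in> R" using pR[OF one] by simp
  have surj: "\<exists>x \<in> R. r = proj x" for r
    using q2 unfolding quotient_map_def by (metis UNIV_I imageE)
  have hom: "proj (x + y) = proj x + proj y" "proj (x * y) = proj x * proj y"
    "red (proj (x + y)) = red (proj x) + red (proj y)" "red (proj (x * y)) = red (proj x) * red (proj y)"
    if "x \<in> R" "y \<in> R" for x y
    using q1 q2 that by (auto simp: quotient_map_def)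
  show ?thesis
  proof
    fix r s :: 'r
    obtain x where x: "x \<in> R" "r = proj x" using surj by blast
    obtain y where y: "y \<in> R" "s = proj y" using surj by blast
    show "red (r + s) = red r + red s" "red (r * s) = red r * red s"
      using hom x y by metis+
    have "red r = 0 \<longleftrightarrow> (\<exists>y \<in> R. x = p * y)"
      using q1 x by (auto simp: quotient_map_def)
    also have "\<dots> \<longleftrightarrow> (\<exists>s. r = proj p * s)"
    proof
      assume "\<exists>y \<in> R. x = p * y"
      then show "\<exists>s. r = proj p * s" using hom(2)[OF pR1] x by auto
    next
      assume "\<exists>s. r = proj p * s"
      then obtain z where z: "z \<in> R" "r = proj (p * z)" using surj hom(2)[OF pR1] by metis
      then have "red (proj (p * z)) = 0"
        using q1 pR[OF z(1)] z(1) unfolding quotient_map_def by fastforce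
      then have "red (proj x) = 0" using x z by simp
      then show "\<exists>y \<in> R. x = p * y" using q1 x by (auto simp: quotient_map_def)
    qed
    finally show "red r = 0 \<longleftrightarrow> (\<exists>s. r = proj p * s)" .
    have "proj p * r = 0 \<longleftrightarrow> proj (p * x) = 0" using hom(2)[OF pR1 x(1)] x by simp
    also have "\<dots> \<longleftrightarrow> (\<exists>y \<in> R. p * x = p ^ 2 * y)"
      using q2 pR[OF x(1)] by (auto simp: quotient_map_def)
    also have "\<dots> \<longleftrightarrow> (\<exists>y \<in> R. x = p * y)"
      using p0 by (simp add: power2_eq_square mult.assoc)
    also have "\<dots> \<longleftrightarrow> red r = 0"
      using q1 x by (auto simp: quotient_map_def)
    finally show "proj p * r = 0 \<longleftrightarrow> red r = 0" .
  next
    show "red 1 = 1" using q1 q2 by (simp add: quotient_map_def)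
    show "range red = UNIV"
    proof -
      have "(red \<circ> proj) ` R = UNIV" using q1 by (simp add: quotient_map_def)
      then show ?thesis by (auto simp: image_comp[symmetric])
    qed
  qed
qed

theorem corollary1p5:
  fixes \<oo> :: "'f :: field set" and \<pi>\<^sub>F :: 'f
    and proj :: "'f \<Rightarrow> 'r :: comm_ring_1" and red :: "'r \<Rightarrow> 'k :: {field, finite}"
    and \<psi>\<^sub>0 :: "'r \<Rightarrow> complex"
    and \<rho> :: "('r mat, 'v :: ab_group_add) rep" and \<chi> :: "'r \<Rightarrow> complex"
  assumes "odd CARD('p :: prime_card)"
    and "integers_of_unramified_extension TYPE('p) \<oo>"
    and "uniformizer \<oo> \<pi>\<^sub>F"
    and "quotient_map \<oo> (\<pi>\<^sub>F ^ 2) proj"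
    and "quotient_map \<oo> \<pi>\<^sub>F (red \<circ> proj)"
    and "\<forall>x. \<psi>\<^sub>0 x \<noteq> 0" and "\<forall>x y. \<psi>\<^sub>0 (x + y) = \<psi>\<^sub>0 x * \<psi>\<^sub>0 y"
    and "\<exists>x. \<psi>\<^sub>0 (proj \<pi>\<^sub>F * x) \<noteq> 1"
    and "strongly_cuspidal (proj \<pi>\<^sub>F) red \<psi>\<^sub>0 3 \<rho>"
    and "character unit_group \<chi>"
  shows "let \<pi> = induced_rep (GL 4) parabolic_3_1 (inflated_rep \<rho> \<chi>);
             W = degenerate_whittaker \<psi>\<^sub>0 \<pi>
         in \<exists>\<omega>. has_central_character 4 \<pi> \<omega> \<and>
              (\<forall>\<tau> :: ('r mat, 'w :: ab_group_add) rep. irreducible_rep (GL 2) \<tau> \<longrightarrow>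
                 (occurs_in (GL 2) \<tau> W \<longleftrightarrow>
                    regular_rep (proj \<pi>\<^sub>F) red \<psi>\<^sub>0 2 \<tau> \<and> has_central_character 2 \<tau> \<omega>)) \<and>
              multiplicity_free (GL 2) W"
proof -
  interpret length_two_ring "proj \<pi>\<^sub>F" red
    by (rule quotient_length_two[OF one_in_integers[OF assms(2)] assms(3-5)])
  interpret length_two_ring_character "proj \<pi>\<^sub>F" red \<psi>\<^sub>0
    by unfold_locales (use assms(6-8) in auto)
  obtain c0 c1 t \<phi> lam where "cuspidal_functional (proj \<pi>\<^sub>F) red \<psi>\<^sub>0 \<rho> c0 c1 t \<phi> lam"
    by (rule strongly_cuspidal_functional[OF assms(9)])
  then interpret cuspidal_functional "proj \<pi>\<^sub>F" red \<psi>\<^sub>0 \<rho> c0 c1 t \<phi> lam .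
  interpret whittaker_model "proj \<pi>\<^sub>F" red \<psi>\<^sub>0 \<rho> c0 c1 t \<phi> lam \<chi>
    by unfold_locales (rule assms(10))
  have "occurs_in (GL 2) \<tau> whittaker \<longleftrightarrow>
      regular_rep (proj \<pi>\<^sub>F) red \<psi>\<^sub>0 2 \<tau> \<and> has_central_character 2 \<tau> central"
    if irr: "irreducible_rep (GL 2) \<tau>" for \<tau> :: "('r mat, 'w) rep"
  proof -
    have fd: "finite_dim_rep (GL 2) \<tau>" using irr by (simp add: irreducible_rep_def)
    interpret T: fin_dim_representation "GL 2 :: 'r mat monoid" \<tau>
      by (rule fin_dim_representation.intro[OF group_GL fd])
    interpret T: irreducible_representation "GL 2 :: 'r mat monoid" \<tau>
      by unfold_locales (rule irr)
    interpret whittaker_irreducible "proj \<pi>\<^sub>F" red \<psi>\<^sub>0 \<rho> c0 c1 t \<phi> lam \<chi> \<tau>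
      by unfold_locales
    show ?thesis by (rule occurs_iff_regular)
  qed
  then show ?thesis
    unfolding Let_def induced_def[symmetric] whittaker_def[symmetric]
    using induced_central_character multiplicity_free_whittaker by blast
qed

end
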